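(* Let $\omega$ be such that boolean matrix multiplication of size $n\times n\times n$ can be solved in $n^{\omega+o(1)}$ time. Then Acyclic Simulation of order $n$ and Acyclic 2TRG Winning Set of order $n\times n$ can be computed in $n^{\omega+o(1)}$ time.
   Context: A game-graph is $\mathcal G=(\mathcal V,\mathcal E,\mathcal V^0,\mathcal V^1)$: finite configurations $\mathcal V$, moves $\mathcal E\subseteq\mathcal V\times\mathcal V$, and a partition of $\mathcal V$ into configurations controlled by player 0 (Alice) and player 1 (Bob). A play is a non-empty finite or infinite walk in $(\mathcal V,\mathcal E)$. A strategy for player $P$ is a map $s\colon\mathcal V^P\to\mathcal V\cup\{\bot\}$ with $(\sigma,s(\sigma))\in\mathcal E$ or $s(\sigma)=\bot$; a play conforms to $s$ if at each $\sigma_i\in\mathcal V^P$ either $\sigma_{i+1}=s(\sigma_i)\ne\bot$, or $s(\sigma_i)=\bot$ and $\sigma_i$ is the last configuration. A reachability game is $(\mathcal G,\mathcal F)$ with $\mathcal F=(\mathcal F^0,\mathcal F^1)$ a partition of $\mathcal V$. A play is winning for $P$ if finite with last configuration in $\mathcal F^P$, surviving for $P$ if winning for $P$ or infinite. $\mathcal W^P$ (resp. $\mathcal S^P$) is the set of configurations $\sigma_0$ from which $P$ has a strategy all of whose conforming plays from $\sigma_0$ are winning (resp. surviving) for $P$. For finite directed graphs $G_0=(V_0,E_0)$, $G_1=(V_1,E_1)$, $\mathcal G(G_0,G_1)$ has configurations $\mathcal V^P=\{\langle P,u,v\rangle:u\in V_P,v\in V_{1-P}\}$ and moves $(\langle P,u,v\rangle,\langle1-P,v,u'\rangle)$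 for $(u,u')\in E_P$, $v\in V_{1-P}$. Acyclic 2TRG Winning Set of order $|V_0|\times|V_1|$: given acyclic $G_0,G_1$ and a partition $\mathcal F$, compute the winning and surviving sets of $(\mathcal G(G_0,G_1),\mathcal F)$. A Kripke structure is $(S,T,L)$ with finite state set $S$, transitions $T\subseteq S\times S$ and labeling $L$. Its simulation game is the reachability game on $\mathcal G(G,G)$, $G=(S,T)$, with $\mathcal F^1=\{\langle0,s,t\rangle:L(s)=L(t)\}$ and $\mathcal F^0$ the complement; $t$ simulates $s$ iff $\langle0,s,t\rangle\in\mathcal S^1$. Acyclic Simulation of order $|S|$: given $(S,T,L)$ with $(S,T)$ acyclic, compute the relation "$t$ simulates $s$" on $S\times S$. Boolean matrix multiplication: $(\mathbf B_1\star\mathbf B_2)[i,j]=\bigvee_k\mathbf B_1[i,k]\wedge\mathbf B_2[k,j]$. *)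

theory Defs
  imports
    Complex_Main
    "HOL-Library.Landau_Symbols"
    "HOL-Library.Log_Nat"
    "Graph_Theory.Pair_Digraph"
begin

section \<open>Reachability games\<close>

datatype player = Alice | Bob

fun opp :: "player \<Rightarrow> player" where
  "opp Alice = Bob"
| "opp Bob = Alice"

definition bipartition :: "'c set \<Rightarrow> (player \<Rightarrow> 'c set) \<Rightarrow> bool" where
  "bipartition V F \<longleftrightarrow> F Alice \<union> F Bob = V \<and> F Alice \<inter> F Bob = {}"

record 'c game_graph =
  confs :: "'c set"
  moves :: "'c rel"
  controlled :: "player \<Rightarrow> 'c set"

definition wf_game_graph :: "'c game_graph \<Rightarrow> bool" where
  "wf_game_graph G \<longleftrightarrow>
     finite (confs G) \<and> moves G \<subseteq> confs G \<times> confs G \<and> bipartition (confs G) (controlled G)"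

datatype 'c play = FinPlay "'c list" | InfPlay "nat \<Rightarrow> 'c"

fun is_play :: "'c game_graph \<Rightarrow> 'c play \<Rightarrow> bool" where
  "is_play G (FinPlay xs) \<longleftrightarrow>
     xs \<noteq> [] \<and> set xs \<subseteq> confs G \<and> (\<forall>i. Suc i < length xs \<longrightarrow> (xs ! i, xs ! Suc i) \<in> moves G)"
| "is_play G (InfPlay p) \<longleftrightarrow> range p \<subseteq> confs G \<and> (\<forall>i. (p i, p (Suc i)) \<in> moves G)"

fun start :: "'c play \<Rightarrow> 'c" where
  "start (FinPlay xs) = hd xs"
| "start (InfPlay p) = p 0"

text \<open>The value \<open>None\<close> of a strategy plays the role of \<open>\<bottom>\<close> (stop). It may be chosen
  even where a move exists; values outside the player's own configurations are irrelevant.\<close>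

definition is_strategy :: "'c game_graph \<Rightarrow> player \<Rightarrow> ('c \<Rightarrow> 'c option) \<Rightarrow> bool" where
  "is_strategy G P s \<longleftrightarrow> (\<forall>\<sigma>\<in>controlled G P. \<forall>\<tau>. s \<sigma> = Some \<tau> \<longrightarrow> (\<sigma>, \<tau>) \<in> moves G)"

fun conforms :: "'c game_graph \<Rightarrow> player \<Rightarrow> ('c \<Rightarrow> 'c option) \<Rightarrow> 'c play \<Rightarrow> bool" where
  "conforms G P s (FinPlay xs) \<longleftrightarrow>
     (\<forall>i < length xs. xs ! i \<in> controlled G P \<longrightarrow>
        (Suc i < length xs \<and> s (xs ! i) = Some (xs ! Suc i)) \<or>
        (Suc i = length xs \<and> s (xs ! i) = None))"
| "conforms G P s (InfPlay p) \<longleftrightarrow> (\<forall>i. p i \<in> controlled G P \<longrightarrow> s (p i) = Some (p (Suc i)))"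

fun winning_play :: "(player \<Rightarrow> 'c set) \<Rightarrow> player \<Rightarrow> 'c play \<Rightarrow> bool" where
  "winning_play F P (FinPlay xs) \<longleftrightarrow> last xs \<in> F P"
| "winning_play F P (InfPlay p) \<longleftrightarrow> False"

definition surviving_play :: "(player \<Rightarrow> 'c set) \<Rightarrow> player \<Rightarrow> 'c play \<Rightarrow> bool" where
  "surviving_play F P \<pi> \<longleftrightarrow> winning_play F P \<pi> \<or> (\<exists>p. \<pi> = InfPlay p)"

definition winning_set :: "'c game_graph \<Rightarrow> (player \<Rightarrow> 'c set) \<Rightarrow> player \<Rightarrow> 'c set" where
  "winning_set G F P = {\<sigma>\<in>confs G. \<exists>s. is_strategy G P s \<and>
     (\<forall>\<pi>. is_play G \<pi> \<and> start \<pi> = \<sigma> \<and> conforms G P s \<pi> \<longrightarrow> winning_play F P \<pi>)}"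

definition surviving_set :: "'c game_graph \<Rightarrow> (player \<Rightarrow> 'c set) \<Rightarrow> player \<Rightarrow> 'c set" where
  "surviving_set G F P = {\<sigma>\<in>confs G. \<exists>s. is_strategy G P s \<and>
     (\<forall>\<pi>. is_play G \<pi> \<and> start \<pi> = \<sigma> \<and> conforms G P s \<pi> \<longrightarrow> surviving_play F P \<pi>)}"


section \<open>Two-token games and simulation games\<close>

text \<open>In a configuration \<open>(P, u, v)\<close> it is the turn of \<open>P\<close>, whose own token is on \<open>u\<close>.\<close>

definition two_token_graph ::
    "'v pair_pre_digraph \<Rightarrow> 'v pair_pre_digraph \<Rightarrow> (player \<times> 'v \<times> 'v) game_graph" where
  "two_token_graph G0 G1 =
     (let G = case_player G0 G1;
          C = (\<lambda>P. {(P, u, v) | u v. u \<in> pverts (G P) \<and> v \<in> pverts (G (opp P))})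
      in \<lparr> confs = C Alice \<union> C Bob,
           moves = {((P, u, v), (opp P, v, u')) | P u u' v.
                      (u, u') \<in> parcs (G P) \<and> v \<in> pverts (G (opp P))},
           controlled = C \<rparr>)"

lemma wf_two_token_graph:
  assumes "pair_fin_digraph G0" and "pair_fin_digraph G1"
  shows "wf_game_graph (two_token_graph G0 G1)"
proof -
  interpret G0: pair_fin_digraph G0 by fact
  interpret G1: pair_fin_digraph G1 by fact
  have "confs (two_token_graph G0 G1) \<subseteq>
      {Alice, Bob} \<times> (pverts G0 \<union> pverts G1) \<times> (pverts G0 \<union> pverts G1)"
    by (auto simp: two_token_graph_def Let_def)
  then have "finite (confs (two_token_graph G0 G1))"
    by (rule finite_subset) (simp add: G0.pair_finite_verts G1.pair_finite_verts)
  moreover have "moves (two_token_graph G0 G1) \<subseteq>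
      confs (two_token_graph G0 G1) \<times> confs (two_token_graph G0 G1)"
  proof
    fix m assume "m \<in> moves (two_token_graph G0 G1)"
    then obtain P u u' v where m: "m = ((P, u, v), (opp P, v, u'))"
        "(u, u') \<in> parcs (case_player G0 G1 P)" "v \<in> pverts (case_player G0 G1 (opp P))"
      by (auto simp: two_token_graph_def Let_def)
    then show "m \<in> confs (two_token_graph G0 G1) \<times> confs (two_token_graph G0 G1)"
      by (cases P) (auto simp: two_token_graph_def Let_def dest: G0.wellformed' G1.wellformed')
  qed
  moreover have "bipartition (confs (two_token_graph G0 G1)) (controlled (two_token_graph G0 G1))"
    by (auto simp: bipartition_def two_token_graph_def Let_def)
  ultimately show ?thesis
    by (simp add: wf_game_graph_def)
qed

record ('s, 'l) kripke =
  states :: "'s set"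
  transitions :: "'s rel"
  labeling :: "'s \<Rightarrow> 'l"

definition kripke_graph :: "('s, 'l) kripke \<Rightarrow> 's pair_pre_digraph" where
  "kripke_graph K = \<lparr> pverts = states K, parcs = transitions K \<rparr>"

definition simulation_graph :: "('s, 'l) kripke \<Rightarrow> (player \<times> 's \<times> 's) game_graph" where
  "simulation_graph K = two_token_graph (kripke_graph K) (kripke_graph K)"

definition simulation_final :: "('s, 'l) kripke \<Rightarrow> player \<Rightarrow> (player \<times> 's \<times> 's) set" where
  "simulation_final K =
     (let B = {(Alice, s, t) | s t. s \<in> states K \<and> t \<in> states K \<and> labeling K s = labeling K t}
      in case_player (confs (simulation_graph K) - B) B)"

definition simulates :: "('s, 'l) kripke \<Rightarrow> 's \<Rightarrow> 's \<Rightarrow> bool" where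
  "simulates K t s \<longleftrightarrow>
     (Alice, s, t) \<in> surviving_set (simulation_graph K) (simulation_final K) Bob"

lemma bipartition_simulation_final:
  "bipartition (confs (simulation_graph K)) (simulation_final K)"
  by (auto simp: bipartition_def Let_def simulation_final_def simulation_graph_def two_token_graph_def
      kripke_graph_def)


section \<open>Random access machines with logarithmic cost\<close>

text \<open>A structured random access machine: registers and zero-based arrays, both named by natural
  numbers, holding natural numbers of arbitrary size. Every instruction is charged
  the total bit length of the numbers it handles (array indices included) plus one, so that
  operating on large numbers is not free. A program mentions finitely many
  registers and arrays, and array names are never computed.\<close>

datatype binop = Add | Sub | Mul | Div | Mod

fun binop_val :: "binop \<Rightarrow> nat \<Rightarrow> nat \<Rightarrow> nat" where
  "binop_val Add a b = a + b"
| "binop_val Sub a b = a - b"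
| "binop_val Mul a b = a * b"
| "binop_val Div a b = a div b"
| "binop_val Mod a b = a mod b"

datatype com =
    Skip
  | Const nat nat             \<comment> \<open>\<open>Const r k\<close>: \<open>r := k\<close>\<close>
  | Binop binop nat nat nat   \<comment> \<open>\<open>Binop f r p q\<close>: \<open>r := f p q\<close>\<close>
  | Load nat nat nat          \<comment> \<open>\<open>Load r a i\<close>: \<open>r := a[i]\<close>, the register \<open>i\<close> holding the index\<close>
  | Store nat nat nat         \<comment> \<open>\<open>Store a i r\<close>: \<open>a[i] := r\<close>\<close>
  | Seq com com
  | Cond nat com com          \<comment> \<open>the test is whether the register is nonzero\<close>
  | While nat com

record state =
  reg :: "nat \<Rightarrow> nat"
  arr :: "nat \<Rightarrow> nat \<Rightarrow> nat"

abbreviation bits :: "nat \<Rightarrow> nat" where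
  "bits \<equiv> floorlog 2"

text \<open>\<open>exec c \<sigma> t \<tau>\<close>: started in \<open>\<sigma>\<close>, the program \<open>c\<close> halts in \<open>\<tau>\<close> after time \<open>t\<close>.\<close>

inductive exec :: "com \<Rightarrow> state \<Rightarrow> nat \<Rightarrow> state \<Rightarrow> bool" where
  Skip: "exec Skip \<sigma> 1 \<sigma>"
| Const: "exec (Const r k) \<sigma> (1 + bits k) (\<sigma>\<lparr>reg := (reg \<sigma>)(r := k)\<rparr>)"
| Binop: "exec (Binop f r p q) \<sigma> (1 + bits (reg \<sigma> p) + bits (reg \<sigma> q))
            (\<sigma>\<lparr>reg := (reg \<sigma>)(r := binop_val f (reg \<sigma> p) (reg \<sigma> q))\<rparr>)"
| Load: "exec (Load r a i) \<sigma> (1 + bits (reg \<sigma> i) + bits (arr \<sigma> a (reg \<sigma> i)))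
           (\<sigma>\<lparr>reg := (reg \<sigma>)(r := arr \<sigma> a (reg \<sigma> i))\<rparr>)"
| Store: "exec (Store a i r) \<sigma> (1 + bits (reg \<sigma> i) + bits (reg \<sigma> r))
            (\<sigma>\<lparr>arr := (arr \<sigma>)(a := (arr \<sigma> a)(reg \<sigma> i := reg \<sigma> r))\<rparr>)"
| Seq: "exec c \<sigma> t \<rho> \<Longrightarrow> exec d \<rho> u \<tau> \<Longrightarrow> exec (Seq c d) \<sigma> (t + u) \<tau>"
| CondTrue: "reg \<sigma> r \<noteq> 0 \<Longrightarrow> exec c \<sigma> t \<tau> \<Longrightarrow> exec (Cond r c d) \<sigma> (1 + bits (reg \<sigma> r) + t) \<tau>"
| CondFalse: "reg \<sigma> r = 0 \<Longrightarrow> exec d \<sigma> t \<tau> \<Longrightarrow> exec (Cond r c d) \<sigma> (1 + t) \<tau>"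
| WhileFalse: "reg \<sigma> r = 0 \<Longrightarrow> exec (While r c) \<sigma> 1 \<sigma>"
| WhileTrue: "reg \<sigma> r \<noteq> 0 \<Longrightarrow> exec c \<sigma> t \<rho> \<Longrightarrow> exec (While r c) \<rho> u \<tau> \<Longrightarrow>
    exec (While r c) \<sigma> (1 + bits (reg \<sigma> r) + t + u) \<tau>"

inductive_cases exec_elims:
  "exec Skip \<sigma> t \<tau>" "exec (Const r k) \<sigma> t \<tau>" "exec (Binop f r p q) \<sigma> t \<tau>"
  "exec (Load r a i) \<sigma> t \<tau>" "exec (Store a i r) \<sigma> t \<tau>" "exec (Seq c d) \<sigma> t \<tau>"
  "exec (Cond r c d) \<sigma> t \<tau>" "exec (While r c) \<sigma> t \<tau>"

lemma exec_deterministic: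
  "exec c \<sigma> t \<tau> \<Longrightarrow> exec c \<sigma> t' \<tau>' \<Longrightarrow> t' = t \<and> \<tau>' = \<tau>"
proof (induction arbitrary: t' \<tau>' rule: exec.induct)
  case (Seq c \<sigma> t \<rho> d u \<tau>)
  from Seq.prems obtain t1 \<rho>1 u1
    where "exec c \<sigma> t1 \<rho>1" "exec d \<rho>1 u1 \<tau>'" "t' = t1 + u1"
    by (auto elim: exec_elims)
  with Seq.IH show ?case by metis
next
  case (CondTrue \<sigma> r c t \<tau> d)
  from CondTrue.prems CondTrue.hyps obtain t1
    where "exec c \<sigma> t1 \<tau>'" "t' = 1 + bits (reg \<sigma> r) + t1"
    by (auto elim: exec_elims)
  with CondTrue.IH show ?case by metis
next
  case (CondFalse \<sigma> r d t \<tau> c)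
  from CondFalse.prems CondFalse.hyps obtain t1 where "exec d \<sigma> t1 \<tau>'" "t' = 1 + t1"
    by (auto elim: exec_elims)
  with CondFalse.IH show ?case by metis
next
  case (WhileFalse \<sigma> r c)
  then show ?case by (auto elim: exec_elims)
next
  case (WhileTrue \<sigma> r c t \<rho> u \<tau>)
  from WhileTrue.prems WhileTrue.hyps(1) obtain t1 \<rho>1 u1
    where "exec c \<sigma> t1 \<rho>1" "exec (While r c) \<rho>1 u1 \<tau>'" "t' = 1 + bits (reg \<sigma> r) + t1 + u1"
    by (auto elim: exec_elims(8))
  with WhileTrue.IH show ?case by metis
qed (auto elim: exec_elims)

text \<open>The input is placed in array 0 and the output is expected in array 1; everything else is
  initially zero.\<close>

definition init_state :: "nat list \<Rightarrow> state" where
  "init_state x = \<lparr> reg = (\<lambda>_. 0),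
     arr = (\<lambda>_ _. 0)(0 := (\<lambda>i. if i < length x then x ! i else 0)) \<rparr>"

definition has_output :: "state \<Rightarrow> nat list \<Rightarrow> bool" where
  "has_output \<sigma> y \<longleftrightarrow> (\<forall>i < length y. arr \<sigma> 1 i = y ! i)"

text \<open>A problem assigns to every order \<open>n\<close> its instances of order \<open>n\<close>, as pairs of an encoded
  input and the encoded required output.\<close>

type_synonym problem = "nat \<Rightarrow> (nat list \<times> nat list) set"

definition computable_in_time :: "problem \<Rightarrow> (nat \<Rightarrow> nat) \<Rightarrow> bool" where
  "computable_in_time Q T \<longleftrightarrow> (\<exists>c. \<forall>n. \<forall>(x, y)\<in>Q n. \<exists>t \<sigma>.
     exec c (init_state x) t \<sigma> \<and> t \<le> T n \<and> has_output \<sigma> y)"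

text \<open>Computability in time \<open>n\<^bsup>\<omega>+o(1)\<^esup>\<close>.\<close>

definition computable_with_exponent :: "problem \<Rightarrow> real \<Rightarrow> bool" where
  "computable_with_exponent Q \<omega> \<longleftrightarrow> (\<exists>T \<epsilon>.
     computable_in_time Q T \<and> \<epsilon> \<in> o(\<lambda>_. 1) \<and>
     (\<forall>\<^sub>F n in sequentially. real (T n) \<le> real n powr (\<omega> + \<epsilon> n)))"


section \<open>The computational problems\<close>

text \<open>Vertices, states and matrix indices of an instance of order \<open>n\<close> are \<open>0, \<dots>, n - 1\<close>. Relations
  are given by their 0/1 matrices, in row-major order.\<close>

definition row_major :: "nat \<Rightarrow> (nat \<Rightarrow> nat \<Rightarrow> bool) \<Rightarrow> nat list" where
  "row_major n A = map (\<lambda>k. of_bool (A (k div n) (k mod n))) [0..<n * n]"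

definition encode_rel :: "nat \<Rightarrow> nat rel \<Rightarrow> nat list" where
  "encode_rel n R = row_major n (\<lambda>i j. (i, j) \<in> R)"

definition encode_confs :: "nat \<Rightarrow> (player \<times> nat \<times> nat) set \<Rightarrow> nat list" where
  "encode_confs n X =
     row_major n (\<lambda>u v. (Alice, u, v) \<in> X) @ row_major n (\<lambda>u v. (Bob, u, v) \<in> X)"

definition bool_mat_mult ::
    "nat \<Rightarrow> (nat \<Rightarrow> nat \<Rightarrow> bool) \<Rightarrow> (nat \<Rightarrow> nat \<Rightarrow> bool) \<Rightarrow> nat \<Rightarrow> nat \<Rightarrow> bool" where
  "bool_mat_mult n A B i j \<longleftrightarrow> (\<exists>k<n. A i k \<and> B k j)"

definition boolean_matrix_multiplication :: problem where
  "boolean_matrix_multiplication n =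
     {(n # row_major n A @ row_major n B, row_major n (bool_mat_mult n A B)) | A B. True}"

definition acyclic_2trg_winning_set :: problem where
  "acyclic_2trg_winning_set n =
     {(n # encode_rel n (parcs G0) @ encode_rel n (parcs G1) @ encode_confs n (F Bob),
       encode_confs n (winning_set (two_token_graph G0 G1) F Alice) @
       encode_confs n (winning_set (two_token_graph G0 G1) F Bob) @
       encode_confs n (surviving_set (two_token_graph G0 G1) F Alice) @
       encode_confs n (surviving_set (two_token_graph G0 G1) F Bob)) | G0 G1 F.
      pair_fin_digraph G0 \<and> pverts G0 = {0..<n} \<and> acyclic (parcs G0) \<and>
      pair_fin_digraph G1 \<and> pverts G1 = {0..<n} \<and> acyclic (parcs G1) \<and>
      bipartition (confs (two_token_graph G0 G1)) F}"

text \<open>Labels are numbers below \<open>n ^ d\<close>, that is, words of \<open>O(log n)\<close> bits. Without such a bound the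
  time to read the labels would not be controlled by the order.\<close>

definition acyclic_simulation :: "nat \<Rightarrow> problem" where
  "acyclic_simulation d n =
     {(n # encode_rel n (transitions K) @ map (labeling K) [0..<n],
       row_major n (\<lambda>s t. simulates K t s)) | K :: (nat, nat) kripke.
      pair_fin_digraph (kripke_graph K) \<and> states K = {0..<n} \<and> acyclic (transitions K) \<and>
      (\<forall>s<n. labeling K s < n ^ d)}"

end

theory Submission
  imports Defs "HOL-Real_Asymp.Real_Asymp"
begin

text \<open>
  On the disjoint union of the two graphs, the game takes the negamax form
  \<open>Z(u, v) \<longleftrightarrow> f(u, v) \<or> (\<exists>k. E(u, k) \<and> \<not> Z(v, k))\<close>, and since every play is finite, winning and
  surviving coincide. After padding to \<open>N = 2\<^sup>L\<close> vertices and sorting topologically, \<open>E(u, k)\<close>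
  implies \<open>k < u\<close>. The cells are then finalised in Morton order: whenever an aligned block of side
  \<open>s = 2\<^sup>j\<close> is complete, its contribution to the next block of rows is a product of two Boolean
  \<open>s \<times> s\<close> matrices. Level \<open>j\<close> needs \<open>2 \<cdot> 4\<^bsup>L-j\<^esup>\<close> products, and because the exponent is at least 2
  (the output alone has \<open>n\<^sup>2\<close> cells to be written), every level costs at most as much as one product of
  side \<open>N\<close>, up to constants.
  The given multiplication program expects a zeroed memory; instead of clearing its arrays, every
  call is given its own residue class of array indices.
\<close>


section \<open>The program logic\<close>

text \<open>The shape of the algorithm comes from a transposition in the recurrence: the value at
  \<open>(u, v)\<close> reads row \<open>v\<close> instead of row \<open>u\<close>. One update
  therefore multiplies a block of \<open>E\<close> by the transposed complement of a block of
  \<open>Z\<close>, and the order of evaluation has to settle a cell together with its mirror image;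
  an aligned block and its transpose are treated as a pair. Passing a block only to the next block
  of rows loses no arc, because at the highest binary digit in which \<open>u\<close> and
  \<open>k\<close> differ the two lie in neighbouring sibling blocks. A second obstacle is the error
  term in the exponent. The bound on the multiplication time is asymptotic, but products of every
  size \<open>2^j\<close> occur, also tiny ones. So an arbitrary \<delta> > 0 is fixed, the bound is
  made uniform in the size at the price of a constant, and the error term of the new program is
  recovered from the bounds for all \<delta>. The cost model charges bit lengths, hence every number
  handled has to stay polynomial in \<open>n\<close>. Elementary steps then cost O(log n), which
  together with the number of levels disappears in the error term.\<close>

datatype ex = Nm nat | Rg nat | Ar nat ex | Op binop ex ex

primrec val :: "ex \<Rightarrow> (nat \<Rightarrow> nat) \<Rightarrow> (nat \<Rightarrow> nat \<Rightarrow> nat) \<Rightarrow> nat" where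
  "val (Nm k) \<rho> \<alpha> = k"
| "val (Rg r) \<rho> \<alpha> = \<rho> r"
| "val (Ar a e) \<rho> \<alpha> = \<alpha> a (val e \<rho> \<alpha>)"
| "val (Op f d e) \<rho> \<alpha> = binop_val f (val d \<rho> \<alpha>) (val e \<rho> \<alpha>)"

primrec esize :: "ex \<Rightarrow> nat" where
  "esize (Nm k) = 1"
| "esize (Rg r) = 1"
| "esize (Ar a e) = esize e + 1"
| "esize (Op f d e) = esize d + esize e + 1"

primrec low_regs :: "ex \<Rightarrow> bool" where
  "low_regs (Nm k) = True"
| "low_regs (Rg r) = (r < 100)"
| "low_regs (Ar a e) = low_regs e"
| "low_regs (Op f d e) = (low_regs d \<and> low_regs e)"

text \<open>Only leaves are bounded: constants, registers and loaded cells. Results of operations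
  may exceed \<open>M\<close>; \<open>val_le_power\<close> controls them through the size of the
  expression.\<close>

primrec bounded :: "nat \<Rightarrow> ex \<Rightarrow> (nat \<Rightarrow> nat) \<Rightarrow> (nat \<Rightarrow> nat \<Rightarrow> nat) \<Rightarrow> bool" where
  "bounded M (Nm k) \<rho> \<alpha> = (k \<le> M)"
| "bounded M (Rg r) \<rho> \<alpha> = (\<rho> r \<le> M)"
| "bounded M (Ar a e) \<rho> \<alpha> = (bounded M e \<rho> \<alpha> \<and> \<alpha> a (val e \<rho> \<alpha>) \<le> M)"
| "bounded M (Op f d e) \<rho> \<alpha> = (bounded M d \<rho> \<alpha> \<and> bounded M e \<rho> \<alpha>)"

text \<open>Evaluation with a stack of registers: the value arrives in \<open>d\<close>, and only
  registers from \<open>d\<close> upwards are touched. As there is no copy instruction, a register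
  is added to a zeroed one, which costs nothing for the zero since
  \<open>bits 0 = 0\<close>.\<close>

primrec compile :: "ex \<Rightarrow> nat \<Rightarrow> com" where
  "compile (Nm k) d = Const d k"
| "compile (Rg r) d = Seq (Const d 0) (Binop Add d r d)"
| "compile (Ar a e) d = Seq (compile e d) (Load d a d)"
| "compile (Op f e e') d = Seq (compile e d) (Seq (compile e' (d + 1)) (Binop f d d (d + 1)))"

section \<open>Bit lengths and the cost of evaluating an expression\<close>

lemma bits_mono: "a \<le> b \<Longrightarrow> bits a \<le> bits b"
  by (simp add: floorlog_mono)

lemma bits_le_iff: "bits a \<le> k \<longleftrightarrow> a < 2 ^ k"
  by (simp add: floorlog_le_iff) 

lemma less_two_power_bits: "a < 2 ^ bits a"
  using bits_le_iff by blast

lemma bits_mult: "bits (a * b) \<le> bits a + bits b"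
  unfolding bits_le_iff power_add
  by (intro mult_strict_mono less_two_power_bits) auto

lemma bits_add: "bits (a + b) \<le> Suc (max (bits a) (bits b))"
proof -
  have "a < 2 ^ max (bits a) (bits b)" "b < 2 ^ max (bits a) (bits b)"
    by (rule less_le_trans[OF less_two_power_bits], simp)+
  then show ?thesis unfolding bits_le_iff by simp
qed

lemma bits_pos: "0 < a \<Longrightarrow> 1 \<le> bits a"
  by (metis One_nat_def Suc_leI bits_le_iff gr0I less_one not_le power_0)

lemma esize_pos: "1 \<le> esize e"
  by (induction e) auto

text \<open>Even a sum is at most twice the product of the bounds of its operands, and the factor 2
  is paid by one more power of \<open>M\<close>, which is the \<open>+ 1\<close> in
  \<open>esize\<close>.\<close>

lemma val_le_power:
  assumes "2 \<le> M" "bounded M e \<rho> \<alpha>"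
  shows "val e \<rho> \<alpha> \<le> M ^ esize e"
  using assms(2)
proof (induction e)
  case (Ar a e)
  then have "val (Ar a e) \<rho> \<alpha> \<le> M ^ 1" by simp
  also have "\<dots> \<le> M ^ esize (Ar a e)"
    using assms(1) by (intro power_increasing) auto
  finally show ?case .
next
  case (Op f d e)
  let ?x = "val d \<rho> \<alpha>" and ?y = "val e \<rho> \<alpha>"
  have IH: "?x \<le> M ^ esize d" "?y \<le> M ^ esize e"
    using Op by auto
  have "2 * (M ^ esize d * M ^ esize e) \<le> M ^ esize (Op f d e)"
    using assms(1) by (simp add: power_add)
  moreover have "M ^ esize d * 1 \<le> M ^ esize d * M ^ esize e" "1 * M ^ esize e \<le> M ^ esize d * M ^ esize e"
    using assms(1) by (intro mult_mono; simp)+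
  moreover have "?x * ?y \<le> M ^ esize d * M ^ esize e"
    using IH by (intro mult_mono) auto
  moreover have "?x div ?y \<le> ?x" "?x mod ?y \<le> ?x" by auto
  ultimately have "?x + ?y \<le> M ^ esize (Op f d e)" "?x - ?y \<le> M ^ esize (Op f d e)"
      "?x * ?y \<le> M ^ esize (Op f d e)" "?x div ?y \<le> M ^ esize (Op f d e)"
      "?x mod ?y \<le> M ^ esize (Op f d e)"
    using IH by linarith+
  then show ?case by (cases f) (simp_all del: esize.simps)
qed auto

lemma bits_val:
  assumes "2 \<le> M" "bounded M e \<rho> \<alpha>"
  shows "bits (val e \<rho> \<alpha>) \<le> esize e * bits M"
proof -
  have "val e \<rho> \<alpha> \<le> M ^ esize e" by (rule val_le_power[OF assms])
  also have "\<dots> < (2 ^ bits M) ^ esize e"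
    using less_two_power_bits esize_pos[of e] by (intro power_strict_mono) auto
  finally show ?thesis by (simp add: bits_le_iff power_mult[symmetric] mult.commute)
qed

lemma bounded_cong:
  "low_regs e \<Longrightarrow> (\<And>r. r < 100 \<Longrightarrow> \<rho> r = \<rho>' r) \<Longrightarrow>
    val e \<rho> \<alpha> = val e \<rho>' \<alpha> \<and> bounded M e \<rho> \<alpha> = bounded M e \<rho>' \<alpha>"
  by (induction e) auto

text \<open>The square arises because each of the \<open>esize e\<close> nodes handles numbers of up
  to \<open>esize e * bits M\<close> bits. The second operand is evaluated one register higher, so
  the first survives; its value is unaffected by the first evaluation because only registers below
  100 occur in it.\<close>

lemma exec_compile:
  assumes M: "2 \<le> M" and "low_regs e" "bounded M e (reg \<sigma>) (arr \<sigma>)" "100 \<le> d"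
  shows "\<exists>t \<tau>. exec (compile e d) \<sigma> t \<tau> \<and> t \<le> 4 * (esize e)\<^sup>2 * bits M \<and>
    reg \<tau> d = val e (reg \<sigma>) (arr \<sigma>) \<and> (\<forall>r<d. reg \<tau> r = reg \<sigma> r) \<and> arr \<tau> = arr \<sigma>"
  using assms(2-)
proof (induction e arbitrary: d \<sigma>)
  case (Nm k)
  have E: "exec (Const d k) \<sigma> (1 + bits k) (\<sigma>\<lparr>reg := (reg \<sigma>)(d := k)\<rparr>)" by (rule exec.Const)
  have F1: "bits k \<le> bits M" "1 \<le> bits M"
    using Nm M bits_mono bits_pos by auto
  show ?case unfolding compile.simps
    by (intro exI conjI, rule E) (use F1 in \<open>auto\<close>)
next
  case (Rg r)
  let ?\<rho> = "\<sigma>\<lparr>reg := (reg \<sigma>)(d := 0)\<rparr>"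
  have E: "exec (Seq (Const d 0) (Binop Add d r d)) \<sigma>
      ((1 + bits 0) + (1 + bits (reg ?\<rho> r) + bits (reg ?\<rho> d)))
      (?\<rho>\<lparr>reg := (reg ?\<rho>)(d := binop_val Add (reg ?\<rho> r) (reg ?\<rho> d))\<rparr>)"
    by (rule exec.Seq[OF exec.Const exec.Binop])
  have F1: "bits (reg \<sigma> r) \<le> bits M" "1 \<le> bits M"
    using Rg M bits_mono bits_pos by auto
  have F2: "bits 0 = 0" by (simp add: floorlog_def)
  have F3: "r \<noteq> d" using Rg by auto
  show ?case unfolding compile.simps
    by (intro exI conjI, rule E) (use F1 F2 F3  in \<open>auto\<close>)
next
  case (Ar a e)
  then obtain t \<tau> where *: "exec (compile e d) \<sigma> t \<tau>" "t \<le> 4 * (esize e)\<^sup>2 * bits M"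
    "reg \<tau> d = val e (reg \<sigma>) (arr \<sigma>)" "\<forall>r<d. reg \<tau> r = reg \<sigma> r" "arr \<tau> = arr \<sigma>"
    by fastforce
  have E: "exec (compile (Ar a e) d) \<sigma> (t + (1 + bits (reg \<tau> d) + bits (arr \<tau> a (reg \<tau> d))))
      (\<tau>\<lparr>reg := (reg \<tau>)(d := arr \<tau> a (reg \<tau> d))\<rparr>)"
    unfolding compile.simps by (rule exec.Seq[OF *(1) exec.Load])
  have F1: "bits (reg \<tau> d) \<le> esize e * bits M" "bits (arr \<tau> a (reg \<tau> d)) \<le> bits M"
      "1 \<le> bits M"
    using Ar * M bits_mono bits_pos bits_val by auto
  have F2: "4 * (esize e)\<^sup>2 * bits M + (1 * bits M + esize e * bits M + bits M) \<le>
      4 * (esize (Ar a e))\<^sup>2 * bits M"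
    by (simp add: power2_eq_square algebra_simps)
  show ?case
    by (intro exI conjI, rule E) (use F1 F2 * in \<open>auto\<close>)
next
  case (Op f e1 e2)
  then obtain t \<tau> where *: "exec (compile e1 d) \<sigma> t \<tau>" "t \<le> 4 * (esize e1)\<^sup>2 * bits M"
    "reg \<tau> d = val e1 (reg \<sigma>) (arr \<sigma>)" "\<forall>r<d. reg \<tau> r = reg \<sigma> r" "arr \<tau> = arr \<sigma>"
    by (metis low_regs.simps(4) bounded.simps(4))
  have eq: "val e2 (reg \<tau>) (arr \<tau>) = val e2 (reg \<sigma>) (arr \<sigma>)"
    "bounded M e2 (reg \<tau>) (arr \<tau>) = bounded M e2 (reg \<sigma>) (arr \<sigma>)"
    using bounded_cong[of e2 "reg \<tau>" "reg \<sigma>"] Op.prems * by auto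
  obtain u \<upsilon> where **: "exec (compile e2 (d+1)) \<tau> u \<upsilon>" "u \<le> 4 * (esize e2)\<^sup>2 * bits M"
    "reg \<upsilon> (d+1) = val e2 (reg \<sigma>) (arr \<sigma>)" "\<forall>r<d+1. reg \<upsilon> r = reg \<tau> r" "arr \<upsilon> = arr \<tau>"
    using Op.IH(2)[of \<tau> "d+1"] Op.prems eq by auto
  have E: "exec (compile (Op f e1 e2) d) \<sigma> (t + (u + (1 + bits (reg \<upsilon> d) + bits (reg \<upsilon> (d+1)))))
      (\<upsilon>\<lparr>reg := (reg \<upsilon>)(d := binop_val f (reg \<upsilon> d) (reg \<upsilon> (d+1)))\<rparr>)"
    unfolding compile.simps by (rule exec.Seq[OF *(1) exec.Seq[OF **(1) exec.Binop]])
  have F1: "bits (reg \<upsilon> d) \<le> esize e1 * bits M" "bits (reg \<upsilon> (d+1)) \<le> esize e2 * bits M"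
      "1 \<le> bits M"
    using Op * ** M bits_pos bits_val by auto
  have F2: "4 * (esize e1)\<^sup>2 * bits M + (4 * (esize e2)\<^sup>2 * bits M +
        (1 * bits M + esize e1 * bits M + esize e2 * bits M)) \<le> 4 * (esize (Op f e1 e2))\<^sup>2 * bits M"
    by (simp add: power2_eq_square algebra_simps)
  show ?case
    by (intro exI conjI, rule E) (use F1 F2 * ** in \<open>auto\<close>)
qed

text \<open>Programs are specified on the registers below 100; the others are scratch space, whose
  contents before and after are unknown.\<close>

definition repr :: "state \<Rightarrow> (nat \<Rightarrow> nat) \<Rightarrow> (nat \<Rightarrow> nat \<Rightarrow> nat) \<Rightarrow> bool" where
  "repr \<sigma> \<rho> \<alpha> \<longleftrightarrow> (\<forall>r<100. reg \<sigma> r = \<rho> r) \<and> arr \<sigma> = \<alpha>"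

text \<open>Total correctness with a time bound. The initial contents are given exactly instead of
  by an assertion: straight-line code is then verified by rewriting with function updates, and
  assertions are needed only after loops and calls.\<close>

definition hoare :: "com \<Rightarrow> nat \<Rightarrow> (nat \<Rightarrow> nat) \<Rightarrow> (nat \<Rightarrow> nat \<Rightarrow> nat) \<Rightarrow>
    ((nat \<Rightarrow> nat) \<Rightarrow> (nat \<Rightarrow> nat \<Rightarrow> nat) \<Rightarrow> bool) \<Rightarrow> bool" where
  "hoare c T \<rho> \<alpha> Q \<longleftrightarrow> (\<forall>\<sigma>. repr \<sigma> \<rho> \<alpha> \<longrightarrow>
     (\<exists>t \<tau> \<rho>' \<alpha>'. exec c \<sigma> t \<tau> \<and> t \<le> T \<and> repr \<tau> \<rho>' \<alpha>' \<and> Q \<rho>' \<alpha>'))"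

lemma hoare_mono:
  "hoare c T \<rho> \<alpha> Q \<Longrightarrow> T \<le> T' \<Longrightarrow> (\<And>\<rho>' \<alpha>'. Q \<rho>' \<alpha>' \<Longrightarrow> Q' \<rho>' \<alpha>') \<Longrightarrow> hoare c T' \<rho> \<alpha> Q'"
  unfolding hoare_def by (meson order_trans)

lemma hoare_Seq:
  assumes "hoare c T \<rho> \<alpha> Q" "\<And>\<rho>' \<alpha>'. Q \<rho>' \<alpha>' \<Longrightarrow> hoare d U \<rho>' \<alpha>' Q'"
  shows "hoare (Seq c d) (T + U) \<rho> \<alpha> Q'"
  using assms unfolding hoare_def by (meson add_mono exec.Seq)

definition assign :: "nat \<Rightarrow> ex \<Rightarrow> com" where
  "assign r e = Seq (compile e 100) (Seq (Const 101 0) (Binop Add r 100 101))"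

definition store :: "nat \<Rightarrow> ex \<Rightarrow> ex \<Rightarrow> com" where
  "store a d e = Seq (compile d 100) (Seq (compile e 101) (Store a 100 101))"

text \<open>The quadratic term pays for the evaluation, the rest for the instructions that move the
  result from the scratch register to its destination.\<close>

definition ecost :: "ex \<Rightarrow> nat" where
  "ecost e = 4 * (esize e)\<^sup>2 + esize e + 2"

lemma hoare_assign:
  assumes M: "2 \<le> M" and e: "low_regs e" "bounded M e \<rho> \<alpha>" and r: "r < 100"
  shows "hoare (assign r e) (ecost e * bits M) \<rho> \<alpha> (\<lambda>\<rho>' \<alpha>'. \<rho>' = \<rho>(r := val e \<rho> \<alpha>) \<and> \<alpha>' = \<alpha>)"
  unfolding hoare_def
proof (intro allI impI)
  fix \<sigma> assume \<sigma>: "repr \<sigma> \<rho> \<alpha>"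
  have eq: "val e (reg \<sigma>) (arr \<sigma>) = val e \<rho> \<alpha>" "bounded M e (reg \<sigma>) (arr \<sigma>)"
    using bounded_cong[of e "reg \<sigma>" \<rho>] \<sigma> e by (auto simp: repr_def)
  obtain t \<tau> where *: "exec (compile e 100) \<sigma> t \<tau>" "t \<le> 4 * (esize e)\<^sup>2 * bits M"
    "reg \<tau> 100 = val e \<rho> \<alpha>" "\<forall>r<100. reg \<tau> r = reg \<sigma> r" "arr \<tau> = arr \<sigma>"
    using exec_compile[OF M e(1) eq(2), of 100] eq by auto
  let ?\<tau> = "\<tau>\<lparr>reg := (reg \<tau>)(101 := 0)\<rparr>"
  have E: "exec (assign r e) \<sigma> (t + ((1 + bits 0) + (1 + bits (reg ?\<tau> 100) + bits (reg ?\<tau> 101))))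
      (?\<tau>\<lparr>reg := (reg ?\<tau>)(r := binop_val Add (reg ?\<tau> 100) (reg ?\<tau> 101))\<rparr>)"
    unfolding assign_def by (rule exec.Seq[OF *(1) exec.Seq[OF exec.Const exec.Binop]])
  have F1: "bits (val e \<rho> \<alpha>) \<le> esize e * bits M" "1 \<le> bits M" "bits 0 = 0"
    using M e bits_val bits_pos by (auto simp: floorlog_def)
  show "\<exists>t \<tau> \<rho>' \<alpha>'. exec (assign r e) \<sigma> t \<tau> \<and> t \<le> ecost e * bits M \<and>
     repr \<tau> \<rho>' \<alpha>' \<and> \<rho>' = \<rho>(r := val e \<rho> \<alpha>) \<and> \<alpha>' = \<alpha>"
    by (intro exI conjI, rule E) (use F1 \<sigma> * r in \<open>(auto simp: repr_def ecost_def algebra_simps)\<close>)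
qed

lemma hoare_assign_Seq:
  assumes "2 \<le> M" "low_regs e" "bounded M e \<rho> \<alpha>" "r < 100"
    and "hoare c T (\<rho>(r := val e \<rho> \<alpha>)) \<alpha> Q"
  shows "hoare (Seq (assign r e) c) (ecost e * bits M + T) \<rho> \<alpha> Q"
  by (rule hoare_Seq[OF hoare_assign[OF assms(1-4)]]) (use assms(5) in simp)

lemma hoare_store:
  assumes M: "2 \<le> M" and d: "low_regs d" "bounded M d \<rho> \<alpha>" and e: "low_regs e" "bounded M e \<rho> \<alpha>"
  shows "hoare (store a d e) ((ecost d + ecost e) * bits M) \<rho> \<alpha>
    (\<lambda>\<rho>' \<alpha>'. \<rho>' = \<rho> \<and> \<alpha>' = \<alpha>(a := (\<alpha> a)(val d \<rho> \<alpha> := val e \<rho> \<alpha>)))"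
  unfolding hoare_def
proof (intro allI impI)
  fix \<sigma> assume \<sigma>: "repr \<sigma> \<rho> \<alpha>"
  have eq: "val d (reg \<sigma>) (arr \<sigma>) = val d \<rho> \<alpha>" "bounded M d (reg \<sigma>) (arr \<sigma>)"
    using bounded_cong[of d "reg \<sigma>" \<rho>] \<sigma> d by (auto simp: repr_def)
  obtain t \<tau> where *: "exec (compile d 100) \<sigma> t \<tau>" "t \<le> 4 * (esize d)\<^sup>2 * bits M"
    "reg \<tau> 100 = val d \<rho> \<alpha>" "\<forall>r<100. reg \<tau> r = reg \<sigma> r" "arr \<tau> = arr \<sigma>"
    using exec_compile[OF M d(1) eq(2), of 100] eq by auto
  have eq': "val e (reg \<tau>) (arr \<tau>) = val e \<rho> \<alpha>" "bounded M e (reg \<tau>) (arr \<tau>)"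
    using bounded_cong[of e "reg \<tau>" \<rho>] \<sigma> e * by (auto simp: repr_def)
  obtain u \<upsilon> where **: "exec (compile e 101) \<tau> u \<upsilon>" "u \<le> 4 * (esize e)\<^sup>2 * bits M"
    "reg \<upsilon> 101 = val e \<rho> \<alpha>" "\<forall>r<101. reg \<upsilon> r = reg \<tau> r" "arr \<upsilon> = arr \<tau>"
    using exec_compile[OF M e(1) eq'(2), of 101] eq' by auto
  have E: "exec (store a d e) \<sigma> (t + (u + (1 + bits (reg \<upsilon> 100) + bits (reg \<upsilon> 101))))
      (\<upsilon>\<lparr>arr := (arr \<upsilon>)(a := (arr \<upsilon> a)(reg \<upsilon> 100 := reg \<upsilon> 101))\<rparr>)"
    unfolding store_def by (rule exec.Seq[OF *(1) exec.Seq[OF **(1) exec.Store]])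
  have F1: "bits (val e \<rho> \<alpha>) \<le> esize e * bits M" "bits (val d \<rho> \<alpha>) \<le> esize d * bits M"
      "1 \<le> bits M"
    using M d e bits_val bits_pos by auto
  show "\<exists>t \<tau> \<rho>' \<alpha>'. exec (store a d e) \<sigma> t \<tau> \<and> t \<le> (ecost d + ecost e) * bits M \<and>
     repr \<tau> \<rho>' \<alpha>' \<and> \<rho>' = \<rho> \<and> \<alpha>' = \<alpha>(a := (\<alpha> a)(val d \<rho> \<alpha> := val e \<rho> \<alpha>))"
    by (intro exI conjI, rule E) (use F1 \<sigma> * ** in \<open>(auto simp: repr_def ecost_def algebra_simps)\<close>)
qed

lemma hoare_store_Seq:
  assumes "2 \<le> M" "low_regs d" "bounded M d \<rho> \<alpha>" "low_regs e" "bounded M e \<rho> \<alpha>"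
    and "hoare c T \<rho> (\<alpha>(a := (\<alpha> a)(val d \<rho> \<alpha> := val e \<rho> \<alpha>))) Q"
  shows "hoare (Seq (store a d e) c) ((ecost d + ecost e) * bits M + T) \<rho> \<alpha> Q"
  by (rule hoare_Seq[OF hoare_store[OF assms(1-5)]]) (use assms(6) in simp)

definition cond :: "nat \<Rightarrow> ex \<Rightarrow> com \<Rightarrow> com" where
  "cond r e c = Seq (assign r e) (Cond r c Skip)"

text \<open>\<open>ecost e\<close> is counted twice because the branching instruction is charged
  once more for the bit length of the tested value.\<close>

lemma hoare_cond:
  assumes M: "2 \<le> M" and e: "low_regs e" "bounded M e \<rho> \<alpha>" and r: "r < 100"
    and c: "val e \<rho> \<alpha> \<noteq> 0 \<Longrightarrow> hoare c T (\<rho>(r := val e \<rho> \<alpha>)) \<alpha> Q"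
    and skip: "val e \<rho> \<alpha> = 0 \<Longrightarrow> Q (\<rho>(r := 0)) \<alpha>"
  shows "hoare (cond r e c) (2 * ecost e * bits M + (if val e \<rho> \<alpha> = 0 then 0 else T)) \<rho> \<alpha> Q"
proof -
  have b: "bits (val e \<rho> \<alpha>) \<le> esize e * bits M" "1 \<le> bits M"
    using M e bits_val bits_pos by auto
  have "2 + esize e * bits M \<le> ecost e * bits M"
    using b(2) unfolding ecost_def distrib_right by linarith
  then have b': "2 + bits (val e \<rho> \<alpha>) \<le> ecost e * bits M" using b by linarith
  have "hoare (Cond r c Skip) (ecost e * bits M + (if val e \<rho> \<alpha> = 0 then 0 else T))
     (\<rho>(r := val e \<rho> \<alpha>)) \<alpha> Q"
  proof (cases "val e \<rho> \<alpha> = 0")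
    case True
    show ?thesis unfolding hoare_def
    proof (intro allI impI)
      fix \<sigma> assume \<sigma>: "repr \<sigma> (\<rho>(r := val e \<rho> \<alpha>)) \<alpha>"
      then have E: "exec (Cond r c Skip) \<sigma> (1 + 1) \<sigma>"
        using True r by (intro exec.intros) (auto simp: repr_def)
      show "\<exists>t \<tau> \<rho>' \<alpha>'. exec (Cond r c Skip) \<sigma> t \<tau> \<and>
          t \<le> ecost e * bits M + (if val e \<rho> \<alpha> = 0 then 0 else T) \<and> repr \<tau> \<rho>' \<alpha>' \<and> Q \<rho>' \<alpha>'"
    by (intro exI conjI, rule E) (use  skip[OF True] b' \<sigma> True in \<open>auto\<close>)
    qed
  next
    case False
    show ?thesis unfolding hoare_def
    proof (intro allI impI)
      fix \<sigma> assume \<sigma>: "repr \<sigma> (\<rho>(r := val e \<rho> \<alpha>)) \<alpha>"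
      then obtain t \<tau> \<rho>' \<alpha>' where *: "exec c \<sigma> t \<tau>" "t \<le> T" "repr \<tau> \<rho>' \<alpha>'" "Q \<rho>' \<alpha>'"
        using c[OF False] unfolding hoare_def by blast
      have E: "exec (Cond r c Skip) \<sigma> (1 + bits (reg \<sigma> r) + t) \<tau>"
        using * r False \<sigma> by (intro exec.intros) (auto simp: repr_def)
      have F1: "reg \<sigma> r = val e \<rho> \<alpha>" using \<sigma> r by (auto simp: repr_def)
      show "\<exists>t \<tau> \<rho>' \<alpha>'. exec (Cond r c Skip) \<sigma> t \<tau> \<and>
          t \<le> ecost e * bits M + (if val e \<rho> \<alpha> = 0 then 0 else T) \<and> repr \<tau> \<rho>' \<alpha>' \<and> Q \<rho>' \<alpha>'"
    by (intro exI conjI, rule E) (use F1 * b' False in \<open>auto\<close>)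
    qed
  qed
  then have "hoare (cond r e c) (ecost e * bits M + (ecost e * bits M + (if val e \<rho> \<alpha> = 0 then 0 else T))) \<rho> \<alpha> Q"
    unfolding cond_def by (intro hoare_Seq[OF hoare_assign[OF M e r]]) auto
  then show ?thesis by (rule hoare_mono) auto
qed

text \<open>The loop \<open>loop i\<close> keeps its limit in register \<open>i + 2\<close> and the number of remaining rounds in
  register \<open>i + 1\<close>.\<close>

definition loop :: "nat \<Rightarrow> ex \<Rightarrow> com \<Rightarrow> com" where
  "loop i e c = Seq (assign (i + 2) e) (Seq (assign i (Nm 0)) (Seq (assign (i + 1) (Rg (i + 2)))
     (While (i + 1) (Seq c (Seq (assign i (Op Add (Rg i) (Nm 1)))
        (assign (i + 1) (Op Sub (Rg (i + 2)) (Rg i))))))))"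

text \<open>\<open>I\<close> is indexed by the number of completed rounds and the tested register
  holds the number of remaining ones, so the proof is an induction on \<open>n - k\<close>. The
  bound \<open>b\<close> pays for each test.\<close>

lemma hoare_While:
  assumes step: "\<And>k \<rho> \<alpha>. k < n \<Longrightarrow> I k \<rho> \<alpha> \<Longrightarrow> hoare c (T k) \<rho> \<alpha> (I (Suc k))"
    and test: "\<And>k \<rho> \<alpha>. I k \<rho> \<alpha> \<Longrightarrow> k \<le> n \<Longrightarrow> \<rho> r = n - k"
    and r: "r < 100" and k: "k \<le> n" and I: "I k \<rho> \<alpha>" and b: "bits n \<le> b"
  shows "hoare (While r c) ((\<Sum>j=k..<n. T j) + (n - k) * (1 + b) + 1) \<rho> \<alpha> (I n)"
  using k I
proof (induction "n - k" arbitrary: k \<rho> \<alpha>)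
  case 0
  then have [simp]: "k = n" by simp
  show ?case unfolding hoare_def
  proof (intro allI impI)
    fix \<sigma> assume \<sigma>: "repr \<sigma> \<rho> \<alpha>"
    then have E: "exec (While r c) \<sigma> 1 \<sigma>"
      using test[OF 0(3)] r by (intro exec.intros) (auto simp: repr_def)
    show "\<exists>t \<tau> \<rho>' \<alpha>'. exec (While r c) \<sigma> t \<tau> \<and> t \<le> (\<Sum>j=k..<n. T j) + (n - k) * (1 + b) + 1 \<and>
        repr \<tau> \<rho>' \<alpha>' \<and> I n \<rho>' \<alpha>'"
    by (intro exI conjI, rule E) (use  \<sigma> 0 in \<open>auto\<close>)
  qed
next
  case (Suc m)
  then have k: "k < n" by simp
  show ?case unfolding hoare_def
  proof (intro allI impI)
    fix \<sigma> assume \<sigma>: "repr \<sigma> \<rho> \<alpha>"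
    have reg: "reg \<sigma> r = n - k" using test[OF Suc.prems(2)] r \<sigma> k by (auto simp: repr_def)
    obtain t \<tau> \<rho>' \<alpha>' where *: "exec c \<sigma> t \<tau>" "t \<le> T k" "repr \<tau> \<rho>' \<alpha>'" "I (Suc k) \<rho>' \<alpha>'"
      using step[OF k Suc.prems(2)] \<sigma> unfolding hoare_def by blast
    have "hoare (While r c) ((\<Sum>j=Suc k..<n. T j) + (n - Suc k) * (1 + b) + 1) \<rho>' \<alpha>' (I n)"
      using Suc.hyps * k by (intro Suc.hyps(1)) auto
    then obtain u \<upsilon> \<rho>'' \<alpha>'' where **: "exec (While r c) \<tau> u \<upsilon>"
        "u \<le> (\<Sum>j=Suc k..<n. T j) + (n - Suc k) * (1 + b) + 1" "repr \<upsilon> \<rho>'' \<alpha>''" "I n \<rho>'' \<alpha>''"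
      using * unfolding hoare_def by blast
    have E: "exec (While r c) \<sigma> (1 + bits (reg \<sigma> r) + t + u) \<upsilon>"
      using * ** reg k by (intro exec.intros) auto
    have F1: "bits (n - k) \<le> b" using b bits_mono[of "n - k" n] by auto
    have F2: "(\<Sum>j=k..<n. T j) = T k + (\<Sum>j=Suc k..<n. T j)"
      using k by (rule sum.atLeast_Suc_lessThan)
    have F3: "(n - k) * (1 + b) = (n - Suc k) * (1 + b) + (1 + b)"
      using k by (metis Suc_diff_Suc add.commute mult_Suc)
    show "\<exists>t \<tau> \<rho>' \<alpha>'. exec (While r c) \<sigma> t \<tau> \<and>
        t \<le> (\<Sum>j=k..<n. T j) + (n - k) * (1 + b) + 1 \<and> repr \<tau> \<rho>' \<alpha>' \<and> I n \<rho>' \<alpha>'"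
    by (intro exI conjI, rule E) (use F1 F2 F3 reg * ** in \<open>auto\<close>)
  qed
qed

text \<open>The body has to preserve the counter \<open>i\<close> and the limit
  \<open>i + 2\<close>; register \<open>i + 1\<close> is recomputed after each round. Increment and
  recomputation cost 82 times \<open>bits M\<close> and the test at most 2 times, so 100 leaves room
  for the initial assignments.\<close>

lemma hoare_loop:
  assumes M: "2 \<le> M" and e: "low_regs e" "bounded M e \<rho> \<alpha>" "val e \<rho> \<alpha> = n" "n \<le> M" and i: "i + 2 < 100"
    and init: "I 0 (\<rho>(i + 2 := n, i := 0, i + 1 := n)) \<alpha>"
    and step: "\<And>k \<rho>' \<alpha>'. k < n \<Longrightarrow> I k \<rho>' \<alpha>' \<Longrightarrow> \<rho>' i = k \<Longrightarrow> \<rho>' (i + 1) = n - k \<Longrightarrow> \<rho>' (i + 2) = n \<Longrightarrow>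
      hoare c (T k) \<rho>' \<alpha>' (\<lambda>\<rho>'' \<alpha>''. \<rho>'' i = k \<and> \<rho>'' (i + 2) = n \<and>
        I (Suc k) (\<rho>''(i := Suc k, i + 1 := n - Suc k)) \<alpha>'')"
  shows "hoare (loop i e c) ((\<Sum>k<n. T k) + (n + 1) * ((ecost e + 100) * bits M)) \<rho> \<alpha>
    (\<lambda>\<rho>' \<alpha>'. I n \<rho>' \<alpha>' \<and> \<rho>' i = n \<and> \<rho>' (i + 1) = 0 \<and> \<rho>' (i + 2) = n)"
proof -
  let ?I = "\<lambda>k \<rho>' \<alpha>'. I k \<rho>' \<alpha>' \<and> \<rho>' i = k \<and> \<rho>' (i + 1) = n - k \<and> \<rho>' (i + 2) = n"
  let ?inc = "Op Add (Rg i) (Nm 1)" and ?rest = "Op Sub (Rg (i + 2)) (Rg i)"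
  let ?T = "\<lambda>k. T k + (ecost ?inc * bits M + ecost ?rest * bits M)"
  have b: "bits n \<le> bits M" "1 \<le> bits M" using e M bits_mono bits_pos by auto
  have body: "hoare (Seq c (Seq (assign i ?inc) (assign (i + 1) ?rest))) (?T k) \<rho>' \<alpha>' (?I (Suc k))"
    if "k < n" "?I k \<rho>' \<alpha>'" for k \<rho>' \<alpha>'
  proof (rule hoare_Seq)
    show "hoare c (T k) \<rho>' \<alpha>' (\<lambda>\<rho>'' \<alpha>''. \<rho>'' i = k \<and> \<rho>'' (i + 2) = n \<and>
        I (Suc k) (\<rho>''(i := Suc k, i + 1 := n - Suc k)) \<alpha>'')"
      using that by (intro step) auto
  next
    fix \<rho>'' \<alpha>''
    assume *: "\<rho>'' i = k \<and> \<rho>'' (i + 2) = n \<and> I (Suc k) (\<rho>''(i := Suc k, i + 1 := n - Suc k)) \<alpha>''"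
    have "hoare (assign i ?inc) (ecost ?inc * bits M) \<rho>'' \<alpha>''
        (\<lambda>\<rho> \<alpha>. \<rho> = \<rho>''(i := val ?inc \<rho>'' \<alpha>'') \<and> \<alpha> = \<alpha>'')"
      using M i e * that by (intro hoare_assign) auto
    then show "hoare (Seq (assign i ?inc) (assign (i + 1) ?rest))
        (ecost ?inc * bits M + ecost ?rest * bits M) \<rho>'' \<alpha>'' (?I (Suc k))"
    proof (rule hoare_Seq)
      fix \<rho> \<alpha> assume **: "\<rho> = \<rho>''(i := val ?inc \<rho>'' \<alpha>'') \<and> \<alpha> = \<alpha>''"
      have "hoare (assign (i + 1) ?rest) (ecost ?rest * bits M) \<rho> \<alpha>
          (\<lambda>\<rho>' \<alpha>'. \<rho>' = \<rho>(i + 1 := val ?rest \<rho> \<alpha>) \<and> \<alpha>' = \<alpha>)"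
        using M i e * ** that by (intro hoare_assign) auto
      then show "hoare (assign (i + 1) ?rest) (ecost ?rest * bits M) \<rho> \<alpha> (?I (Suc k))"
        by (rule hoare_mono) (use * ** that in auto)
    qed
  qed
  have "hoare (While (i + 1) (Seq c (Seq (assign i ?inc) (assign (i + 1) ?rest))))
      ((\<Sum>j=0..<n. ?T j) + (n - 0) * (1 + bits M) + 1) (\<rho>(i + 2 := n, i := 0, i + 1 := n)) \<alpha> (?I n)"
  proof (rule hoare_While[where I = ?I])
    show "?I 0 (\<rho>(i + 2 := n, i := 0, i + 1 := n)) \<alpha>" using init by simp
  next
    show "hoare (Seq c (Seq (assign i ?inc) (assign (i + 1) ?rest))) (?T k) \<rho>' \<alpha>' (?I (Suc k))"
      if "k < n" "?I k \<rho>' \<alpha>'" for k \<rho>' \<alpha>'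
      by (rule body[OF that])
  qed (use i b in simp_all)
  then have "hoare (loop i e c) (ecost e * bits M + (ecost (Nm 0) * bits M + (ecost (Rg (i + 2)) * bits M +
     ((\<Sum>j=0..<n. ?T j) + (n - 0) * (1 + bits M) + 1)))) \<rho> \<alpha> (?I n)"
    unfolding loop_def
    by (intro hoare_assign_Seq[OF M]) (use e i in simp_all)
  then show ?thesis
  proof (rule hoare_mono)
    have "(\<Sum>j=0..<n. ?T j) = (\<Sum>k<n. T k) + 82 * (n * bits M)"
      by (simp add: sum.distrib ecost_def lessThan_atLeast0 power2_eq_square)
    moreover have "(n + 1) * ((ecost e + 100) * bits M) =
        n * (ecost e * bits M) + 100 * (n * bits M) + ecost e * bits M + 100 * bits M"
      by (simp add: algebra_simps)
    moreover have "(n - 0) * (1 + bits M) = n + n * bits M"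
      by simp
    moreover have "ecost (Nm 0) * bits M = 7 * bits M" "ecost (Rg (i + 2)) * bits M = 7 * bits M"
      by (simp_all add: ecost_def)
    moreover have "n \<le> n * bits M" using b by auto
    ultimately show "ecost e * bits M + (ecost (Nm 0) * bits M + (ecost (Rg (i + 2)) * bits M +
     ((\<Sum>j=0..<n. ?T j) + (n - 0) * (1 + bits M) + 1))) \<le>
       (\<Sum>k<n. T k) + (n + 1) * ((ecost e + 100) * bits M)"
      using b by linarith
  qed auto
qed

text \<open>Normal form of the array that a \<open>fill\<close> leaves behind, stated so that
  injectivity of the address function \<open>h\<close> is demanded only where a written cell is read
  back.\<close>

primrec scattered :: "(nat \<Rightarrow> nat) \<Rightarrow> (nat \<Rightarrow> nat) \<Rightarrow> (nat \<Rightarrow> nat) \<Rightarrow> nat \<Rightarrow> nat \<Rightarrow> nat" where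
  "scattered A h g 0 = A"
| "scattered A h g (Suc k) = (scattered A h g k)(h k := g k)"

lemma scattered_hit: "inj_on h {..<n} \<Longrightarrow> k < n \<Longrightarrow> scattered A h g n (h k) = g k"
  by (induction n) (auto simp: inj_on_def less_Suc_eq)

lemma scattered_miss: "(\<And>k. k < n \<Longrightarrow> h k \<noteq> x) \<Longrightarrow> scattered A h g n x = A x"
  by (induction n) auto

lemma scattered_id: "scattered A (\<lambda>k. k) g n x = (if x < n then g x else A x)"
  by (induction n) auto

lemma scattered_cases:
  assumes "\<And>k. k < n \<Longrightarrow> P (h k) (g k)" "\<And>x. P x (A x)"
  shows "P x (scattered A h g n x)"
  using assms(1) by (induction n arbitrary: x) (auto simp: assms(2))

definition fill :: "nat \<Rightarrow> ex \<Rightarrow> nat \<Rightarrow> ex \<Rightarrow> ex \<Rightarrow> com" where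
  "fill i l a d e = loop i l (store a d e)"

definition fcost :: "ex \<Rightarrow> ex \<Rightarrow> ex \<Rightarrow> nat" where
  "fcost l d e = ecost l + ecost d + ecost e + 100"

text \<open>In round \<open>k\<close> both expressions see the array with the first \<open>k\<close>
  stores already made. A \<open>fill\<close> can therefore tabulate a recurrence; running sums, the
  search for a sink and the decoding of Morton codes are all obtained in this way.\<close>

lemma hoare_fill:
  assumes M: "2 \<le> M" and l: "low_regs l" "bounded M l \<rho> \<alpha>" "val l \<rho> \<alpha> = n" "n \<le> M" and i: "i + 2 < 100"
    and de: "low_regs d" "low_regs e"
    and step: "\<And>k. k < n \<Longrightarrow>
      let \<rho>' = \<rho>(i := k, i + 1 := n - k, i + 2 := n); \<alpha>' = \<alpha>(a := scattered (\<alpha> a) h g k)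
      in bounded M d \<rho>' \<alpha>' \<and> bounded M e \<rho>' \<alpha>' \<and> val d \<rho>' \<alpha>' = h k \<and> val e \<rho>' \<alpha>' = g k"
  shows "hoare (fill i l a d e) ((n + 1) * (fcost l d e * bits M)) \<rho> \<alpha>
    (\<lambda>\<rho>' \<alpha>'. \<rho>' = \<rho>(i := n, i + 1 := 0, i + 2 := n) \<and> \<alpha>' = \<alpha>(a := scattered (\<alpha> a) h g n))"
proof -
  let ?I = "\<lambda>k \<rho>' \<alpha>'. \<rho>' = \<rho>(i := k, i + 1 := n - k, i + 2 := n) \<and> \<alpha>' = \<alpha>(a := scattered (\<alpha> a) h g k)"
  have "hoare (loop i l (store a d e)) ((\<Sum>k<n. (ecost d + ecost e) * bits M) + (n + 1) * ((ecost l + 100) * bits M))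
     \<rho> \<alpha> (\<lambda>\<rho>' \<alpha>'. ?I n \<rho>' \<alpha>' \<and> \<rho>' i = n \<and> \<rho>' (i + 1) = 0 \<and> \<rho>' (i + 2) = n)"
  proof (rule hoare_loop[OF M l i, where I = ?I])
    show "?I 0 (\<rho>(i + 2 := n, i := 0, i + 1 := n)) \<alpha>" by (auto simp: fun_eq_iff)
  next
    fix k \<rho>' \<alpha>' assume k: "k < n" and I: "?I k \<rho>' \<alpha>'"
    show "hoare (store a d e) ((ecost d + ecost e) * bits M) \<rho>' \<alpha>'
         (\<lambda>\<rho>'' \<alpha>''. \<rho>'' i = k \<and> \<rho>'' (i + 2) = n \<and> ?I (Suc k) (\<rho>''(i := Suc k, i + 1 := n - Suc k)) \<alpha>'')"
    proof (rule hoare_mono[OF hoare_store[OF M] order_refl])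
      show "low_regs d" "bounded M d \<rho>' \<alpha>'" "low_regs e" "bounded M e \<rho>' \<alpha>'"
        using step[OF k] de I by (simp_all add: Let_def)
      fix \<rho>'' \<alpha>''
      assume "\<rho>'' = \<rho>' \<and> \<alpha>'' = \<alpha>'(a := (\<alpha>' a)(val d \<rho>' \<alpha>' := val e \<rho>' \<alpha>'))"
      then show "\<rho>'' i = k \<and> \<rho>'' (i + 2) = n \<and> ?I (Suc k) (\<rho>''(i := Suc k, i + 1 := n - Suc k)) \<alpha>''"
        using step[OF k] I by (simp add: Let_def) (auto simp: fun_eq_iff)
    qed
  qed
  then show ?thesis unfolding fill_def
  proof (rule hoare_mono)
    show "(\<Sum>k<n. (ecost d + ecost e) * bits M) + (n + 1) * ((ecost l + 100) * bits M) \<le>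
        (n + 1) * (fcost l d e * bits M)"
      by (simp add: fcost_def distrib_right distrib_left)
  qed simp
qed

section \<open>Relocating a program\<close>

text \<open>To call a program repeatedly without clearing its arrays, the \<open>k\<close>-th call is made to use the
  cells with index congruent to \<open>k\<close> modulo \<open>m\<close>, which earlier calls have not touched. The numbers
  \<open>m\<close> and \<open>k\<close> are held in the registers 6 and 16.\<close>

primrec relocate :: "com \<Rightarrow> com" where
  "relocate Skip = Skip"
| "relocate (Const r k) = Const (r + 100) k"
| "relocate (Binop f r p q) = Binop f (r + 100) (p + 100) (q + 100)"
| "relocate (Load r a i) = Seq (Binop Mul 98 (i + 100) 6) (Seq (Binop Add 98 98 16) (Load (r + 100) (a + 20) 98))"
| "relocate (Store a i r) = Seq (Binop Mul 98 (i + 100) 6) (Seq (Binop Add 98 98 16) (Store (a + 20) 98 (r + 100)))"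
| "relocate (Seq c d) = Seq (relocate c) (relocate d)"
| "relocate (Cond r c d) = Cond (r + 100) (relocate c) (relocate d)"
| "relocate (While r c) = While (r + 100) (relocate c)"

text \<open>A call has to start from zeroed registers, and only finitely many can be cleared. The
  bound \<open>R\<close> says which ones.\<close>

primrec regs_below :: "nat \<Rightarrow> com \<Rightarrow> bool" where
  "regs_below R Skip = True"
| "regs_below R (Const r k) = (r < R)"
| "regs_below R (Binop f r p q) = (r < R \<and> p < R \<and> q < R)"
| "regs_below R (Load r a i) = (r < R \<and> i < R)"
| "regs_below R (Store a i r) = (r < R \<and> i < R)"
| "regs_below R (Seq c d) = (regs_below R c \<and> regs_below R d)"
| "regs_below R (Cond r c d) = (r < R \<and> regs_below R c \<and> regs_below R d)"
| "regs_below R (While r c) = (r < R \<and> regs_below R c)"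

lemma regs_below_mono: "regs_below R c \<Longrightarrow> R \<le> R' \<Longrightarrow> regs_below R' c"
  by (induction c) auto

lemma ex_regs_below: "\<exists>R. regs_below R c"
proof (induction c)
  case (Const r k)
  show ?case by (rule exI[of _ "Suc r"]) simp
next
  case (Binop f r p q)
  show ?case by (rule exI[of _ "Suc (r + p + q)"]) simp
next
  case (Load r a i)
  show ?case by (rule exI[of _ "Suc (r + i)"]) simp
next
  case (Store a i r)
  show ?case by (rule exI[of _ "Suc (r + i)"]) simp
next
  case (Seq c d)
  then obtain R R' where "regs_below R c" "regs_below R' d" by blast
  then have "regs_below (R + R') (Seq c d)" by (auto elim: regs_below_mono)
  then show ?case ..
next
  case (Cond r c d)
  then obtain R R' where "regs_below R c" "regs_below R' d" by blast
  then have "regs_below (Suc (r + R + R')) (Cond r c d)" by (auto elim: regs_below_mono)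
  then show ?case ..
next
  case (While r c)
  then obtain R where "regs_below R c" by blast
  then have "regs_below (Suc (r + R)) (While r c)" by (auto elim: regs_below_mono)
  then show ?case ..
qed auto

definition simulated :: "nat \<Rightarrow> nat \<Rightarrow> nat \<Rightarrow> state \<Rightarrow> state \<Rightarrow> bool" where
  "simulated R m k \<sigma> \<sigma>' \<longleftrightarrow> (\<forall>r<R. reg \<sigma>' (r + 100) = reg \<sigma> r) \<and>
     (\<forall>a x. arr \<sigma>' (a + 20) (x * m + k) = arr \<sigma> a x) \<and> reg \<sigma>' 6 = m \<and> reg \<sigma>' 16 = k"

text \<open>Register 98 holds the translated array index and is the only low register that a
  relocated program changes. That other residue classes stay untouched is what keeps them zero for
  later calls.\<close>

definition framed :: "nat \<Rightarrow> nat \<Rightarrow> state \<Rightarrow> state \<Rightarrow> bool" where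
  "framed m k \<sigma> \<tau> \<longleftrightarrow> (\<forall>r<100. r \<noteq> 98 \<longrightarrow> reg \<tau> r = reg \<sigma> r) \<and> (\<forall>a<20. arr \<tau> a = arr \<sigma> a) \<and>
     (\<forall>a x. x mod m \<noteq> k \<longrightarrow> arr \<tau> (a + 20) x = arr \<sigma> (a + 20) x)"

lemma framed_refl: "framed m k \<sigma> \<sigma>"
  by (simp add: framed_def)

lemma framed_trans: "framed m k \<sigma> \<rho> \<Longrightarrow> framed m k \<rho> \<tau> \<Longrightarrow> framed m k \<sigma> \<tau>"
  by (simp add: framed_def)

lemma relocated_index_cost:
  assumes "k < m"
  shows "1 + bits x + bits m + (1 + bits (x * m) + bits k + (1 + bits (x * m + k) + y)) \<le>
    10 * bits m * (1 + bits x + y)"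
proof -
  have m: "1 \<le> bits m" using assms by (intro bits_pos) simp
  have k: "bits k \<le> bits m" using assms by (intro bits_mono) simp
  have xm: "bits (x * m) \<le> bits x + bits m" by (rule bits_mult)
  have "bits (x * m + k) \<le> Suc (max (bits (x * m)) (bits k))" by (rule bits_add)
  with xm k have xk: "bits (x * m + k) \<le> Suc (bits x + bits m)" by linarith
  have "bits x \<le> bits m * bits x" "y \<le> bits m * y" using m by simp_all
  then have "4 + 3 * bits x + 4 * bits m + y \<le> 10 * bits m + 10 * (bits m * bits x) + 10 * (bits m * y)"
    using m by linarith
  also have "\<dots> = 10 * bits m * (1 + bits x + y)" by (simp add: algebra_simps)
  finally show ?thesis using xm xk k by linarith
qed

lemma exec_relocated_index:
  assumes "simulated R m k \<sigma> \<sigma>'" "i < R"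
  defines "\<tau>' \<equiv> \<sigma>'\<lparr>reg := (reg \<sigma>')(98 := reg \<sigma> i * m + k)\<rparr>"
  assumes "exec c \<tau>' u \<upsilon>"
  shows "exec (Seq (Binop Mul 98 (i + 100) 6) (Seq (Binop Add 98 98 16) c)) \<sigma>'
    (1 + bits (reg \<sigma> i) + bits m + (1 + bits (reg \<sigma> i * m) + bits k + u)) \<upsilon>"
proof -
  let ?\<rho> = "\<sigma>'\<lparr>reg := (reg \<sigma>')(98 := reg \<sigma> i * m)\<rparr>"
  have "exec (Binop Mul 98 (i + 100) 6) \<sigma>' (1 + bits (reg \<sigma>' (i + 100)) + bits (reg \<sigma>' 6))
    (\<sigma>'\<lparr>reg := (reg \<sigma>')(98 := binop_val Mul (reg \<sigma>' (i + 100)) (reg \<sigma>' 6))\<rparr>)"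
    by (rule exec.Binop)
  moreover have "exec (Binop Add 98 98 16) ?\<rho> (1 + bits (reg ?\<rho> 98) + bits (reg ?\<rho> 16))
    (?\<rho>\<lparr>reg := (reg ?\<rho>)(98 := binop_val Add (reg ?\<rho> 98) (reg ?\<rho> 16))\<rparr>)"
    by (rule exec.Binop)
  moreover have "reg \<sigma>' (i + 100) = reg \<sigma> i" "reg \<sigma>' 6 = m" "reg \<sigma>' 16 = k"
    using assms(1,2) by (auto simp: simulated_def)
  ultimately have 1: "exec (Binop Mul 98 (i + 100) 6) \<sigma>' (1 + bits (reg \<sigma> i) + bits m) ?\<rho>"
    and 2: "exec (Binop Add 98 98 16) ?\<rho> (1 + bits (reg \<sigma> i * m) + bits k) \<tau>'"
    by (simp_all add: \<tau>'_def)
  show ?thesis by (rule exec.Seq[OF 1 exec.Seq[OF 2 assms(4)]])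
qed

text \<open>Translating an index costs O(\<open>bits x + bits m\<close>). Every instruction costs at
  least one unit, so this overhead can be charged as a factor to the instruction itself; for
  \<open>m\<close> polynomial in \<open>n\<close> the factor is logarithmic.\<close>

lemma exec_relocate:
  assumes "exec c \<sigma> t \<tau>" "regs_below R c" "k < m" "simulated R m k \<sigma> \<sigma>'"
  shows "\<exists>t' \<tau>'. exec (relocate c) \<sigma>' t' \<tau>' \<and> t' \<le> 10 * bits m * t \<and>
    simulated R m k \<tau> \<tau>' \<and> framed m k \<sigma>' \<tau>'"
proof -
  have m: "1 \<le> bits m" using assms by (intro bits_pos) simp
  then have le: "x \<le> 10 * bits m * x" for x by simp
  from assms show ?thesis
  proof (induction arbitrary: \<sigma>' rule: exec.induct)
    case (Skip \<sigma>)
    have E: "exec (relocate Skip) \<sigma>' 1 \<sigma>'" unfolding relocate.simps by (rule exec.Skip)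
    show ?case by (intro exI conjI, rule E) (use le Skip in \<open>auto simp: framed_refl\<close>)
  next
    case (Const r v \<sigma>)
    have E: "exec (relocate (Const r v)) \<sigma>' (1 + bits v) (\<sigma>'\<lparr>reg := (reg \<sigma>')(r + 100 := v)\<rparr>)"
      by (simp add: exec.Const[simplified])
    show ?case by (intro exI conjI, rule E, rule le)
      (use Const in \<open>auto simp: simulated_def framed_def\<close>)
  next
    case (Binop f r p q \<sigma>)
    have E: "exec (relocate (Binop f r p q)) \<sigma>' (1 + bits (reg \<sigma> p) + bits (reg \<sigma> q))
       (\<sigma>'\<lparr>reg := (reg \<sigma>')(r + 100 := binop_val f (reg \<sigma> p) (reg \<sigma> q))\<rparr>)"
      using exec.Binop[of f "r + 100" "p + 100" "q + 100" \<sigma>'] Binop by (simp add: simulated_def)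
    show ?case by (intro exI conjI, rule E, rule le)
      (use Binop in \<open>auto simp: simulated_def framed_def\<close>)
  next
    case (Load r a i \<sigma>)
    let ?\<tau> = "\<sigma>'\<lparr>reg := (reg \<sigma>')(98 := reg \<sigma> i * m + k)\<rparr>"
    have "exec (Load (r + 100) (a + 20) 98) ?\<tau> (1 + bits (reg \<sigma> i * m + k) + bits (arr \<sigma> a (reg \<sigma> i)))
      (?\<tau>\<lparr>reg := (reg ?\<tau>)(r + 100 := arr \<sigma> a (reg \<sigma> i))\<rparr>)"
      using exec.Load[of "r + 100" "a + 20" 98 ?\<tau>] Load by (simp add: simulated_def)
    then have E: "exec (relocate (Load r a i)) \<sigma>' (1 + bits (reg \<sigma> i) + bits m + (1 + bits (reg \<sigma> i * m) + bits k +
        (1 + bits (reg \<sigma> i * m + k) + bits (arr \<sigma> a (reg \<sigma> i)))))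
      (?\<tau>\<lparr>reg := (reg ?\<tau>)(r + 100 := arr \<sigma> a (reg \<sigma> i))\<rparr>)"
      unfolding relocate.simps using Load by (intro exec_relocated_index) auto
    show ?case by (intro exI conjI, rule E, rule relocated_index_cost)
      (use Load in \<open>auto simp: simulated_def framed_def\<close>)
  next
    case (Store a i r \<sigma>)
    let ?\<tau> = "\<sigma>'\<lparr>reg := (reg \<sigma>')(98 := reg \<sigma> i * m + k)\<rparr>"
    have "exec (Store (a + 20) 98 (r + 100)) ?\<tau> (1 + bits (reg \<sigma> i * m + k) + bits (reg \<sigma> r))
      (?\<tau>\<lparr>arr := (arr ?\<tau>)(a + 20 := (arr ?\<tau> (a + 20))(reg \<sigma> i * m + k := reg \<sigma> r))\<rparr>)"
      using exec.Store[of "a + 20" 98 "r + 100" ?\<tau>] Store by (simp add: simulated_def)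
    then have E: "exec (relocate (Store a i r)) \<sigma>' (1 + bits (reg \<sigma> i) + bits m + (1 + bits (reg \<sigma> i * m) + bits k +
        (1 + bits (reg \<sigma> i * m + k) + bits (reg \<sigma> r))))
      (?\<tau>\<lparr>arr := (arr ?\<tau>)(a + 20 := (arr ?\<tau> (a + 20))(reg \<sigma> i * m + k := reg \<sigma> r))\<rparr>)"
      unfolding relocate.simps using Store by (intro exec_relocated_index) auto
    show ?case by (intro exI conjI, rule E, rule relocated_index_cost)
      (use Store in \<open>auto simp: simulated_def framed_def\<close>)
  next
    case (Seq c \<sigma> t \<rho> d u \<tau>)
    obtain t' \<rho>' where 1: "exec (relocate c) \<sigma>' t' \<rho>'" "t' \<le> 10 * bits m * t"
        "simulated R m k \<rho> \<rho>'" "framed m k \<sigma>' \<rho>'"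
      using Seq.IH(1)[of \<sigma>'] Seq.prems by auto
    obtain u' \<tau>' where 2: "exec (relocate d) \<rho>' u' \<tau>'" "u' \<le> 10 * bits m * u"
        "simulated R m k \<tau> \<tau>'" "framed m k \<rho>' \<tau>'"
      using Seq.IH(2)[of \<rho>'] Seq.prems 1 by auto
    have E: "exec (relocate (Seq c d)) \<sigma>' (t' + u') \<tau>'"
      using 1 2 by (simp add: exec.Seq)
    show ?case by (intro exI conjI, rule E)
      (use 1 2 in \<open>auto simp: distrib_left intro: framed_trans\<close>)
  next
    case (CondTrue \<sigma> r c t \<tau> d)
    obtain t' \<tau>' where 1: "exec (relocate c) \<sigma>' t' \<tau>'" "t' \<le> 10 * bits m * t"
        "simulated R m k \<tau> \<tau>'" "framed m k \<sigma>' \<tau>'"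
      using CondTrue.IH[of \<sigma>'] CondTrue.prems by auto
    have "reg \<sigma>' (r + 100) = reg \<sigma> r" using CondTrue.prems by (simp add: simulated_def)
    then have E: "exec (relocate (Cond r c d)) \<sigma>' (1 + bits (reg \<sigma> r) + t') \<tau>'"
      using exec.CondTrue[of \<sigma>' "r + 100"] CondTrue.hyps 1 by simp
    show ?case by (intro exI conjI, rule E)
      (use 1 le[of "1 + bits (reg \<sigma> r)"] in \<open>auto simp: distrib_left\<close>)
  next
    case (CondFalse \<sigma> r d t \<tau> c)
    obtain t' \<tau>' where 1: "exec (relocate d) \<sigma>' t' \<tau>'" "t' \<le> 10 * bits m * t"
        "simulated R m k \<tau> \<tau>'" "framed m k \<sigma>' \<tau>'"
      using CondFalse.IH[of \<sigma>'] CondFalse.prems by auto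
    have "reg \<sigma>' (r + 100) = reg \<sigma> r" using CondFalse.prems by (simp add: simulated_def)
    then have E: "exec (relocate (Cond r c d)) \<sigma>' (1 + t') \<tau>'"
      using exec.CondFalse[of \<sigma>' "r + 100"] CondFalse.hyps 1 by simp
    show ?case by (intro exI conjI, rule E)
      (use 1 le[of 1] in \<open>auto simp: distrib_left\<close>)
  next
    case (WhileFalse \<sigma> r c)
    have "reg \<sigma>' (r + 100) = reg \<sigma> r" using WhileFalse.prems by (simp add: simulated_def)
    then have E: "exec (relocate (While r c)) \<sigma>' 1 \<sigma>'"
      using exec.WhileFalse[of \<sigma>' "r + 100"] WhileFalse.hyps by simp
    show ?case by (intro exI conjI, rule E, rule le)
      (use WhileFalse in \<open>auto simp: framed_refl\<close>)
  next
    case (WhileTrue \<sigma> r c t \<rho> u \<tau>)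
    obtain t' \<rho>' where 1: "exec (relocate c) \<sigma>' t' \<rho>'" "t' \<le> 10 * bits m * t"
        "simulated R m k \<rho> \<rho>'" "framed m k \<sigma>' \<rho>'"
      using WhileTrue.IH(1)[of \<sigma>'] WhileTrue.prems by auto
    obtain u' \<tau>' where 2: "exec (relocate (While r c)) \<rho>' u' \<tau>'" "u' \<le> 10 * bits m * u"
        "simulated R m k \<tau> \<tau>'" "framed m k \<rho>' \<tau>'"
      using WhileTrue.IH(2)[of \<rho>'] WhileTrue.prems 1 by auto
    have "reg \<sigma>' (r + 100) = reg \<sigma> r" using WhileTrue.prems by (simp add: simulated_def)
    then have E: "exec (relocate (While r c)) \<sigma>' (1 + bits (reg \<sigma> r) + t' + u') \<tau>'"
      using exec.WhileTrue[of \<sigma>' "r + 100"] WhileTrue.hyps 1 2 by simp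
    show ?case by (intro exI conjI, rule E)
      (use 1 2 le[of "1 + bits (reg \<sigma> r)"] in \<open>auto simp: distrib_left intro: framed_trans\<close>)
  qed
qed

text \<open>Registers from 100 on are shared by the evaluation of expressions and by all calls, so
  leftovers have to be removed before the called program can rely on its initial state.\<close>

primrec clear_regs :: "nat \<Rightarrow> com" where
  "clear_regs 0 = Skip"
| "clear_regs (Suc r) = Seq (clear_regs r) (Const (r + 100) 0)"

lemma exec_clear_regs:
  "\<exists>\<tau>. exec (clear_regs R) \<sigma> (R + 1) \<tau> \<and> (\<forall>r<R. reg \<tau> (r + 100) = 0) \<and>
    (\<forall>r<100. reg \<tau> r = reg \<sigma> r) \<and> arr \<tau> = arr \<sigma>"
proof (induction R)
  case 0
  show ?case using exec.Skip by auto
next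
  case (Suc R)
  then obtain \<tau> where *: "exec (clear_regs R) \<sigma> (R + 1) \<tau>" "\<forall>r<R. reg \<tau> (r + 100) = 0"
    "\<forall>r<100. reg \<tau> r = reg \<sigma> r" "arr \<tau> = arr \<sigma>" by blast
  have E: "exec (clear_regs (Suc R)) \<sigma> (Suc R + 1) (\<tau>\<lparr>reg := (reg \<tau>)(R + 100 := 0)\<rparr>)"
    using exec.Seq[OF *(1) exec.Const[of "R + 100" 0]] by (simp add: floorlog_def)
  show ?case by (intro exI conjI, rule E) (use * in \<open>auto simp: less_Suc_eq\<close>)
qed

definition call :: "nat \<Rightarrow> com \<Rightarrow> com" where
  "call R c = Seq (clear_regs R) (relocate c)"

text \<open>\<open>input\<close> speaks of all arrays and all indices: the residue class
  \<open>k\<close> must hold the input and be zero everywhere else, exactly as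
  \<open>init_state\<close> looks to the original program.\<close>

lemma hoare_call:
  assumes c: "exec c (init_state x) t \<sigma>" "regs_below R c" "has_output \<sigma> y"
    and m: "\<rho> 6 = m" "\<rho> 16 = k" "k < m"
    and input: "\<And>a i. \<alpha> (a + 20) (i * m + k) = arr (init_state x) a i"
  shows "hoare (call R c) (R + 1 + 10 * bits m * t) \<rho> \<alpha> (\<lambda>\<rho>' \<alpha>'.
    (\<forall>r. r \<noteq> 98 \<longrightarrow> \<rho>' r = \<rho> r) \<and> (\<forall>a<20. \<alpha>' a = \<alpha> a) \<and>
    (\<forall>a x. x mod m \<noteq> k \<longrightarrow> \<alpha>' (a + 20) x = \<alpha> (a + 20) x) \<and>
    (\<forall>i<length y. \<alpha>' 21 (i * m + k) = y ! i))"
  unfolding hoare_def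
proof (intro allI impI)
  fix \<sigma>\<^sub>0 assume \<sigma>\<^sub>0: "repr \<sigma>\<^sub>0 \<rho> \<alpha>"
  obtain \<sigma>\<^sub>1 where 1: "exec (clear_regs R) \<sigma>\<^sub>0 (R + 1) \<sigma>\<^sub>1" "\<forall>r<R. reg \<sigma>\<^sub>1 (r + 100) = 0"
    "\<forall>r<100. reg \<sigma>\<^sub>1 r = reg \<sigma>\<^sub>0 r" "arr \<sigma>\<^sub>1 = arr \<sigma>\<^sub>0"
    using exec_clear_regs by blast
  have "simulated R m k (init_state x) \<sigma>\<^sub>1"
    using 1 \<sigma>\<^sub>0 m input by (auto simp: simulated_def repr_def init_state_def)
  then obtain u \<tau> where 2: "exec (relocate c) \<sigma>\<^sub>1 u \<tau>" "u \<le> 10 * bits m * t"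
    "simulated R m k \<sigma> \<tau>" "framed m k \<sigma>\<^sub>1 \<tau>"
    using exec_relocate[OF c(1,2) m(3)] by blast
  have E: "exec (call R c) \<sigma>\<^sub>0 (R + 1 + u) \<tau>"
    unfolding call_def by (rule exec.Seq[OF 1(1) 2(1)])
  have "repr \<tau> (\<lambda>r. if r = 98 then reg \<tau> 98 else \<rho> r) (arr \<tau>)"
    using 1 2 \<sigma>\<^sub>0 by (auto simp: repr_def framed_def)
  moreover have "arr \<tau> 21 (i * m + k) = y ! i" if "i < length y" for i
  proof -
    have "arr \<tau> (1 + 20) (i * m + k) = y ! i"
      using 2(3) c(3) that by (auto simp only: simulated_def has_output_def)
    then show ?thesis by simp
  qed
  ultimately show "\<exists>t' \<tau> \<rho>' \<alpha>'. exec (call R c) \<sigma>\<^sub>0 t' \<tau> \<and> t' \<le> R + 1 + 10 * bits m * t \<and> repr \<tau> \<rho>' \<alpha>' \<and>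
    (\<forall>r. r \<noteq> 98 \<longrightarrow> \<rho>' r = \<rho> r) \<and> (\<forall>a<20. \<alpha>' a = \<alpha> a) \<and>
    (\<forall>a x. x mod m \<noteq> k \<longrightarrow> \<alpha>' (a + 20) x = \<alpha> (a + 20) x) \<and>
    (\<forall>i<length y. \<alpha>' 21 (i * m + k) = y ! i)"
    using E 1 2 \<sigma>\<^sub>0
    by (intro exI[of _ "R + 1 + u"] exI[of _ \<tau>] exI[of _ "\<lambda>r. if r = 98 then reg \<tau> 98 else \<rho> r"] exI[of _ "arr \<tau>"])
       (auto simp: framed_def repr_def)
qed

text \<open>A store changes at most one cell, no other instruction changes any, and each instruction
  costs at least 1. This yields the quadratic lower bound for matrix multiplication.\<close>

lemma card_changed_cells_le:
  assumes "exec c \<sigma> t \<tau>"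
  shows "finite {i. arr \<tau> a i \<noteq> arr \<sigma> a i} \<and> card {i. arr \<tau> a i \<noteq> arr \<sigma> a i} \<le> t"
  using assms
proof (induction rule: exec.induct)
  case (Store b i r \<sigma>)
  let ?S = "{j. arr (\<sigma>\<lparr>arr := (arr \<sigma>)(b := (arr \<sigma> b)(reg \<sigma> i := reg \<sigma> r))\<rparr>) a j \<noteq> arr \<sigma> a j}"
  have "?S \<subseteq> {reg \<sigma> i}" by (auto split: if_splits)
  then have "finite ?S" "card ?S \<le> card {reg \<sigma> i}"
    by (auto intro: finite_subset card_mono simp del: card.insert)
  then show ?case by simp
next
  case (Seq c \<sigma> t \<rho> d u \<tau>)
  have sub: "{i. arr \<tau> a i \<noteq> arr \<sigma> a i} \<subseteq> {i. arr \<rho> a i \<noteq> arr \<sigma> a i} \<union> {i. arr \<tau> a i \<noteq> arr \<rho> a i}"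
    by auto
  show ?case using finite_subset[OF sub] card_mono[OF _ sub] Seq
    card_Un_le[of "{i. arr \<rho> a i \<noteq> arr \<sigma> a i}" "{i. arr \<tau> a i \<noteq> arr \<rho> a i}"] by force
next
  case (WhileTrue \<sigma> r c t \<rho> u \<tau>)
  have sub: "{i. arr \<tau> a i \<noteq> arr \<sigma> a i} \<subseteq> {i. arr \<rho> a i \<noteq> arr \<sigma> a i} \<union> {i. arr \<tau> a i \<noteq> arr \<rho> a i}"
    by auto
  show ?case using finite_subset[OF sub] card_mono[OF _ sub] WhileTrue
    card_Un_le[of "{i. arr \<rho> a i \<noteq> arr \<sigma> a i}" "{i. arr \<tau> a i \<noteq> arr \<rho> a i}"] by force
qed auto

section \<open>Divide and conquer in Morton order\<close>

function morton :: "nat \<Rightarrow> nat \<Rightarrow> nat" where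
  "morton a b = (if a = 0 \<and> b = 0 then 0 else 4 * morton (a div 2) (b div 2) + 2 * (a mod 2) + b mod 2)"
  by auto
termination
proof (relation "measure (\<lambda>(a, b). a + b)")
  show "\<not> (a = 0 \<and> b = 0) \<Longrightarrow> ((a div 2, b div 2), (a, b)) \<in> measure (\<lambda>(a, b). a + b)" for a b :: nat
    by simp presburger
qed simp

fun morton_fst :: "nat \<Rightarrow> nat" where
  "morton_fst t = (if t = 0 then 0 else 2 * morton_fst (t div 4) + t div 2 mod 2)"

fun morton_snd :: "nat \<Rightarrow> nat" where
  "morton_snd t = (if t = 0 then 0 else 2 * morton_snd (t div 4) + t mod 2)"

declare morton.simps[simp del] morton_fst.simps[simp del] morton_snd.simps[simp del]

lemma morton_zero [simp]: "morton 0 0 = 0" "morton_fst 0 = 0" "morton_snd 0 = 0"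
  by (subst morton.simps morton_fst.simps morton_snd.simps; simp)+

lemma base_4_digits:
  fixes x a b t :: nat
  shows "4 * (t div 4) + 2 * (t div 2 mod 2) + t mod 2 = t"
    and "(4 * x + 2 * (a mod 2) + b mod 2) div 4 = x"
    and "(4 * x + 2 * (a mod 2) + b mod 2) div 2 mod 2 = a mod 2"
    and "(4 * x + 2 * (a mod 2) + b mod 2) mod 2 = b mod 2"
proof -
  have "t div 2 div 2 = t div 4" by (simp add: div_mult2_eq[symmetric])
  then show "4 * (t div 4) + 2 * (t div 2 mod 2) + t mod 2 = t"
    using div_mult_mod_eq[of t 2] div_mult_mod_eq[of "t div 2" 2] by linarith
  have "(4 * x + 2 * c + d) div 2 = 2 * x + c" "(4 * x + 2 * c + d) div 4 = x"
    if "c < 2" "d < 2" for c d :: nat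
    using that by (auto intro!: div_nat_eqI)
  then have *: "(4 * x + 2 * (a mod 2) + b mod 2) div 2 = 2 * x + a mod 2"
    and "(4 * x + 2 * (a mod 2) + b mod 2) div 4 = x"
    by simp_all
  then show "(4 * x + 2 * (a mod 2) + b mod 2) div 4 = x" by blast
  show "(4 * x + 2 * (a mod 2) + b mod 2) div 2 mod 2 = a mod 2"
    unfolding * by simp
  show "(4 * x + 2 * (a mod 2) + b mod 2) mod 2 = b mod 2"
    using div_mult_mod_eq[of "4 * x + 2 * (a mod 2) + b mod 2" 2] * by linarith
qed

lemma morton_rec: "morton a b = 4 * morton (a div 2) (b div 2) + 2 * (a mod 2) + b mod 2"
proof (cases "a = 0 \<and> b = 0")
  case False
  then show ?thesis by (subst morton.simps) (simp only: if_False)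
qed simp

lemma morton_div_4: "morton a b div 4 = morton (a div 2) (b div 2)"
  by (subst morton_rec) (rule base_4_digits)

text \<open>Dropping \<open>j\<close> base-4 digits of the code drops \<open>j\<close> binary digits
  of both coordinates. Hence an aligned block of side \<open>2^j\<close> is exactly a run of
  \<open>4^j\<close> consecutive codes, and its position in the order is the Morton code of the
  block coordinates.\<close>

lemma morton_div: "morton a b div 4 ^ j = morton (a div 2 ^ j) (b div 2 ^ j)"
  by (induction j) (simp_all add: div_mult2_eq mult.commute[of _ "4 ^ _"] mult.commute[of _ "2 ^ _"] morton_div_4)

lemma morton_inverse: "morton (morton_fst t) (morton_snd t) = t"
proof (induction t rule: less_induct)
  case (less t)
  show ?case
  proof (cases "t = 0")
    case False
    have "morton (morton_fst t) (morton_snd t) =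
        4 * morton (morton_fst (t div 4)) (morton_snd (t div 4)) + 2 * (t div 2 mod 2) + t mod 2"
      by (subst morton_rec) (simp add: morton_fst.simps[of t] morton_snd.simps[of t] False)
    also have "\<dots> = t" using less[of "t div 4"] False by (simp add: base_4_digits(1) del: mult_Suc)
    finally show ?thesis .
  qed simp
qed

lemma morton_fst_morton: "morton_fst (morton a b) = a"
  and morton_snd_morton: "morton_snd (morton a b) = b"
proof (induction a b rule: morton.induct)
  case (1 a b)
  let ?t = "morton a b"
  have digits: "?t div 4 = morton (a div 2) (b div 2)" "?t div 2 mod 2 = a mod 2" "?t mod 2 = b mod 2"
    by (subst morton_rec, rule base_4_digits)+
  have nonzero: "?t \<noteq> 0" if *: "\<not> (a = 0 \<and> b = 0)"
  proof
    assume "?t = 0"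
    then have "a div 2 = 0" "b div 2 = 0" using 1[OF *] digits by simp_all
    moreover have "a mod 2 = 0" "b mod 2 = 0" using \<open>?t = 0\<close> digits by simp_all
    ultimately show False using * by auto
  qed
  show "morton_fst ?t = a"
  proof (cases "a = 0 \<and> b = 0")
    case False
    then have "?t \<noteq> 0" by (rule nonzero)
    then have "morton_fst ?t = 2 * morton_fst (?t div 4) + ?t div 2 mod 2"
      by (subst morton_fst.simps) simp
    then show ?thesis using 1(1)[OF False] digits by simp
  qed simp
  show "morton_snd ?t = b"
  proof (cases "a = 0 \<and> b = 0")
    case False
    then have "?t \<noteq> 0" by (rule nonzero)
    then have "morton_snd ?t = 2 * morton_snd (?t div 4) + ?t mod 2"
      by (subst morton_snd.simps) simp
    then show ?thesis using 1(2)[OF False] digits by simp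
  qed simp
qed

lemma morton_eq_iff: "morton a b = morton c d \<longleftrightarrow> a = c \<and> b = d"
  by (metis morton_fst_morton morton_snd_morton)

lemma morton_fst_less: "t < 4 ^ L \<Longrightarrow> morton_fst t < 2 ^ L"
proof (induction L arbitrary: t)
  case (Suc L)
  then have "morton_fst (t div 4) < 2 ^ L" by (intro Suc.IH) auto
  then show ?case by (subst morton_fst.simps) auto
qed simp

lemma morton_snd_less: "t < 4 ^ L \<Longrightarrow> morton_snd t < 2 ^ L"
proof (induction L arbitrary: t)
  case (Suc L)
  then have "morton_snd (t div 4) < 2 ^ L" by (intro Suc.IH) auto
  then show ?case by (subst morton_snd.simps) auto
qed simp

text \<open>The level \<open>j\<close> is the highest binary digit in which \<open>k\<close> and
  \<open>u\<close> differ: above it they agree, and there \<open>k\<close> has digit 0 and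
  \<open>u\<close> has digit 1.\<close>

lemma separating_level:
  assumes "k < (u::nat)"
  shows "\<exists>j. u div 2 ^ j = Suc (k div 2 ^ j) \<and> even (k div 2 ^ j)"
  using assms
proof (induction u arbitrary: k rule: less_induct)
  case (less u)
  show ?case
  proof (cases "u div 2 = k div 2")
    case True
    then have "u div 2 ^ 0 = Suc (k div 2 ^ 0) \<and> even (k div 2 ^ 0)"
      using less.prems by simp presburger
    then show ?thesis by blast
  next
    case False
    then have "k div 2 < u div 2" using less.prems by presburger
    then obtain j where "u div 2 div 2 ^ j = Suc (k div 2 div 2 ^ j) \<and> even (k div 2 div 2 ^ j)"
      using less.IH[of "u div 2" "k div 2"] less.prems by auto
    then show ?thesis by (intro exI[of _ "Suc j"]) (simp add: div_mult2_eq)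
  qed
qed

text \<open>The winner of the game in negamax form: \<open>negamax E f u v\<close> states that the player to move, whose
  own token is on \<open>u\<close> and whose opponent's token is on \<open>v\<close>, wins.\<close>

declare conj_cong[fundef_cong]

function negamax :: "(nat \<Rightarrow> nat \<Rightarrow> bool) \<Rightarrow> (nat \<Rightarrow> nat \<Rightarrow> bool) \<Rightarrow> nat \<Rightarrow> nat \<Rightarrow> bool" where
  "negamax E f u v \<longleftrightarrow> f u v \<or> (\<exists>k<u. E u k \<and> \<not> negamax E f v k)"
  by auto
text \<open>The recursive call is at \<open>(v, k)\<close> with \<open>k < u\<close>, so the sum of
  the two positions decreases although they change places; the guard reaches the termination
  condition through \<open>conj_cong\<close>.\<close>

termination by (relation "measure (\<lambda>(E, f, u, v). u + v)") auto

declare negamax.simps[simp del]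

lemma negamax_base: "f u v \<Longrightarrow> negamax E f u v"
  by (subst negamax.simps) simp

text \<open>The block \<open>(I, J)\<close> of level \<open>j\<close> ends just before code
  \<open>(morton I J + 1) * 4^j\<close>, and \<open>t\<close> counts the codes already passed. A
  block also counts as done when its transpose is, because the contributions of both are made at the
  same moment.\<close>

definition block_done :: "nat \<Rightarrow> nat \<Rightarrow> nat \<Rightarrow> nat \<Rightarrow> bool" where
  "block_done t j I J \<longleftrightarrow> (morton I J + 1) * 4 ^ j \<le> t \<or> (morton J I + 1) * 4 ^ j \<le> t"

text \<open>A block product: rows \<open>Suc J\<close> and columns \<open>J\<close> of
  \<open>E\<close> times the transposed complement of rows \<open>I\<close> and columns
  \<open>J\<close> of \<open>X\<close>, added to rows \<open>Suc J\<close> and columns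
  \<open>I\<close>.\<close>

definition update :: "nat \<Rightarrow> nat \<Rightarrow> nat \<Rightarrow> (nat \<Rightarrow> nat \<Rightarrow> bool) \<Rightarrow> (nat \<Rightarrow> nat \<Rightarrow> bool) \<Rightarrow> nat \<Rightarrow> nat \<Rightarrow> bool" where
  "update s I J E X u v \<longleftrightarrow> X u v \<or>
     (u div s = Suc J \<and> v div s = I \<and> (\<exists>k. k div s = J \<and> E u k \<and> \<not> X v k))"

locale triangular_game =
  fixes L N :: nat and E f :: "nat \<Rightarrow> nat \<Rightarrow> bool"
  assumes N: "N = 2 ^ L" and E: "E u k \<Longrightarrow> k < u \<and> u < N"
begin

abbreviation "Z \<equiv> negamax E f"

text \<open>Rows are not restricted to \<open>u < N\<close>, since the block of rows after the last
  one lies outside the matrix and is written nevertheless.\<close>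

definition sound :: "(nat \<Rightarrow> nat \<Rightarrow> bool) \<Rightarrow> bool" where
  "sound X \<longleftrightarrow> (\<forall>u. \<forall>v<N. (f u v \<longrightarrow> X u v) \<and> (X u v \<longrightarrow> Z u v))"

text \<open>Phrased with the true value \<open>Z\<close> and not with the current \<open>X\<close>,
  so that the property persists while \<open>X\<close> grows.\<close>

definition contributed :: "nat \<Rightarrow> nat \<Rightarrow> nat \<Rightarrow> (nat \<Rightarrow> nat \<Rightarrow> bool) \<Rightarrow> bool" where
  "contributed j I J X \<longleftrightarrow> (\<forall>u v k. u div 2 ^ j = Suc J \<longrightarrow> k div 2 ^ j = J \<longrightarrow> v div 2 ^ j = I \<longrightarrow>
     v < N \<longrightarrow> E u k \<longrightarrow> \<not> Z v k \<longrightarrow> X u v)"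

text \<open>The state inside step \<open>t\<close> after its levels below \<open>j\<close>: blocks
  that ended before code \<open>t\<close> have contributed on all levels, and blocks ending at code
  \<open>t\<close> have contributed on the levels already treated.\<close>

definition invariant :: "nat \<Rightarrow> nat \<Rightarrow> (nat \<Rightarrow> nat \<Rightarrow> bool) \<Rightarrow> bool" where
  "invariant t j X \<longleftrightarrow> sound X \<and>
     (\<forall>j' I J. block_done t j' I J \<or> j' < j \<and> block_done (t + 1) j' I J \<longrightarrow> contributed j' I J X)"

lemma invariant_init: "(\<And>u v. v < N \<Longrightarrow> X u v = f u v) \<Longrightarrow> invariant 0 0 X"
  by (auto simp: invariant_def sound_def block_done_def negamax_base)

text \<open>A winning move of the cell \<open>(v, k)\<close> to \<open>w\<close> is decided by the
  cell \<open>(k, w)\<close>. On the level that separates \<open>w\<close> from \<open>v\<close>,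
  the block of \<open>(k, w)\<close> or its transpose ends before the block containing the cell with
  code at most \<open>t\<close> begins. It has therefore contributed, and its contribution sets
  \<open>X v k\<close>.\<close>

lemma invariant_exact:
  assumes inv: "invariant t j X" and vk: "v < N" "k < N" and t: "morton v k \<le> t \<or> morton k v \<le> t"
  shows "X v k = Z v k"
proof
  show "X v k \<Longrightarrow> Z v k" using inv vk by (auto simp: invariant_def sound_def)
  assume "Z v k"
  then consider "f v k" | w where "w < v" "E v w" "\<not> Z k w"
    by (subst (asm) negamax.simps) auto
  then show "X v k"
  proof cases
    case 1
    then show ?thesis using inv vk by (auto simp: invariant_def sound_def)
  next
    case 2
    obtain i where i: "v div 2 ^ i = Suc (w div 2 ^ i)" "even (w div 2 ^ i)"
      using separating_level[OF 2(1)] by blast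
    let ?J = "w div 2 ^ i" and ?I = "k div 2 ^ i"
    have "block_done t i ?I ?J"
      using t
    proof
      assume "morton v k \<le> t"
      \<comment> \<open>The transposed block \<open>(?J, ?I)\<close> and the block
        \<open>(Suc ?J, ?I)\<close> of the cell \<open>(v, k)\<close> have the same parent because
        \<open>?J\<close> is even; their codes differ only in the last base-4 digit.\<close>
      have "morton ?J ?I + 1 \<le> morton (v div 2 ^ i) ?I"
        unfolding i(1) morton_rec[of "Suc ?J"] morton_rec[of ?J] using i(2) by auto
      also have "\<dots> = morton v k div 4 ^ i" by (rule morton_div[symmetric])
      finally have "(morton ?J ?I + 1) * 4 ^ i \<le> morton v k"
        by (simp add: less_eq_div_iff_mult_less_eq)
      with \<open>morton v k \<le> t\<close> show ?thesis by (auto simp: block_done_def)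
    next
      assume "morton k v \<le> t"
      have "morton ?I ?J + 1 \<le> morton ?I (v div 2 ^ i)"
        unfolding i(1) morton_rec[of _ "Suc ?J"] morton_rec[of _ ?J] using i(2) by auto
      also have "\<dots> = morton k v div 4 ^ i" by (rule morton_div[symmetric])
      finally have "(morton ?I ?J + 1) * 4 ^ i \<le> morton k v"
        by (simp add: less_eq_div_iff_mult_less_eq)
      with \<open>morton k v \<le> t\<close> show ?thesis by (auto simp: block_done_def)
    qed
    then have "contributed i ?I ?J X" using inv by (auto simp: invariant_def)
    then show ?thesis using 2 i vk by (auto simp: contributed_def)
  qed
qed

text \<open>The condition on \<open>t\<close> says that the source block or its transpose ends no
  later than code \<open>t\<close>, so \<open>X\<close> is exact on it. Only this makes the
  complement safe: a cell that is merely not yet set would otherwise be taken for a lost position of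
  the opponent.\<close>

lemma invariant_update:
  assumes inv: "invariant t j X" and X': "\<And>u v. v < N \<Longrightarrow> X' u v = update (2 ^ i) I J E X u v"
    and t: "(morton I J + 1) * 4 ^ i \<le> t + 1 \<or> (morton J I + 1) * 4 ^ i \<le> t + 1"
  shows "invariant t j X' \<and> contributed i I J X'"
proof -
  have exact: "X v k = Z v k" if "v < N" "k < N" "v div 2 ^ i = I" "k div 2 ^ i = J" for v k
  proof -
    have "morton v k < (morton v k div 4 ^ i + 1) * 4 ^ i" "morton k v < (morton k v div 4 ^ i + 1) * 4 ^ i"
      by (simp_all add: dividend_less_div_times)
    then have "morton v k \<le> t \<or> morton k v \<le> t"
      using t that unfolding morton_div by auto
    then show ?thesis by (rule invariant_exact[OF inv that(1,2)])
  qed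
  have mono: "X u v \<Longrightarrow> X' u v" if "v < N" for u v using X' that by (simp add: update_def)
  have snd: "Z u v" if v: "v < N" and x': "X' u v" for u v
  proof -
    consider "X u v" | k where "u div 2 ^ i = Suc J" "v div 2 ^ i = I" "k div 2 ^ i = J" "E u k" "\<not> X v k"
      using x' X'[OF v] by (auto simp: update_def)
    then show ?thesis
    proof cases
      case 1
      then show ?thesis using inv v by (auto simp: invariant_def sound_def)
    next
      case 2
      then have "\<not> Z v k" using exact[of v k] v E[of u k] by auto
      then show ?thesis using 2 E[of u k] by (subst negamax.simps) auto
    qed
  qed
  have "contributed i I J X'"
    unfolding contributed_def
  proof (intro allI impI)
    fix u v k assume *: "u div 2 ^ i = Suc J" "k div 2 ^ i = J" "v div 2 ^ i = I" "v < N" "E u k" "\<not> Z v k"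
    then have "\<not> X v k" using exact[of v k] E[of u k] by auto
    with * show "X' u v" unfolding X'[OF *(4)] update_def by blast
  qed
  moreover have "invariant t j X'"
  proof -
    have "contributed i' I' J' X'" if "contributed i' I' J' X" for i' I' J'
      using that mono unfolding contributed_def by blast
    then show ?thesis
      using inv mono snd unfolding invariant_def sound_def by blast
  qed
  ultimately show ?thesis by blast
qed

text \<open>If \<open>4^j\<close> divides \<open>t + 1\<close>, then \<open>t\<close> is the last
  code of a block of level \<open>j\<close>. This block and its transpose are the only ones of that
  level that become done in step \<open>t\<close>, so two updates suffice.\<close>

lemma invariant_level:
  assumes inv: "invariant t j X" and t: "t < 4 ^ L" and j: "4 ^ j dvd t + 1"
  defines "I \<equiv> morton_fst t div 2 ^ j" and "J \<equiv> morton_snd t div 2 ^ j"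
  assumes X\<^sub>1: "\<And>u v. v < N \<Longrightarrow> X\<^sub>1 u v = update (2 ^ j) I J E X u v"
    and X\<^sub>2: "\<And>u v. v < N \<Longrightarrow> X\<^sub>2 u v = update (2 ^ j) J I E X\<^sub>1 u v"
  shows "invariant t (Suc j) X\<^sub>2"
proof -
  have mIJ: "morton I J = t div 4 ^ j"
    unfolding I_def J_def morton_div[symmetric] morton_inverse ..
  obtain q where q: "t + 1 = 4 ^ j * q" using j by (auto elim: dvdE)
  then obtain r where r: "q = Suc r" by (cases q) auto
  \<comment> \<open>The last \<open>j\<close> base-4 digits of \<open>t\<close> are all 3, so
    dividing by \<open>4^j\<close> leaves the code \<open>r\<close> of the block.\<close>
  have t_eq: "t = r * 4 ^ j + (4 ^ j - 1)" using q unfolding r by (simp add: algebra_simps)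
  have "t div 4 ^ j = r" 

  proof -
    have "(r * p + (p - 1)) div p = r" if "0 < p" for p
      by (rule div_nat_eqI) (use that in \<open>cases p; simp\<close>)+
    then show ?thesis unfolding t_eq by simp
  qed
  with mIJ q r have mt: "(morton I J + 1) * 4 ^ j = t + 1" by (simp add: algebra_simps)
  have 1: "invariant t j X\<^sub>1" "contributed j I J X\<^sub>1"
    using invariant_update[OF inv X\<^sub>1] mt by auto
  have 2: "invariant t j X\<^sub>2" "contributed j J I X\<^sub>2"
    using invariant_update[OF 1(1) X\<^sub>2] mt by auto
  have 3: "contributed j I J X\<^sub>2"
    using 1(2) X\<^sub>2 unfolding contributed_def update_def by blast
  have "contributed j' I' J' X\<^sub>2"
    if "block_done t j' I' J' \<or> j' < Suc j \<and> block_done (t + 1) j' I' J'" for j' I' J'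
  proof (cases "block_done t j' I' J' \<or> j' < j \<and> block_done (t + 1) j' I' J'")
    case True
    then show ?thesis using 2(1) unfolding invariant_def by blast
  next
    case False
    with that have [simp]: "j' = j" by (auto simp: less_Suc_eq)
    from that False have *: "block_done (t + 1) j I' J'" "\<not> block_done t j I' J'" by simp_all
    then have "(morton I' J' + 1) * 4 ^ j = t + 1 \<or> (morton J' I' + 1) * 4 ^ j = t + 1"
      by (auto simp: block_done_def)
    then have "(morton I' J' + 1) * 4 ^ j = (morton I J + 1) * 4 ^ j \<or>
        (morton J' I' + 1) * 4 ^ j = (morton I J + 1) * 4 ^ j"
      unfolding mt .
    then have "morton I' J' = morton I J \<or> morton J' I' = morton I J" by auto
    then have "I' = I \<and> J' = J \<or> I' = J \<and> J' = I" by (auto simp: morton_eq_iff)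
    then show ?thesis using 2 3 by auto
  qed
  then show ?thesis using 2(1) by (auto simp: invariant_def)
qed

text \<open>Blocks of level \<open>j\<close> end at multiples of \<open>4^j\<close>, so none becomes
  done between \<open>t\<close> and \<open>t + 1\<close>.\<close>

lemma invariant_skip_level:
  assumes inv: "invariant t j X" and j: "\<not> 4 ^ j dvd t + 1"
  shows "invariant t (Suc j) X"
proof -
  have le: "x * 4 ^ j \<le> t" if "x * 4 ^ j \<le> t + 1" for x
    using that j by (metis Suc_eq_plus1 dvd_triv_right le_SucE)
  have "block_done t j I J" if "block_done (t + 1) j I J" for I J
    using that le unfolding block_done_def by blast
  then show ?thesis using inv unfolding invariant_def less_Suc_eq by blast
qed

text \<open>A block of a level above \<open>L\<close> needs more than \<open>4^L\<close> codes and
  cannot be done yet; having treated the levels up to \<open>L\<close> means having treated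
  all.\<close>

lemma invariant_next:
  assumes inv: "invariant t (Suc L) X" and t: "t < 4 ^ L"
  shows "invariant (Suc t) 0 X"
proof -
  have "j < Suc L" if "block_done (t + 1) j I J" for j I J
  proof -
    have "1 * 4 ^ j \<le> (t + 1)"
      using that unfolding block_done_def by (auto intro: le_trans[rotated])
    also have "\<dots> \<le> 4 ^ L" using t by simp
    finally show ?thesis by (simp add: power_le_imp_le_exp less_Suc_eq_le)
  qed
  then show ?thesis using inv unfolding invariant_def by auto
qed

lemma invariant_final:
  assumes "invariant (4 ^ L) 0 X" "u < N" "v < N"
  shows "X u v = Z u v"
proof (rule invariant_exact[OF assms])
  have "morton u v div 4 ^ L = morton 0 0" using assms N by (simp add: morton_div)
  then have "morton u v < 4 ^ L" by (simp add: div_eq_0_iff)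
  then show "morton u v \<le> 4 ^ L \<or> morton v u \<le> 4 ^ L" by simp
qed

end

section \<open>Counting the products on each level\<close>

lemma card_multiples_Suc:
  assumes "0 < (a::nat)"
  shows "card {t. t < a * b \<and> a dvd t + 1} = b"
proof -
  have "{t. t < a * b \<and> a dvd t + 1} = (\<lambda>i. a * i + (a - 1)) ` {..<b}" (is "?A = ?B")
  proof
    show "?B \<subseteq> ?A"
    proof clarify
      fix i assume "i < b"
      then have "a * (i + 1) \<le> a * b" by (intro mult_le_mono2) auto
      moreover have "a * i + (a - 1) + 1 = a * (i + 1)" using assms by simp
      ultimately show "a * i + (a - 1) < a * b \<and> a dvd a * i + (a - 1) + 1"
        by (metis Suc_eq_plus1 Suc_le_eq dvd_triv_left)
    qed
    show "?A \<subseteq> ?B"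
    proof
      fix t assume "t \<in> ?A"
      then obtain q where q: "t + 1 = a * q" "t < a * b" by (auto elim: dvdE)
      then obtain r where r: "q = Suc r" by (cases q) auto
      have "t = a * r + (a - 1)" using q assms unfolding r by simp
      moreover have "r < b"
      proof -
        have "a * q \<le> a * b" using q by linarith
        then have "a * Suc r \<le> a * b" unfolding r .
        then show ?thesis using assms by (simp only: mult_le_cancel1 Suc_le_eq)
      qed
      ultimately show "t \<in> ?B" by auto
    qed
  qed
  moreover have "inj_on (\<lambda>i. a * i + (a - 1)) {..<b}" using assms by (intro inj_onI) (simp only: add_right_cancel mult_cancel1, simp)
  ultimately show ?thesis by (simp add: card_image)
qed

text \<open>After exchanging the sums, level \<open>j\<close> is active for the codes
  \<open>4^j * i + (4^j - 1)\<close>, of which there are \<open>4^(L - j)\<close> below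
  \<open>4^L\<close>.\<close>

lemma sum_level_costs:
  fixes c :: "nat \<Rightarrow> nat"
  shows "(\<Sum>t<4 ^ L :: nat. \<Sum>j<Suc L. if 4 ^ j dvd t + 1 then c j else 0) = (\<Sum>j<Suc L. 4 ^ (L - j) * c j)"
proof -
  have "(\<Sum>t<4 ^ L :: nat. if 4 ^ j dvd t + 1 then c j else 0) = 4 ^ (L - j) * c j" if "j < Suc L" for j
  proof -
    have "(4::nat) ^ L = 4 ^ j * 4 ^ (L - j)" using that by (simp add: power_add[symmetric])
    then have "card {t :: nat. t < 4 ^ L \<and> 4 ^ j dvd t + 1} = 4 ^ (L - j)"
      using card_multiples_Suc[of "4 ^ j" "4 ^ (L - j)"] by simp
    moreover have "(\<Sum>t<4 ^ L :: nat. if 4 ^ j dvd t + 1 then c j else 0) = (\<Sum>t\<in>{t :: nat. t < 4 ^ L \<and> 4 ^ j dvd t + 1}. c j)"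
      by (intro sum.mono_neutral_cong_right) auto
    ultimately show ?thesis by simp
  qed
  then show ?thesis by (subst sum.swap) simp
qed

section \<open>Topological sorting\<close>

text \<open>For an unplaced vertex \<open>d\<close> counts its arcs to unplaced vertices. A placed
  vertex is marked by \<open>2 * N + 1\<close>; later rounds decrement marks like ordinary degrees,
  by at most 1 each, so with \<open>p \<le> N\<close> a mark stays above \<open>N\<close> and a
  search for degree 0 never finds a placed vertex.\<close>

definition sorted_upto :: "nat \<Rightarrow> (nat \<Rightarrow> nat \<Rightarrow> bool) \<Rightarrow> nat \<Rightarrow> (nat \<Rightarrow> nat) \<Rightarrow> (nat \<Rightarrow> nat) \<Rightarrow> bool" where
  "sorted_upto N A p d ord \<longleftrightarrow> inj_on ord {..<p} \<and> ord ` {..<p} \<subseteq> {..<N} \<and>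
     (\<forall>w<N. w \<notin> ord ` {..<p} \<longrightarrow> d w = card {u. u < N \<and> u \<notin> ord ` {..<p} \<and> A w u}) \<and>
     (\<forall>w\<in>ord ` {..<p}. 2 * N < d w + p) \<and>
     (\<forall>i<p. \<forall>u<N. A (ord i) u \<longrightarrow> u \<in> ord ` {..<i})"

lemma sorted_upto_0:
  "(\<And>w. w < N \<Longrightarrow> d w = card {u. u < N \<and> A w u}) \<Longrightarrow> sorted_upto N A 0 d ord"
  by (simp add: sorted_upto_def)

text \<open>Fewer than \<open>N\<close> vertices are placed, so the set of unplaced ones is nonempty
  and has a minimal element for the converse of the acyclic relation; all its successors are
  placed.\<close>

lemma ex_sink:
  assumes "sorted_upto N A p d ord" "p < N" and acyc: "acyclic {(u, w). u < N \<and> w < N \<and> A u w}"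
  shows "\<exists>r<N. d r = 0"
proof -
  let ?R = "{(u, w). u < N \<and> w < N \<and> A u w}" and ?S = "ord ` {..<p}"
  have "finite ?R" by (rule finite_subset[of _ "{..<N} \<times> {..<N}"]) auto
  then have wf: "wf (?R\<inverse>)" using acyc by (rule finite_acyclic_wf_converse)
  have "card ?S \<le> p" using card_image_le[of "{..<p}" ord] by simp
  then have "\<not> {..<N} \<subseteq> ?S" using assms(2) card_mono[of ?S "{..<N}"] by auto
  then obtain x where "x \<in> {..<N} - ?S" by blast
  from wfE_min[OF wf this] obtain r where r: "r \<in> {..<N} - ?S"
    and min: "\<And>y. (y, r) \<in> ?R\<inverse> \<Longrightarrow> y \<notin> {..<N} - ?S"
    by blast
  have "{u. u < N \<and> u \<notin> ?S \<and> A r u} = {}" using min r by auto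
  then have "d r = 0" using assms(1) r by (auto simp: sorted_upto_def)
  then show ?thesis using r by auto
qed

lemma sorted_upto_Suc:
  assumes sorted: "sorted_upto N A p d ord" and p: "p < N" and r: "r < N" "d r = 0"
    and ord': "\<And>i. i < p \<Longrightarrow> ord' i = ord i" "ord' p = r"
    and d': "\<And>w. w < N \<Longrightarrow> d' w = (if w = r then 2 * N + 1 else d w) - of_bool (A w r)"
  shows "sorted_upto N A (Suc p) d' ord'"
proof -
  let ?S = "ord ` {..<p}"
  have im: "ord' ` {..<i} = ord ` {..<i}" if "i \<le> p" for i using ord'(1) that by auto
  have S': "ord' ` {..<Suc p} = insert r ?S" unfolding lessThan_Suc using im ord'(2) by auto
  have rS: "r \<notin> ?S"
  proof
    assume "r \<in> ?S"
    then have "2 * N < d r + p" using sorted unfolding sorted_upto_def by blast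
    then show False using r p by simp
  qed
  have "inj_on ord' {..<Suc p}"
    unfolding lessThan_Suc inj_on_insert using sorted rS im[of p] ord'
    by (auto simp: sorted_upto_def inj_on_def)
  moreover have "insert r ?S \<subseteq> {..<N}" using sorted r by (auto simp: sorted_upto_def)
  moreover have "d' w = card {u. u < N \<and> u \<notin> insert r ?S \<and> A w u}" if w: "w < N" "w \<notin> insert r ?S" for w
  proof -
    let ?B = "{u. u < N \<and> u \<notin> ?S \<and> A w u}"
    have "{u. u < N \<and> u \<notin> insert r ?S \<and> A w u} = ?B - {r}" by auto
    moreover have "card (?B - {r}) = card ?B - of_bool (A w r)"
    proof (cases "A w r")
      case True
      then have "r \<in> ?B" using r rS by auto
      then show ?thesis using True by simp
    qed (simp add: Diff_insert0)
    moreover have "d w = card ?B" using sorted w by (auto simp: sorted_upto_def)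
    ultimately show ?thesis using d'[OF w(1)] w by auto
  qed
  moreover have "2 * N < d' w + Suc p" if w: "w \<in> insert r ?S" for w
  proof (cases "w = r")
    case True
    then show ?thesis using d'[OF r(1)] by simp
  next
    case False
    then have "w \<in> ?S" "w < N" "2 * N < d w + p" using w sorted by (auto simp: sorted_upto_def)
    then show ?thesis using d'[of w] False by auto
  qed
  moreover have "u \<in> ord' ` {..<i}" if "i < Suc p" "u < N" "A (ord' i) u" for i u
  proof (cases "i = p")
    case True
    have "{u. u < N \<and> u \<notin> ?S \<and> A r u} = {}"
      using sorted r rS by (auto simp: sorted_upto_def)
    then show ?thesis using that True im[of p] ord'(2) by auto
  next
    case False
    then show ?thesis using that sorted ord' im[of i] by (auto simp: sorted_upto_def)
  qed
  ultimately show ?thesis unfolding sorted_upto_def S' by blast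
qed

lemma sorted_upto_all:
  assumes "sorted_upto N A N d ord"
  shows "bij_betw ord {..<N} {..<N}"
    and "i < N \<Longrightarrow> j < N \<Longrightarrow> A (ord i) (ord j) \<Longrightarrow> j < i"
proof -
  have inj: "inj_on ord {..<N}" and sub: "ord ` {..<N} \<subseteq> {..<N}"
    using assms by (auto simp: sorted_upto_def)
  then have "ord ` {..<N} = {..<N}" by (simp add: endo_inj_surj)
  with inj show "bij_betw ord {..<N} {..<N}" by (simp add: bij_betw_def)
  assume ij: "i < N" "j < N" "A (ord i) (ord j)"
  then have "ord j \<in> ord ` {..<i}" using assms sub unfolding sorted_upto_def by blast
  then obtain i' where "i' < i" "ord j = ord i'" by auto
  then show "j < i" using inj ij by (auto dest!: inj_onD[of _ _ j i'])
qed

text \<open>The recursion is the one that is tabulated in an array by the program; the default 0 is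
  the initial content of that array.\<close>

primrec find_last :: "(nat \<Rightarrow> bool) \<Rightarrow> nat \<Rightarrow> nat" where
  "find_last P 0 = 0"
| "find_last P (Suc k) = (if P k then k else find_last P k)"

lemma find_last: "\<exists>r<n. P r \<Longrightarrow> find_last P n < n \<and> P (find_last P n)"
  by (induction n) (auto simp: less_Suc_eq)

lemma find_last_le: "find_last P n \<le> n"
  by (induction n) auto

section \<open>Negamax characterisation of the winning and surviving sets\<close>

text \<open>The recurrence is required only at genuine configurations and \<open>z\<close> is
  otherwise arbitrary, so that it can be read off from the matrix of the union graph, whose
  remaining entries have no meaning for the game.\<close>

definition negamax_solution :: "'v pair_pre_digraph \<Rightarrow> 'v pair_pre_digraph \<Rightarrow>
    (player \<Rightarrow> (player \<times> 'v \<times> 'v) set) \<Rightarrow> (player \<Rightarrow> 'v \<Rightarrow> 'v \<Rightarrow> bool) \<Rightarrow> bool" where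
  "negamax_solution G0 G1 F z \<longleftrightarrow> (\<forall>P u v.
     u \<in> pverts (case_player G0 G1 P) \<longrightarrow> v \<in> pverts (case_player G0 G1 (opp P)) \<longrightarrow>
     z P u v \<longleftrightarrow> (P, u, v) \<in> F P \<or> (\<exists>u'. (u, u') \<in> parcs (case_player G0 G1 P) \<and> \<not> z (opp P) v u'))"

lemma opp_opp [simp]: "opp (opp P) = P"
  by (cases P) auto

lemma opp_neq [simp]: "opp P \<noteq> P" "P \<noteq> opp P"
  by (cases P; simp)+

lemma eq_opp_iff: "Q = opp P \<longleftrightarrow> Q \<noteq> P"
  by (cases P; cases Q) auto

lemma two_token_graph_simps:
  "(P, u, v) \<in> confs (two_token_graph G0 G1) \<longleftrightarrow>
     u \<in> pverts (case_player G0 G1 P) \<and> v \<in> pverts (case_player G0 G1 (opp P))"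
  "(P, u, v) \<in> controlled (two_token_graph G0 G1) Q \<longleftrightarrow> P = Q \<and>
     u \<in> pverts (case_player G0 G1 P) \<and> v \<in> pverts (case_player G0 G1 (opp P))"
  "((P, u, v), \<tau>) \<in> moves (two_token_graph G0 G1) \<longleftrightarrow> (\<exists>u'. \<tau> = (opp P, v, u') \<and>
     (u, u') \<in> parcs (case_player G0 G1 P) \<and> v \<in> pverts (case_player G0 G1 (opp P)))"
  by (cases P; auto simp: two_token_graph_def Let_def)+

text \<open>Name the tokens by owner instead of by turn: a move then advances either Alice's token
  or Bob's along an arc of an acyclic graph and leaves the other in place, which descends
  lexicographically.\<close>

lemma wf_two_token_moves:
  assumes G0: "pair_fin_digraph G0" "acyclic (parcs G0)" and G1: "pair_fin_digraph G1" "acyclic (parcs G1)"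
  shows "wf ((moves (two_token_graph G0 G1))\<inverse>)"
proof -
  have "finite (parcs G0)" "finite (parcs G1)"
    using G0(1) G1(1) by (auto simp: pair_fin_digraph.pair_finite_arcs)
  then have "wf ((parcs G0)\<inverse> <*lex*> (parcs G1)\<inverse>)"
    using G0(2) G1(2) by (auto intro!: finite_acyclic_wf_converse)
  then have "wf (inv_image ((parcs G0)\<inverse> <*lex*> (parcs G1)\<inverse>) (\<lambda>(P, u, v). case P of Alice \<Rightarrow> (u, v) | Bob \<Rightarrow> (v, u)))"
    by (rule wf_inv_image)
  then show ?thesis
    by (rule wf_subset) (auto simp: two_token_graph_simps split: player.splits)
qed

context
  fixes G0 G1 :: "'v pair_pre_digraph" and F :: "player \<Rightarrow> (player \<times> 'v \<times> 'v) set"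
    and z :: "player \<Rightarrow> 'v \<Rightarrow> 'v \<Rightarrow> bool" and G
  defines "G \<equiv> two_token_graph G0 G1"
  assumes G0: "pair_fin_digraph G0" "acyclic (parcs G0)"
    and G1: "pair_fin_digraph G1" "acyclic (parcs G1)"
    and F: "bipartition (confs G) F"
    and z: "negamax_solution G0 G1 F z"
begin

text \<open>The configurations that \<open>z\<close> predicts to be won by \<open>P\<close>: true
  values when \<open>P\<close> is to move, false ones when the opponent is.\<close>

definition favourable :: "player \<Rightarrow> (player \<times> 'v \<times> 'v) set" where
  "favourable P = {(Q, u, v) \<in> confs G. z Q u v \<longleftrightarrow> Q = P}"

lemma moves_wf: "wf ((moves G)\<inverse>)" and moves_subset: "moves G \<subseteq> confs G \<times> confs G"
  using wf_two_token_moves[OF G0 G1] wf_two_token_graph[OF G0(1) G1(1)]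
  by (auto simp: G_def wf_game_graph_def)

lemma z_iff:
  assumes "(P, u, v) \<in> confs G"
  shows "z P u v \<longleftrightarrow> (P, u, v) \<in> F P \<or> (\<exists>\<tau>\<in>favourable P. ((P, u, v), \<tau>) \<in> moves G)"
proof -
  have "(\<exists>\<tau>\<in>favourable P. ((P, u, v), \<tau>) \<in> moves G) \<longleftrightarrow>
    (\<exists>u'. (u, u') \<in> parcs (case_player G0 G1 P) \<and> \<not> z (opp P) v u')"
  proof
    assume "\<exists>\<tau>\<in>favourable P. ((P, u, v), \<tau>) \<in> moves G"
    then show "\<exists>u'. (u, u') \<in> parcs (case_player G0 G1 P) \<and> \<not> z (opp P) v u'"
      by (auto simp: favourable_def G_def two_token_graph_simps)
  next
    assume "\<exists>u'. (u, u') \<in> parcs (case_player G0 G1 P) \<and> \<not> z (opp P) v u'"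
    then obtain u' where u': "(u, u') \<in> parcs (case_player G0 G1 P)" "\<not> z (opp P) v u'" by blast
    then have "((P, u, v), (opp P, v, u')) \<in> moves G"
      using assms by (auto simp: G_def two_token_graph_simps)
    moreover from this have "(opp P, v, u') \<in> favourable P"
      using u' moves_subset by (auto simp: favourable_def)
    ultimately show "\<exists>\<tau>\<in>favourable P. ((P, u, v), \<tau>) \<in> moves G" by blast
  qed
  then show ?thesis
    using z assms unfolding negamax_solution_def G_def two_token_graph_simps by metis
qed

lemma favourable_opp: "favourable (opp P) = confs G - favourable P"
  by (auto simp: favourable_def eq_opp_iff)

lemma F_opp: "F (opp P) = confs G - F P"
  using F by (cases P) (auto simp: bipartition_def)

lemma controlled_iff: "\<sigma> \<in> controlled G P \<longleftrightarrow> \<sigma> \<in> confs G \<and> fst \<sigma> = P"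
  by (cases \<sigma>) (auto simp: G_def two_token_graph_simps)

lemma favourable_own:
  assumes "\<sigma> \<in> confs G" "fst \<sigma> = P"
  shows "\<sigma> \<in> favourable P \<longleftrightarrow> \<sigma> \<in> F P \<or> (\<exists>\<tau>\<in>favourable P. (\<sigma>, \<tau>) \<in> moves G)"
  using z_iff[of P "fst (snd \<sigma>)" "snd (snd \<sigma>)"] assms by (cases \<sigma>) (auto simp: favourable_def)

text \<open>The negation of \<open>favourable_own\<close> for the opponent: both the favourable sets
  and the final sets of the two players are complementary, which turns an existential over moves
  into a universal one.\<close>

lemma favourable_other:
  assumes "\<sigma> \<in> confs G" "fst \<sigma> \<noteq> P"
  shows "\<sigma> \<in> favourable P \<longleftrightarrow> \<sigma> \<in> F P \<and> (\<forall>\<tau>. (\<sigma>, \<tau>) \<in> moves G \<longrightarrow> \<tau> \<in> favourable P)"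
proof -
  have "fst \<sigma> = opp P" using assms(2) by (simp add: eq_opp_iff)
  then show ?thesis
    using favourable_own[OF assms(1), of "opp P"] assms moves_subset unfolding favourable_opp F_opp by auto
qed

text \<open>It stops as soon as stopping wins. At unfavourable configurations it also stops, which
  keeps it a legal strategy without a choice of move.\<close>

definition good_strategy :: "player \<Rightarrow> (player \<times> 'v \<times> 'v) \<Rightarrow> (player \<times> 'v \<times> 'v) option" where
  "good_strategy P \<sigma> = (if \<sigma> \<in> F P \<or> \<sigma> \<notin> favourable P then None
     else Some (SOME \<tau>. \<tau> \<in> favourable P \<and> (\<sigma>, \<tau>) \<in> moves G))"

lemma good_strategy_Some:
  assumes "\<sigma> \<in> confs G" "fst \<sigma> = P" "good_strategy P \<sigma> = Some \<tau>"
  shows "\<tau> \<in> favourable P \<and> (\<sigma>, \<tau>) \<in> moves G"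
proof -
  have "\<exists>\<tau>. \<tau> \<in> favourable P \<and> (\<sigma>, \<tau>) \<in> moves G"
    using assms favourable_own[OF assms(1,2)] by (auto simp: good_strategy_def split: if_splits)
  then have "(SOME \<tau>. \<tau> \<in> favourable P \<and> (\<sigma>, \<tau>) \<in> moves G) \<in> favourable P \<and>
      (\<sigma>, (SOME \<tau>. \<tau> \<in> favourable P \<and> (\<sigma>, \<tau>) \<in> moves G)) \<in> moves G"
    by (rule someI_ex)
  then show ?thesis using assms(3) by (auto simp: good_strategy_def split: if_splits)
qed

lemma favourable_step:
  assumes "\<sigma> \<in> favourable P" "(\<sigma>, \<tau>) \<in> moves G" "\<sigma> \<in> controlled G P \<longrightarrow> good_strategy P \<sigma> = Some \<tau>"
  shows "\<tau> \<in> favourable P"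
proof -
  have "\<sigma> \<in> confs G" using assms(1) by (auto simp: favourable_def)
  then show ?thesis
    using good_strategy_Some[of \<sigma> P \<tau>] favourable_other[of \<sigma> P] assms
    by (cases "fst \<sigma> = P"; cases \<tau>) (auto simp: controlled_iff)
qed

text \<open>\<open>good_strategy\<close> never leaves the favourable set, and the opponent cannot
  leave it either. Acyclicity excludes infinite plays, and a conforming play that ends in a
  favourable configuration ends in \<open>F P\<close>, whoever was to move there.\<close>

lemma favourable_imp_winning: "favourable P \<subseteq> winning_set G F P"
proof
  fix \<sigma> assume \<sigma>: "\<sigma> \<in> favourable P"
  have conf: "\<sigma> \<in> confs G" if "\<sigma> \<in> favourable P" for \<sigma> using that by (auto simp: favourable_def)
  have "is_strategy G P (good_strategy P)"
    using good_strategy_Some by (auto simp: is_strategy_def controlled_iff)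
  moreover have "winning_play F P \<pi>"
    if \<pi>: "is_play G \<pi>" "start \<pi> = \<sigma>" "conforms G P (good_strategy P) \<pi>" for \<pi>
  proof (cases \<pi>)
    case (FinPlay xs)
    have fav: "i < length xs \<Longrightarrow> xs ! i \<in> favourable P" for i
    proof (induction i)
      case 0
      then show ?case using \<pi> \<sigma> FinPlay by (auto simp: hd_conv_nth)
    next
      case (Suc i)
      then have "xs ! i \<in> controlled G P \<longrightarrow> good_strategy P (xs ! i) = Some (xs ! Suc i)"
        using \<pi>(3) Suc.prems unfolding FinPlay conforms.simps by (metis Suc_lessD nat_neq_iff)
      then show ?case using favourable_step[of "xs ! i" P "xs ! Suc i"] Suc \<pi>(1) FinPlay by auto
    qed
    define n where "n = length xs - 1"
    have n: "n < length xs" "Suc n = length xs" "last xs = xs ! n"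
      using \<pi>(1) FinPlay by (auto simp: n_def last_conv_nth)
    have "xs ! n \<in> F P"
    proof (cases "fst (xs ! n) = P")
      case True
      then have "good_strategy P (xs ! n) = None"
        using \<pi>(3) n conf[OF fav[OF n(1)]] unfolding FinPlay conforms.simps controlled_iff by fastforce
      then show ?thesis using fav[OF n(1)] by (auto simp: good_strategy_def split: if_splits)
    next
      case False
      then show ?thesis using fav[OF n(1)] favourable_other[of "xs ! n" P] conf by auto
    qed
    then show ?thesis using FinPlay n by simp
  next
    case (InfPlay p)
    then have "\<forall>i. (p (Suc i), p i) \<in> (moves G)\<inverse>" using \<pi>(1) by auto
    then show ?thesis using moves_wf by (auto simp: wf_iff_no_infinite_down_chain)
  qed
  ultimately show "\<sigma> \<in> winning_set G F P"
    using conf[OF \<sigma>] by (auto simp: winning_set_def)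
qed

text \<open>For a fixed strategy \<open>s\<close> it is enough to exhibit one bad play, so the
  opponent's moves may be chosen along the play with \<open>s\<close> known. The play is built by
  induction along the moves and is finite, so it refutes survival as well as winning.\<close>

lemma ex_losing_play:
  assumes s: "is_strategy G P s"
  shows "\<sigma> \<in> confs G - favourable P \<Longrightarrow>
    \<exists>xs. is_play G (FinPlay xs) \<and> hd xs = \<sigma> \<and> conforms G P s (FinPlay xs) \<and> last xs \<notin> F P"
proof (induction \<sigma> rule: wf_induct_rule[OF moves_wf])
  case (1 \<sigma>)
  have extend: ?case if \<tau>: "(\<sigma>, \<tau>) \<in> moves G" "\<tau> \<notin> favourable P"
    "\<sigma> \<in> controlled G P \<Longrightarrow> s \<sigma> = Some \<tau>" for \<tau>
  proof -
    obtain xs where xs: "is_play G (FinPlay xs)" "hd xs = \<tau>" "conforms G P s (FinPlay xs)" "last xs \<notin> F P"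
      using 1(1)[of \<tau>] \<tau> moves_subset by auto
    have ne: "xs \<noteq> []" using xs(1) by auto
    have "is_play G (FinPlay (\<sigma> # xs))"
      using xs(1,2) \<tau>(1) 1(2) ne by (auto simp: nth_Cons hd_conv_nth split: nat.splits)
    moreover have "conforms G P s (FinPlay (\<sigma> # xs))"
      using xs(2,3) \<tau>(3) ne by (auto simp: nth_Cons hd_conv_nth split: nat.splits)
    ultimately show ?thesis using xs(4) ne by (intro exI[of _ "\<sigma> # xs"]) auto
  qed
  have stop: ?case if "\<sigma> \<notin> F P" "\<sigma> \<in> controlled G P \<Longrightarrow> s \<sigma> = None"
    using that 1(2) by (intro exI[of _ "[\<sigma>]"]) auto
  show ?case
  proof (cases "fst \<sigma> = P")
    case True
    have F: "\<sigma> \<notin> F P" and no: "\<And>\<tau>. (\<sigma>, \<tau>) \<in> moves G \<Longrightarrow> \<tau> \<notin> favourable P"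
      using favourable_own[of \<sigma> P] True 1(2) by auto
    show ?thesis
    proof (cases "s \<sigma>")
      case None
      then show ?thesis using stop F by simp
    next
      case (Some \<tau>)
      then have "(\<sigma>, \<tau>) \<in> moves G" using s True 1(2) by (cases \<tau>) (auto simp: is_strategy_def controlled_iff)
      then show ?thesis using extend no Some by blast
    qed
  next
    case False
    then have nc: "\<sigma> \<notin> controlled G P" by (simp add: controlled_iff)
    then consider "\<sigma> \<notin> F P" | \<tau> where "(\<sigma>, \<tau>) \<in> moves G" "\<tau> \<notin> favourable P"
      using favourable_other[of \<sigma> P] False 1(2) by auto
    then show ?thesis using stop extend nc by cases blast+
  qed
qed

lemma surviving_imp_favourable: "surviving_set G F P \<subseteq> favourable P"
proof
  fix \<sigma> assume "\<sigma> \<in> surviving_set G F P"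
  then obtain s where \<sigma>: "\<sigma> \<in> confs G" and s: "is_strategy G P s"
    and surv: "\<And>\<pi>. is_play G \<pi> \<Longrightarrow> start \<pi> = \<sigma> \<Longrightarrow> conforms G P s \<pi> \<Longrightarrow> surviving_play F P \<pi>"
    by (auto simp: surviving_set_def)
  show "\<sigma> \<in> favourable P"
  proof (rule ccontr)
    assume "\<sigma> \<notin> favourable P"
    then obtain xs where "is_play G (FinPlay xs)" "hd xs = \<sigma>" "conforms G P s (FinPlay xs)" "last xs \<notin> F P"
      using ex_losing_play[OF s] \<sigma> by blast
    then show False using surv[of "FinPlay xs"] by (auto simp: surviving_play_def)
  qed
qed

text \<open>The chain favourable, winning, surviving, favourable closes. In particular any solution
  \<open>z\<close> of the recurrence describes all four sets.\<close>

lemma winning_surviving_eq: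
  "winning_set G F P = favourable P" "surviving_set G F P = favourable P"
proof -
  have "winning_set G F P \<subseteq> surviving_set G F P"
    by (auto simp: winning_set_def surviving_set_def surviving_play_def)
  then show "winning_set G F P = favourable P" "surviving_set G F P = favourable P"
    using favourable_imp_winning surviving_imp_favourable by blast+
qed

end

section \<open>Exponents\<close>

lemma smallo_one_iff:
  fixes \<epsilon> :: "nat \<Rightarrow> real"
  shows "\<epsilon> \<in> o(\<lambda>_. 1) \<longleftrightarrow> (\<epsilon> \<longlonglongrightarrow> 0)"
  using smalloI_tendsto[of \<epsilon> "\<lambda>_. 1" sequentially] smalloD_tendsto[of \<epsilon> sequentially "\<lambda>_. 1"] by auto

text \<open>The error term is read off from \<open>T\<close> itself as the excess of its logarithm
  to base \<open>n\<close> over \<omega>, cut off at 0 because only upper bounds are available. The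
  bounds for all \<delta> then force it to tend to 0.\<close>

lemma computable_with_exponentI:
  assumes T: "computable_in_time Q T"
    and le: "\<And>\<delta>. 0 < \<delta> \<Longrightarrow> \<forall>\<^sub>F n in sequentially. real (T n) \<le> real n powr (\<omega> + \<delta>)"
  shows "computable_with_exponent Q \<omega>"
proof -
  define \<epsilon> where "\<epsilon> n = (if T n = 0 then 0 else max 0 (log n (T n) - \<omega>))" for n
  have "\<epsilon> \<longlonglongrightarrow> 0"
  proof (rule LIMSEQ_I)
    fix r :: real assume "0 < r"
    then have "0 < r / 2" by simp
    from le[OF this] eventually_ge_at_top[of 2]
    have "\<forall>\<^sub>F n in sequentially. norm (\<epsilon> n - 0) < r"
    proof eventually_elim
      case (elim n)
      show ?case
      proof (cases "T n = 0")
        case False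
        then have "log n (T n) \<le> log n (real n powr (\<omega> + r / 2))"
          using elim by (intro log_mono) auto
        then have "log n (T n) \<le> \<omega> + r / 2" using elim by simp
        then show ?thesis using \<open>0 < r\<close> by (auto simp: \<epsilon>_def)
      qed (use \<open>0 < r\<close> in \<open>simp add: \<epsilon>_def\<close>)
    qed
    then show "\<exists>N. \<forall>n\<ge>N. norm (\<epsilon> n - 0) < r" by (simp add: eventually_sequentially)
  qed
  then have "\<epsilon> \<in> o(\<lambda>_. 1)" by (simp add: smallo_one_iff)
  moreover have "\<forall>\<^sub>F n in sequentially. real (T n) \<le> real n powr (\<omega> + \<epsilon> n)"
    using eventually_ge_at_top[of 2]
  proof eventually_elim
    case (elim n)
    show ?case
    proof (cases "T n = 0")
      case False
      have "real (T n) = real n powr (log n (T n))" using False elim by simp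
      also have "\<dots> \<le> real n powr (\<omega> + \<epsilon> n)"
        using elim False by (intro powr_mono) (auto simp: \<epsilon>_def)
      finally show ?thesis .
    qed simp
  qed
  ultimately show ?thesis using T unfolding computable_with_exponent_def by blast
qed

text \<open>The finitely many exceptional sizes go into the constant \<open>C\<close>. A bound for
  all sizes is needed because small blocks occur in the recursion for every
  \<open>n\<close>.\<close>

lemma powr_bound:
  assumes "\<epsilon> \<in> o(\<lambda>_. 1)" "\<forall>\<^sub>F n in sequentially. real (T n) \<le> real n powr (\<omega> + \<epsilon> n)" "0 < \<delta>"
  shows "\<exists>C>0. \<forall>n\<ge>1. real (T n) \<le> C * real n powr (\<omega> + \<delta>)"
proof -
  have "\<epsilon> \<longlonglongrightarrow> 0" using assms(1) by (simp add: smallo_one_iff)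
  then have "\<forall>\<^sub>F n in sequentially. \<epsilon> n < \<delta>" by (rule order_tendstoD) (rule assms(3))
  with assms(2) eventually_ge_at_top[of 1]
  have "\<forall>\<^sub>F n in sequentially. real (T n) \<le> real n powr (\<omega> + \<delta>)"
  proof eventually_elim
    case (elim n)
    have "real n powr (\<omega> + \<epsilon> n) \<le> real n powr (\<omega> + \<delta>)" using elim by (intro powr_mono) auto
    with elim show ?case by linarith
  qed
  then obtain m where m: "\<And>n. n \<ge> m \<Longrightarrow> real (T n) \<le> real n powr (\<omega> + \<delta>)"
    by (auto simp: eventually_sequentially)
  define C where "C = 1 + (\<Sum>n<m. real (T n) / real n powr (\<omega> + \<delta>))"
  have C: "1 \<le> C" unfolding C_def by (simp add: sum_nonneg)
  have "real (T n) \<le> C * real n powr (\<omega> + \<delta>)" if n: "n \<ge> 1" for n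
  proof (cases "n < m")
    case True
    have "real (T n) / real n powr (\<omega> + \<delta>) \<le> (\<Sum>n<m. real (T n) / real n powr (\<omega> + \<delta>))"
      using True by (intro member_le_sum) auto
    then have "real (T n) / real n powr (\<omega> + \<delta>) \<le> C" by (simp add: C_def)
    then show ?thesis using n by (simp add: pos_divide_le_eq)
  next
    case False
    then have "real (T n) \<le> 1 * real n powr (\<omega> + \<delta>)" using m by simp
    also have "\<dots> \<le> C * real n powr (\<omega> + \<delta>)" using C by (intro mult_right_mono) auto
    finally show ?thesis .
  qed
  then show ?thesis using C by (intro exI[of _ C]) auto
qed

text \<open>Multiplying all-one matrices changes \<open>n\<^sup>2\<close> cells of the output array, all of them initially zero.\<close>

lemma boolean_matrix_multiplication_time_ge:
  assumes "computable_in_time boolean_matrix_multiplication T" "1 \<le> n"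
  shows "n\<^sup>2 \<le> T n"
proof -
  let ?A = "\<lambda>_ _. True"
  let ?x = "n # row_major n ?A @ row_major n ?A" and ?y = "row_major n (bool_mat_mult n ?A ?A)"
  obtain c where c: "\<forall>n. \<forall>(x, y)\<in>boolean_matrix_multiplication n. \<exists>t \<sigma>.
     exec c (init_state x) t \<sigma> \<and> t \<le> T n \<and> has_output \<sigma> y"
    using assms(1) unfolding computable_in_time_def by blast
  have "(?x, ?y) \<in> boolean_matrix_multiplication n"
    unfolding boolean_matrix_multiplication_def by blast
  then obtain t \<sigma> where *: "exec c (init_state ?x) t \<sigma>" "t \<le> T n" "has_output \<sigma> ?y"
    using c by fast
  let ?S = "{i. arr \<sigma> 1 i \<noteq> arr (init_state ?x) 1 i}"
  have "bool_mat_mult n ?A ?A i j" for i j using assms(2) by (auto simp: bool_mat_mult_def intro!: exI[of _ 0])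
  then have "arr \<sigma> 1 i = 1" if "i < n * n" for i
    using *(3) that by (auto simp: has_output_def row_major_def)
  then have "{..<n * n} \<subseteq> ?S" by (auto simp: init_state_def)
  then have "card {..<n * n} \<le> card ?S"
    using card_changed_cells_le[OF *(1)] by (intro card_mono) auto
  also have "\<dots> \<le> t" using card_changed_cells_le[OF *(1)] by blast
  finally show ?thesis using *(2) by (simp add: power2_eq_square)
qed

lemma exponent_ge_2:
  assumes "computable_with_exponent boolean_matrix_multiplication \<omega>"
  shows "2 \<le> \<omega>"
proof (rule ccontr)
  assume "\<not> 2 \<le> \<omega>"
  \<comment> \<open>Half of the gap to 2, so that the exponent stays below 2 after adding
    it.\<close>
  define \<delta> where "\<delta> = (2 - \<omega>) / 2"
  have \<delta>: "0 < \<delta>" "\<omega> + \<delta> < 2" using \<open>\<not> 2 \<le> \<omega>\<close> by (auto simp: \<delta>_def field_simps)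
  obtain T \<epsilon> where T: "computable_in_time boolean_matrix_multiplication T" "\<epsilon> \<in> o(\<lambda>_. 1)"
     "\<forall>\<^sub>F n in sequentially. real (T n) \<le> real n powr (\<omega> + \<epsilon> n)"
    using assms unfolding computable_with_exponent_def by blast
  obtain C where C: "C > 0" "\<And>n. n \<ge> 1 \<Longrightarrow> real (T n) \<le> C * real n powr (\<omega> + \<delta>)"
    using powr_bound[OF T(2,3) \<delta>(1)] by blast
  have "\<forall>\<^sub>F n in sequentially. C * real n powr (\<omega> + \<delta>) < real n powr 2"
    using C(1) \<delta>(2) by real_asymp
  with eventually_ge_at_top[of 1] have "\<forall>\<^sub>F n :: nat in sequentially. False"
  proof eventually_elim
    case (elim n)
    have "real n powr 2 = real (n\<^sup>2)" using elim by (simp add: powr_numeral)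
    also have "\<dots> \<le> real (T n)"
      using boolean_matrix_multiplication_time_ge[OF T(1)] elim by (simp only: of_nat_le_iff)
    also have "\<dots> \<le> C * real n powr (\<omega> + \<delta>)" using C(2) elim by simp
    finally show ?case using elim by simp
  qed
  then show False by simp
qed

text \<open>As \<open>a\<close> is at least 2, the number \<open>4^(L - j)\<close> is at most the
  \<open>a\<close>-th power of \<open>2^(L - j)\<close>; times the cost for side \<open>2^j\<close>
  this is the cost for side \<open>2^L\<close>. No level is more expensive than the top one in this
  bound.\<close>

lemma level_sum_bound:
  assumes C: "\<And>n. n \<ge> 1 \<Longrightarrow> real (T n) \<le> C * real n powr a" and a: "2 \<le> a"
  shows "(\<Sum>j<Suc L. 4 ^ (L - j) * real (T (2 ^ j))) \<le> real (Suc L) * (C * (2 ^ L) powr a)"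
proof -
  have C0: "0 \<le> C" using C[of 1] by simp
  have "4 ^ (L - j) * real (T (2 ^ j)) \<le> C * (2 ^ L) powr a" if "j < Suc L" for j
  proof -
    have "(4::real) ^ (L - j) = (2 ^ (L - j)) powr 2"
      by (simp add: powr_numeral power_mult[symmetric] mult.commute[of _ 2] power_mult)
    also have "\<dots> \<le> (2 ^ (L - j)) powr a" using a by (intro powr_mono) auto
    finally have 1: "(4::real) ^ (L - j) \<le> (2 ^ (L - j)) powr a" .
    have "real (T (2 ^ j)) \<le> C * (2 ^ j) powr a" using C[of "2 ^ j"] by simp
    then have "4 ^ (L - j) * real (T (2 ^ j)) \<le> (2 ^ (L - j)) powr a * (C * (2 ^ j) powr a)"
      using 1 by (intro mult_mono) auto
    also have "\<dots> = C * (2 ^ (L - j) * 2 ^ j) powr a" by (simp add: powr_mult)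
    also have "(2::real) ^ (L - j) * 2 ^ j = 2 ^ L" using that by (simp add: power_add[symmetric])
    finally show ?thesis .
  qed
  then have "(\<Sum>j<Suc L. 4 ^ (L - j) * real (T (2 ^ j))) \<le> (\<Sum>j<Suc L. C * (2 ^ L) powr a)"
    by (intro sum_mono) auto
  then show ?thesis by simp
qed

text \<open>The first summand pays for visiting every cell, the second for the products; constant
  factors and logarithms are kept outside.\<close>

definition level_time :: "(nat \<Rightarrow> nat) \<Rightarrow> nat \<Rightarrow> nat" where
  "level_time T L = 4 ^ L + (\<Sum>j<Suc L. 4 ^ (L - j) * T (2 ^ j))"

text \<open>The program and \<open>K\<close> may depend on \<open>T\<close> but not on the instance.
  One of the two factors \<open>Suc L\<close> comes from the levels and one from bit lengths;
  bounding the sum in \<open>level_time\<close> adds a third, whence the cube of a logarithm. The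
  maximum over admissible \<open>L\<close> makes the time a function of \<open>n\<close>
  alone.\<close>

lemma computable_with_exponent_transfer:
  assumes bmm: "computable_with_exponent boolean_matrix_multiplication \<omega>"
    and step: "\<And>T. computable_in_time boolean_matrix_multiplication T \<Longrightarrow>
      \<exists>c K. \<forall>n. \<forall>(x, y)\<in>Q n. \<exists>t \<sigma> L. exec c (init_state x) t \<sigma> \<and> has_output \<sigma> y \<and>
        2 ^ L \<le> 4 * n + 1 \<and> t \<le> K * (Suc L ^ 2 * level_time T L)"
  shows "computable_with_exponent Q \<omega>"
proof -
  obtain T \<epsilon> where T: "computable_in_time boolean_matrix_multiplication T" "\<epsilon> \<in> o(\<lambda>_. 1)"
     "\<forall>\<^sub>F n in sequentially. real (T n) \<le> real n powr (\<omega> + \<epsilon> n)"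
    using bmm unfolding computable_with_exponent_def by blast
  obtain c K where c: "\<And>n x y. (x, y) \<in> Q n \<Longrightarrow> \<exists>t \<sigma> L. exec c (init_state x) t \<sigma> \<and> has_output \<sigma> y \<and>
        2 ^ L \<le> 4 * n + 1 \<and> t \<le> K * (Suc L ^ 2 * level_time T L)"
    using step[OF T(1)] by blast
  define S where "S n = {L. (2::nat) ^ L \<le> 4 * n + 1}" for n
  have S: "finite (S n)" "S n \<noteq> {}" for n
  proof -
    have "S n \<subseteq> {..4 * n + 1}" unfolding S_def using less_exp less_le_trans less_imp_le by blast
    then show "finite (S n)" by (rule finite_subset) simp
    have "0 \<in> S n" by (simp add: S_def)
    then show "S n \<noteq> {}" by blast
  qed
  define U where "U n = Max ((\<lambda>L. K * (Suc L ^ 2 * level_time T L)) ` S n)" for n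
  have "computable_in_time Q U"
    unfolding computable_in_time_def
  proof (intro exI allI ballI, clarify)
    fix n x y assume "(x, y) \<in> Q n"
    then obtain t \<sigma> L where *: "exec c (init_state x) t \<sigma>" "has_output \<sigma> y"
        "2 ^ L \<le> 4 * n + 1" "t \<le> K * (Suc L ^ 2 * level_time T L)"
      using c by blast
    have "K * (Suc L ^ 2 * level_time T L) \<le> U n"
      unfolding U_def using S *(3) by (intro Max_ge) (auto simp: S_def)
    then show "\<exists>t \<sigma>. exec c (init_state x) t \<sigma> \<and> t \<le> U n \<and> has_output \<sigma> y"
      using * le_trans by blast
  qed
  then show ?thesis
  proof (rule computable_with_exponentI)
    fix \<delta> :: real assume \<delta>: "0 < \<delta>"
    define a where "a = \<omega> + \<delta> / 2"
    have a: "2 \<le> a" using exponent_ge_2[OF bmm] \<delta> by (simp add: a_def)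
    obtain C where C: "C > 0" "\<And>n. n \<ge> 1 \<Longrightarrow> real (T n) \<le> C * real n powr a"
      using powr_bound[OF T(2,3), of "\<delta> / 2"] \<delta> unfolding a_def by auto
    have bound: "real (U n) \<le> K * ((log 2 (real (4 * n + 1)) + 1) ^ 3 * ((1 + C) * real (4 * n + 1) powr a))" for n
    proof -
      have "U n \<in> (\<lambda>L. K * (Suc L ^ 2 * level_time T L)) ` S n"
        unfolding U_def using S by (intro Max_in) auto
      then obtain L where L: "2 ^ L \<le> 4 * n + 1" "U n = K * (Suc L ^ 2 * level_time T L)"
        by (auto simp: S_def)
      have L': "(2::real) ^ L \<le> real (4 * n + 1)"
        using L(1) by (metis of_nat_le_iff of_nat_numeral of_nat_power)
      have "real L = log 2 (2 ^ L)" by simp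
      also have "\<dots> \<le> log 2 (real (4 * n + 1))" using L' by (intro log_mono) auto
      finally have logL: "real (Suc L) \<le> log 2 (real (4 * n + 1)) + 1" by simp
      have "(4::real) ^ L = (2 ^ L) powr 2"
        by (simp add: powr_numeral power_mult[symmetric] mult.commute[of _ 2] power_mult)
      also have "\<dots> \<le> (2 ^ L) powr a" using a by (intro powr_mono) auto
      also have "\<dots> \<le> real (Suc L) * (2 ^ L) powr a" by (simp add: mult_le_cancel_right1)
      finally have "real (level_time T L) \<le> real (Suc L) * (2 ^ L) powr a + real (Suc L) * (C * (2 ^ L) powr a)"
        using level_sum_bound[OF C(2) a, of L] by (simp add: level_time_def)
      also have "\<dots> = real (Suc L) * ((1 + C) * (2 ^ L) powr a)" by (simp add: algebra_simps)
      also have "\<dots> \<le> real (Suc L) * ((1 + C) * real (4 * n + 1) powr a)"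
        using L' a C(1) by (intro mult_left_mono powr_mono2) auto
      finally have "real (Suc L) ^ 2 * real (level_time T L) \<le>
          real (Suc L) ^ 2 * (real (Suc L) * ((1 + C) * real (4 * n + 1) powr a))"
        by (intro mult_left_mono) auto
      also have "\<dots> = real (Suc L) ^ 3 * ((1 + C) * real (4 * n + 1) powr a)"
        by (simp add: power2_eq_square power3_eq_cube)
      also have "\<dots> \<le> (log 2 (real (4 * n + 1)) + 1) ^ 3 * ((1 + C) * real (4 * n + 1) powr a)"
        using logL C(1) by (intro mult_right_mono power_mono) auto
      finally show ?thesis unfolding L(2) of_nat_mult of_nat_power by (intro mult_left_mono) auto
    qed
    have "\<forall>\<^sub>F n in sequentially. K * ((log 2 (real (4 * n + 1)) + 1) ^ 3 * ((1 + C) * real (4 * n + 1) powr a))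
        \<le> real n powr (\<omega> + \<delta>)"
    proof -
      \<comment> \<open>The added 1 keeps the constant positive when \<open>K\<close> is 0.\<close>
      define D where "D = real K * (1 + C) + 1"
      have D: "0 < D" using C(1) by (simp add: D_def add_nonneg_pos)
      have "\<forall>\<^sub>F n in sequentially. D * (log 2 (4 * real n + 1) + 1) ^ 3 * (4 * real n + 1) powr a
          \<le> real n powr (a + \<delta> / 2)"
        using D a \<delta> by real_asymp
      then show ?thesis
      proof eventually_elim
        case (elim n)
        let ?l = "(log 2 (4 * real n + 1) + 1) ^ 3 * (4 * real n + 1) powr a"
        have "0 \<le> ?l" by simp
        then have "(real K * (1 + C)) * ?l \<le> D * ?l" unfolding D_def by (intro mult_right_mono) auto
        with elim show ?case by (simp add: a_def algebra_simps)
      qed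
    qed
    then show "\<forall>\<^sub>F n in sequentially. real (U n) \<le> real n powr (\<omega> + \<delta>)"
      by eventually_elim (use bound order_trans in blast)
  qed
qed

section \<open>Programs with unit-cost steps\<close>

definition small :: "ex \<Rightarrow> bool" where
  "small e \<longleftrightarrow> low_regs e \<and> esize e \<le> 200"

text \<open>The factor covers the three small expressions evaluated in one round of a \<open>fill\<close>.\<close>

definition tick :: "nat \<Rightarrow> nat" where
  "tick M = 500000 * bits M"

lemma small_cost: "small e \<Longrightarrow> ecost e \<le> 160300"
proof -
  assume "small e"
  then have "esize e \<le> 200" by (simp add: small_def)
  then have "(esize e)\<^sup>2 \<le> 200\<^sup>2" by (rule power_mono) simp
  with \<open>esize e \<le> 200\<close> show ?thesis by (simp add: ecost_def)
qed

lemma hoare_assign_tick: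
  assumes "2 \<le> M" "small e" "bounded M e \<rho> \<alpha>" "r < 100"
    and "hoare c T (\<rho>(r := val e \<rho> \<alpha>)) \<alpha> Q"
  shows "hoare (Seq (assign r e) c) (tick M + T) \<rho> \<alpha> Q"
proof (rule hoare_mono[OF hoare_assign_Seq])
  have "ecost e * bits M \<le> 500000 * bits M" using small_cost[OF assms(2)] by (intro mult_le_mono1) simp
  then show "ecost e * bits M + T \<le> tick M + T" by (simp add: tick_def)
qed (use assms in \<open>simp_all add: small_def\<close>)

lemma hoare_store_tick:
  assumes "2 \<le> M" "small d" "bounded M d \<rho> \<alpha>" "small e" "bounded M e \<rho> \<alpha>"
    and "hoare c T \<rho> (\<alpha>(a := (\<alpha> a)(val d \<rho> \<alpha> := val e \<rho> \<alpha>))) Q"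
  shows "hoare (Seq (store a d e) c) (tick M + T) \<rho> \<alpha> Q"
proof (rule hoare_mono[OF hoare_store_Seq])
  have "(ecost d + ecost e) * bits M \<le> 500000 * bits M"
    using small_cost[OF assms(2)] small_cost[OF assms(4)] by (intro mult_le_mono1) simp
  then show "(ecost d + ecost e) * bits M + T \<le> tick M + T" by (simp add: tick_def)
qed (use assms in \<open>simp_all add: small_def\<close>)

lemma hoare_cond_tick:
  assumes "2 \<le> M" "small e" "bounded M e \<rho> \<alpha>" "r < 100"
    and "val e \<rho> \<alpha> \<noteq> 0 \<Longrightarrow> hoare c T (\<rho>(r := val e \<rho> \<alpha>)) \<alpha> Q"
    and "val e \<rho> \<alpha> = 0 \<Longrightarrow> Q (\<rho>(r := 0)) \<alpha>"
  shows "hoare (cond r e c) (tick M + (if val e \<rho> \<alpha> = 0 then 0 else T)) \<rho> \<alpha> Q"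
proof (rule hoare_mono[OF hoare_cond[where T = T and Q = Q]])
  have "(2 * ecost e) * bits M \<le> 500000 * bits M"
    using small_cost[OF assms(2)] by (intro mult_le_mono1) simp
  then show "2 * ecost e * bits M + (if val e \<rho> \<alpha> = 0 then 0 else T) \<le>
     tick M + (if val e \<rho> \<alpha> = 0 then 0 else T)" by (simp add: tick_def)
qed (use assms in \<open>simp_all add: small_def\<close>)

lemma hoare_loop_tick:
  assumes M: "2 \<le> M" and e: "small e" "bounded M e \<rho> \<alpha>" "val e \<rho> \<alpha> = n" "n \<le> M" and i: "i + 2 < 100"
    and init: "I 0 (\<rho>(i + 2 := n, i := 0, i + 1 := n)) \<alpha>"
    and step: "\<And>k \<rho>' \<alpha>'. k < n \<Longrightarrow> I k \<rho>' \<alpha>' \<Longrightarrow> \<rho>' i = k \<Longrightarrow> \<rho>' (i + 1) = n - k \<Longrightarrow> \<rho>' (i + 2) = n \<Longrightarrow>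
      hoare c (T k) \<rho>' \<alpha>' (\<lambda>\<rho>'' \<alpha>''. \<rho>'' i = k \<and> \<rho>'' (i + 2) = n \<and>
        I (Suc k) (\<rho>''(i := Suc k, i + 1 := n - Suc k)) \<alpha>'')"
  shows "hoare (loop i e c) ((\<Sum>k<n. T k) + (n + 1) * tick M) \<rho> \<alpha>
    (\<lambda>\<rho>' \<alpha>'. I n \<rho>' \<alpha>' \<and> \<rho>' i = n \<and> \<rho>' (i + 1) = 0 \<and> \<rho>' (i + 2) = n)"
proof (rule hoare_mono[OF hoare_loop[where I = I and T = T, OF M _ e(2-4) i init step]])
  have "(ecost e + 100) * bits M \<le> 500000 * bits M"
    using small_cost[OF e(1)] by (intro mult_le_mono1) simp
  then have "(n + 1) * ((ecost e + 100) * bits M) \<le> (n + 1) * tick M"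
    unfolding tick_def by (rule mult_le_mono2)
  then show "(\<Sum>k<n. T k) + (n + 1) * ((ecost e + 100) * bits M) \<le> (\<Sum>k<n. T k) + (n + 1) * tick M" by simp
qed (use e in \<open>simp_all add: small_def\<close>)

lemma hoare_fill_tick:
  assumes M: "2 \<le> M" and l: "small l" "bounded M l \<rho> \<alpha>" "val l \<rho> \<alpha> = n" "n \<le> M" and i: "i + 2 < 100"
    and de: "small d" "small e"
    and step: "\<And>k. k < n \<Longrightarrow>
      let \<rho>' = \<rho>(i := k, i + 1 := n - k, i + 2 := n); \<alpha>' = \<alpha>(a := scattered (\<alpha> a) h g k)
      in bounded M d \<rho>' \<alpha>' \<and> bounded M e \<rho>' \<alpha>' \<and> val d \<rho>' \<alpha>' = h k \<and> val e \<rho>' \<alpha>' = g k"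
    and Q: "Q (\<rho>(i := n, i + 1 := 0, i + 2 := n)) (\<alpha>(a := scattered (\<alpha> a) h g n))"
  shows "hoare (fill i l a d e) ((n + 1) * tick M) \<rho> \<alpha> Q"
proof (rule hoare_mono)
  show "hoare (fill i l a d e) ((n + 1) * (fcost l d e * bits M)) \<rho> \<alpha>
    (\<lambda>\<rho>' \<alpha>'. \<rho>' = \<rho>(i := n, i + 1 := 0, i + 2 := n) \<and> \<alpha>' = \<alpha>(a := scattered (\<alpha> a) h g n))"
  proof (rule hoare_fill[where g = g and h = h, OF M _ l(2-4) i])
    show "let \<rho>' = \<rho>(i := k, i + 1 := n - k, i + 2 := n); \<alpha>' = \<alpha>(a := scattered (\<alpha> a) h g k)
      in bounded M d \<rho>' \<alpha>' \<and> bounded M e \<rho>' \<alpha>' \<and> val d \<rho>' \<alpha>' = h k \<and> val e \<rho>' \<alpha>' = g k" if "k < n" for k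
      by (rule step[OF that])
  qed (use l de in \<open>simp_all add: small_def\<close>)
  have "fcost l d e * bits M \<le> 500000 * bits M"
    using small_cost[OF l(1)] small_cost[OF de(1)] small_cost[OF de(2)]
    by (intro mult_le_mono1) (simp add: fcost_def)
  then show "(n + 1) * (fcost l d e * bits M) \<le> (n + 1) * tick M"
    unfolding tick_def by (rule mult_le_mono2)
  show "\<rho>' = \<rho>(i := n, i + 1 := 0, i + 2 := n) \<and> \<alpha>' = \<alpha>(a := scattered (\<alpha> a) h g n) \<Longrightarrow> Q \<rho>' \<alpha>'" for \<rho>' \<alpha>'
    using Q by (elim conjE) (hypsubst, assumption)
qed

lemma scattered_table: "scattered A (\<lambda>k. k) g n = (\<lambda>x. if x < n then g x else A x)"
  by (simp add: fun_eq_iff scattered_id)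

lemma hoare_table_tick:
  assumes M: "2 \<le> M" and l: "small l" "bounded M l \<rho> \<alpha>" "val l \<rho> \<alpha> = n" "n \<le> M" and i: "i + 2 < 100"
    and e: "small e"
    and step: "\<And>k. k < n \<Longrightarrow>
      let \<rho>' = \<rho>(i := k, i + 1 := n - k, i + 2 := n); \<alpha>' = \<alpha>(a := \<lambda>x. if x < k then g x else \<alpha> a x)
      in bounded M e \<rho>' \<alpha>' \<and> val e \<rho>' \<alpha>' = g k"
    and Q: "Q (\<rho>(i := n, i + 1 := 0, i + 2 := n)) (\<alpha>(a := \<lambda>x. if x < n then g x else \<alpha> a x))"
  shows "hoare (fill i l a (Rg i) e) ((n + 1) * tick M) \<rho> \<alpha> Q"
proof (rule hoare_fill_tick[where g = g and h = "\<lambda>k. k", OF M l i _ e])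
  fix k assume "k < n"
  then show "let \<rho>' = \<rho>(i := k, i + 1 := n - k, i + 2 := n);
          \<alpha>' = \<alpha>(a := scattered (\<alpha> a) (\<lambda>k. k) g k)
      in bounded M (Rg i) \<rho>' \<alpha>' \<and> bounded M e \<rho>' \<alpha>' \<and> val (Rg i) \<rho>' \<alpha>' = k \<and> val e \<rho>' \<alpha>' = g k"
    using step[of k] l(4) unfolding scattered_table Let_def by simp
qed (use i Q in \<open>simp_all add: small_def scattered_table\<close>)

lemma hoare_fill_Seq_tick:
  assumes "2 \<le> M" "small l" "bounded M l \<rho> \<alpha>" "val l \<rho> \<alpha> = n" "n \<le> M" "i + 2 < 100" "small d" "small e"
    and step: "\<And>k. k < n \<Longrightarrow>
      let \<rho>' = \<rho>(i := k, i + 1 := n - k, i + 2 := n); \<alpha>' = \<alpha>(a := scattered (\<alpha> a) h g k)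
      in bounded M d \<rho>' \<alpha>' \<and> bounded M e \<rho>' \<alpha>' \<and> val d \<rho>' \<alpha>' = h k \<and> val e \<rho>' \<alpha>' = g k"
    and c: "hoare c T (\<rho>(i := n, i + 1 := 0, i + 2 := n)) (\<alpha>(a := scattered (\<alpha> a) h g n)) Q"
  shows "hoare (Seq (fill i l a d e) c) ((n + 1) * tick M + T) \<rho> \<alpha> Q"
proof (rule hoare_Seq)
  show "hoare (fill i l a d e) ((n + 1) * tick M) \<rho> \<alpha>
    (\<lambda>\<rho>' \<alpha>'. \<rho>' = \<rho>(i := n, i + 1 := 0, i + 2 := n) \<and> \<alpha>' = \<alpha>(a := scattered (\<alpha> a) h g n))"
    by (rule hoare_fill_tick[where g = g and h = h, OF assms(1-8) step]) simp_all
qed (elim conjE, hypsubst, rule c)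

lemma hoare_table_Seq_tick:
  assumes "2 \<le> M" "small l" "bounded M l \<rho> \<alpha>" "val l \<rho> \<alpha> = n" "n \<le> M" "i + 2 < 100" "small e"
    and step: "\<And>k. k < n \<Longrightarrow>
      let \<rho>' = \<rho>(i := k, i + 1 := n - k, i + 2 := n); \<alpha>' = \<alpha>(a := \<lambda>x. if x < k then g x else \<alpha> a x)
      in bounded M e \<rho>' \<alpha>' \<and> val e \<rho>' \<alpha>' = g k"
    and c: "hoare c T (\<rho>(i := n, i + 1 := 0, i + 2 := n)) (\<alpha>(a := \<lambda>x. if x < n then g x else \<alpha> a x)) Q"
  shows "hoare (Seq (fill i l a (Rg i) e) c) ((n + 1) * tick M + T) \<rho> \<alpha> Q"
proof (rule hoare_Seq)
  show "hoare (fill i l a (Rg i) e) ((n + 1) * tick M) \<rho> \<alpha>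
    (\<lambda>\<rho>' \<alpha>'. \<rho>' = \<rho>(i := n, i + 1 := 0, i + 2 := n) \<and> \<alpha>' = \<alpha>(a := \<lambda>x. if x < n then g x else \<alpha> a x))"
    by (rule hoare_table_tick[where g = g, OF assms(1-7) step]) simp_all
qed (elim conjE, hypsubst, rule c)

section \<open>Tests by arithmetic and padding to a power of two\<close>

abbreviation add_ex (infixl "\<oplus>" 65) where "d \<oplus> e \<equiv> Op Add d e"
abbreviation sub_ex (infixl "\<ominus>" 65) where "d \<ominus> e \<equiv> Op Sub d e"
abbreviation mul_ex (infixl "\<otimes>" 70) where "d \<otimes> e \<equiv> Op Mul d e"
abbreviation div_ex (infixl "\<oslash>" 70) where "d \<oslash> e \<equiv> Op Div d e"
abbreviation mod_ex (infixl "\<odot>" 70) where "d \<odot> e \<equiv> Op Mod d e"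

text \<open>Subtraction is truncated, so this is Boolean negation. With tests as 0/1 values, case
  distinctions become sums of products and the rounds of a \<open>fill\<close> need no
  branching.\<close>

definition is_zero :: "ex \<Rightarrow> ex" where
  "is_zero e = Nm 1 \<ominus> e"

definition is_less :: "ex \<Rightarrow> ex \<Rightarrow> ex" where
  "is_less d e = is_zero (is_zero (e \<ominus> d))"

lemma is_zero_simps [simp]:
  "val (is_zero e) \<rho> \<alpha> = of_bool (val e \<rho> \<alpha> = 0)"
  "bounded M (is_zero e) \<rho> \<alpha> \<longleftrightarrow> 1 \<le> M \<and> bounded M e \<rho> \<alpha>"
  "low_regs (is_zero e) = low_regs e" "esize (is_zero e) = esize e + 2"
  by (auto simp: is_zero_def)

lemma is_less_simps [simp]:
  "val (is_less d e) \<rho> \<alpha> = of_bool (val d \<rho> \<alpha> < val e \<rho> \<alpha>)"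
  "bounded M (is_less d e) \<rho> \<alpha> \<longleftrightarrow> 1 \<le> M \<and> bounded M d \<rho> \<alpha> \<and> bounded M e \<rho> \<alpha>"
  "low_regs (is_less d e) \<longleftrightarrow> low_regs d \<and> low_regs e" "esize (is_less d e) = esize d + esize e + 5"
  by (auto simp: is_less_def)

text \<open>The factor 2 makes room for both graphs side by side.\<close>

definition level_of :: "nat \<Rightarrow> nat" where
  "level_of n = (LEAST L. 2 * n \<le> 2 ^ L)"

lemma level_of: "2 * n \<le> 2 ^ level_of n"
  unfolding level_of_def by (rule LeastI[of _ "2 * n"]) (rule less_imp_le[OF less_exp])

lemma less_level_of_iff: "2 ^ l < 2 * n \<longleftrightarrow> l < level_of n"
proof
  assume "2 ^ l < 2 * n"
  then have "2 ^ l < (2::nat) ^ level_of n" using level_of by (rule less_le_trans)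
  then show "l < level_of n" by simp
next
  assume "l < level_of n"
  then have "\<not> 2 * n \<le> 2 ^ l" unfolding level_of_def by (rule not_less_Least)
  then show "2 ^ l < 2 * n" by simp
qed

lemma level_of_le: "level_of n \<le> 2 * n"
  unfolding level_of_def by (rule Least_le) (rule less_imp_le[OF less_exp])

lemma power_level_of_le: "2 ^ level_of n \<le> 4 * n + 1"
proof (cases "level_of n")
  case (Suc l)
  then have "2 ^ l < 2 * n" by (simp add: less_level_of_iff)
  then show ?thesis using Suc by simp
qed simp

text \<open>
  Registers: 1 \<open>n\<close>, 2 \<open>N = 2\<^sup>L\<close>, 3 \<open>L\<close>, 4 the vertex to be placed next, 6 the modulus and 16 the number
  of a call, 7 the block size, 8 and 9 the block coordinates; the loops use 20--22, 30--32, 40--42.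
  Arrays: 2 adjacency and 3 final configurations of the union graph, 4 and 5 out-degrees, 6 search for
  a sink, 7 the topological order and 8 its inverse, 9 and 10 adjacency and winning matrix in
  that order, 11 and 12 the coordinates of the cells in Morton order, 13 labels, from 20 on the arrays
  of the multiplication program.
\<close>

definition setup_prog :: com where
  "setup_prog = Seq (assign 1 (Ar 0 (Nm 0))) (Seq (assign 2 (Nm 1)) (Seq (assign 3 (Nm 0))
     (loop 20 (Rg 1 \<otimes> Nm 2) (Seq (assign 3 (Rg 3 \<oplus> is_less (Rg 2) (Rg 1 \<otimes> Nm 2)))
       (Seq (assign 2 (Rg 2 \<otimes> (Nm 1 \<oplus> is_less (Rg 2) (Rg 1 \<otimes> Nm 2)))) Skip)))))"

lemma hoare_Skip: "2 \<le> M \<Longrightarrow> Q \<rho> \<alpha> \<Longrightarrow> hoare Skip (tick M) \<rho> \<alpha> Q"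
  unfolding hoare_def
proof (intro allI impI)
  fix \<sigma> assume "2 \<le> M" "Q \<rho> \<alpha>" "repr \<sigma> \<rho> \<alpha>"
  moreover have "1 \<le> tick M" using bits_pos[of M] \<open>2 \<le> M\<close> by (simp add: tick_def)
  moreover have "exec Skip \<sigma> 1 \<sigma>" by (rule exec.Skip)
  ultimately show "\<exists>t \<tau> \<rho>' \<alpha>'. exec Skip \<sigma> t \<tau> \<and> t \<le> tick M \<and> repr \<tau> \<rho>' \<alpha>' \<and> Q \<rho>' \<alpha>'" by blast
qed

text \<open>The loop always makes \<open>2 * n\<close> rounds. Once the power of two is large enough
  the comparison yields 0 and nothing changes any more, hence the minimum in the invariant.\<close>

lemma hoare_setup:
  assumes n: "\<alpha> 0 0 = n" and M: "2 ^ level_of n + 2 \<le> M"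
  shows "hoare setup_prog ((8 * n + 4) * tick M) \<rho> \<alpha> (\<lambda>\<rho>' \<alpha>'. \<alpha>' = \<alpha> \<and>
    \<rho>' 1 = n \<and> \<rho>' 2 = 2 ^ level_of n \<and> \<rho>' 3 = level_of n)"
proof (rule hoare_mono)
  let ?L = "level_of n"
  let ?I = "\<lambda>k (\<rho>' :: nat \<Rightarrow> nat) \<alpha>'. \<alpha>' = \<alpha> \<and> \<rho>' 1 = n \<and> \<rho>' 2 = 2 ^ min k ?L \<and> \<rho>' 3 = min k ?L"
  have nM: "2 * n \<le> M" using level_of[of n] M by simp
  have M2: "2 \<le> M" using M by simp
  have LM: "2 ^ min k ?L \<le> M" "min k ?L \<le> M" for k
  proof -
    have "(2::nat) ^ min k ?L \<le> 2 ^ ?L" by (rule power_increasing) auto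
    then show *: "2 ^ min k ?L \<le> M" using M by linarith
    show "min k ?L \<le> M" using less_exp[of "min k ?L"] * by linarith
  qed
  let ?body = "Seq (assign 3 (Rg 3 \<oplus> is_less (Rg 2) (Rg 1 \<otimes> Nm 2)))
    (Seq (assign 2 (Rg 2 \<otimes> (Nm 1 \<oplus> is_less (Rg 2) (Rg 1 \<otimes> Nm 2)))) Skip)"
  let ?Q = "\<lambda>(\<rho>' :: nat \<Rightarrow> nat) \<alpha>'. ?I (2 * n) \<rho>' \<alpha>' \<and> \<rho>' 20 = 2 * n \<and> \<rho>' (20 + 1) = 0 \<and> \<rho>' (20 + 2) = 2 * n"
  have loop: "hoare (loop 20 (Rg 1 \<otimes> Nm 2) ?body) ((\<Sum>k<2 * n. tick M + (tick M + tick M)) + (2 * n + 1) * tick M)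
     (\<rho>(1 := n, 2 := 1, 3 := 0)) \<alpha> ?Q"
  proof (rule hoare_loop_tick[where I = ?I])
    fix k \<rho>' \<alpha>' assume k: "k < 2 * n" and I: "?I k \<rho>' \<alpha>'"
      and r: "\<rho>' 20 = k" "\<rho>' (20 + 1) = 2 * n - k" "\<rho>' (20 + 2) = 2 * n"
    have *: "min (Suc k) ?L = min k ?L + of_bool (2 ^ min k ?L < 2 * n)"
      unfolding less_level_of_iff by auto
    show "hoare ?body (tick M + (tick M + tick M)) \<rho>' \<alpha>'
       (\<lambda>\<rho>'' \<alpha>''. \<rho>'' 20 = k \<and> \<rho>'' (20 + 2) = 2 * n \<and> ?I (Suc k) (\<rho>''(20 := Suc k, 20 + 1 := 2 * n - Suc k)) \<alpha>'')"
      using I r LM[of k] M2 nM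
      by (intro hoare_assign_tick hoare_Skip) (auto simp: small_def * mult.commute)
  qed (use n M2 nM in \<open>auto simp: small_def\<close>)
  show "hoare setup_prog (tick M + (tick M + (tick M +
     ((\<Sum>k<2 * n. tick M + (tick M + tick M)) + (2 * n + 1) * tick M)))) \<rho> \<alpha> ?Q"
    unfolding setup_prog_def using n M2 nM loop
    by (intro hoare_assign_tick) (auto simp: small_def)
  show "tick M + (tick M + (tick M + ((\<Sum>k<2 * n. tick M + (tick M + tick M)) + (2 * n + 1) * tick M))) \<le>
     (8 * n + 4) * tick M" by (simp add: algebra_simps)
qed (use level_of_le[of n] in \<open>simp add: min_absorb2\<close>)

lemma index_div_mod:
  fixes N :: nat
  assumes "w < N"
  shows "(u * N + w) div N = u" "(u * N + w) mod N = w"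
  using assms by auto

lemma index_less:
  fixes N :: nat
  assumes "u < N" "w < N"
  shows "u * N + w < N * N"
proof -
  have "u * N + w < Suc u * N" using assms(2) by simp
  also have "\<dots> \<le> N * N" using assms(1) by (intro mult_le_mono1) simp
  finally show ?thesis .
qed

lemma index_bounds:
  fixes N :: nat
  assumes "k < N * N"
  shows "k div N < N" "k mod N < N"
  using assms by (auto simp: less_mult_imp_div_less) (metis gr0I mod_less_divisor mult_0 not_less0)

lemma scattered_Suc:
  "scattered A Suc g n x = (case x of 0 \<Rightarrow> A 0 | Suc y \<Rightarrow> if y < n then g y else A x)"
  by (induction n) (auto split: nat.splits)

section \<open>The topological sort as a program\<close>

abbreviation decrement_prog :: com where
  "decrement_prog \<equiv> fill 30 (Rg 2) 5 (Rg 30) (Ar 5 (Rg 30) \<ominus> Ar 2 (Rg 30 \<otimes> Rg 2 \<oplus> Rg 4))"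

abbreviation place_prog :: com where
  "place_prog \<equiv> Seq (assign 4 (Ar 6 (Rg 2))) (Seq (store 7 (Rg 20) (Rg 4)) (Seq (store 8 (Rg 4) (Rg 20))
    (Seq (store 5 (Rg 4) (Nm 2 \<otimes> Rg 2 \<oplus> Nm 1)) decrement_prog)))"

abbreviation find_ex :: ex where
  "find_ex \<equiv> is_zero (Ar 5 (Rg 30)) \<otimes> Rg 30 \<oplus> is_zero (is_zero (Ar 5 (Rg 30))) \<otimes> Ar 6 (Rg 30)"

abbreviation topo_body :: com where
  "topo_body \<equiv> Seq (fill 30 (Rg 2) 6 (Rg 30 \<oplus> Nm 1) find_ex) place_prog"

definition topo_prog :: com where
  "topo_prog =
     Seq (fill 20 (Rg 2 \<otimes> Rg 2) 4 (Rg 20)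
       (Ar 2 (Rg 20) \<oplus> is_less (Nm 0) (Rg 20 \<odot> Rg 2) \<otimes> Ar 4 (Rg 20 \<ominus> Nm 1)))
    (Seq (fill 20 (Rg 2) 5 (Rg 20) (Ar 4 (Rg 20 \<otimes> Rg 2 \<oplus> (Rg 2 \<ominus> Nm 1))))
    (loop 20 (Rg 2)
      topo_body))"

text \<open>Cell 0 of array 6 has to stay zero as the default of the search, and the bound on array
  5 is there for the cost of handling degrees and marks.\<close>

definition topo_invariant :: "nat \<Rightarrow> (nat \<Rightarrow> nat \<Rightarrow> bool) \<Rightarrow> (nat \<Rightarrow> nat) \<Rightarrow> (nat \<Rightarrow> nat \<Rightarrow> nat) \<Rightarrow> nat \<Rightarrow>
    (nat \<Rightarrow> nat) \<Rightarrow> (nat \<Rightarrow> nat \<Rightarrow> nat) \<Rightarrow> bool" where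
  "topo_invariant N A \<rho> \<alpha> p \<rho>' \<alpha>' \<longleftrightarrow>
     (\<forall>r. r \<notin> {4, 20, 21, 22, 30, 31, 32} \<longrightarrow> \<rho>' r = \<rho> r) \<and>
     (\<forall>a. a \<notin> {4, 5, 6, 7, 8} \<longrightarrow> \<alpha>' a = \<alpha> a) \<and> \<alpha>' 6 0 = 0 \<and>
     sorted_upto N A p (\<alpha>' 5) (\<alpha>' 7) \<and> (\<forall>i<p. \<alpha>' 8 (\<alpha>' 7 i) = i) \<and> (\<forall>w<N. \<alpha>' 5 w \<le> 2 * N + 1)"

lemma hoare_topo_body:
  assumes N: "1 \<le> N" "\<rho> 2 = N" and M: "2 * N + 2 \<le> M"
    and A: "\<And>u w. u < N \<Longrightarrow> w < N \<Longrightarrow> \<alpha> 2 (u * N + w) = of_bool (A u w)"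
    and acyc: "acyclic {(u, w). u < N \<and> w < N \<and> A u w}"
    and p: "p < N" and inv: "topo_invariant N A \<rho> \<alpha> p \<rho>' \<alpha>'"
    and regs: "\<rho>' 20 = p" "\<rho>' 22 = N"
  shows "hoare topo_body
     ((N + 1) * tick M + (tick M + (tick M + (tick M + (tick M + (N + 1) * tick M))))) \<rho>' \<alpha>'
     (\<lambda>\<rho>'' \<alpha>''. \<rho>'' 20 = p \<and> \<rho>'' 22 = N \<and>
        topo_invariant N A \<rho> \<alpha> (Suc p) (\<rho>''(20 := Suc p, 21 := N - Suc p)) \<alpha>'')"
proof -
  let ?P = "\<lambda>u. \<alpha>' 5 u = 0"
  define r where "r = find_last ?P N"
  have sorted: "sorted_upto N A p (\<alpha>' 5) (\<alpha>' 7)" and d: "\<And>w. w < N \<Longrightarrow> \<alpha>' 5 w \<le> 2 * N + 1"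
    and pos: "\<And>i. i < p \<Longrightarrow> \<alpha>' 8 (\<alpha>' 7 i) = i" and \<rho>': "\<rho>' 2 = N" and \<alpha>': "\<alpha>' 2 = \<alpha> 2" "\<alpha>' 6 0 = 0"
    using inv N by (auto simp: topo_invariant_def)
  have r: "r < N" "\<alpha>' 5 r = 0"
    using find_last[OF ex_sink[OF sorted p acyc]] by (auto simp: r_def)
  \<comment> \<open>The vertex found has degree 0 and so carries no mark; recording its position
    does not overwrite that of a vertex placed earlier.\<close>
  have rpos: "r \<noteq> \<alpha>' 7 i" if "i < p" for i
  proof -
    have "\<alpha>' 7 i \<in> \<alpha>' 7 ` {..<p}" using that by simp
    then have "2 * N < \<alpha>' 5 (\<alpha>' 7 i) + p" using sorted unfolding sorted_upto_def by blast
    then show ?thesis using r p by auto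
  qed
  \<comment> \<open>Cell \<open>k\<close> of array 6 is the result of searching the first
    \<open>k\<close> vertices, so the result for all of them ends up in cell
    \<open>N\<close>.\<close>
  define h where "h k = find_last ?P (Suc k)" for k
  define \<alpha>\<^sub>1 where "\<alpha>\<^sub>1 = \<alpha>'(6 := scattered (\<alpha>' 6) Suc h N)"
  define \<rho>\<^sub>1 where "\<rho>\<^sub>1 = \<rho>'(30 := N, 31 := 0, 32 := N)"
  have \<alpha>\<^sub>1N: "\<alpha>\<^sub>1 6 N = r"
    using N(1) by (cases N) (simp_all add: \<alpha>\<^sub>1_def scattered_Suc r_def h_def)
  define \<alpha>\<^sub>2 where "\<alpha>\<^sub>2 = \<alpha>\<^sub>1(7 := (\<alpha>\<^sub>1 7)(p := r), 8 := (\<alpha>\<^sub>1 8)(r := p), 5 := (\<alpha>\<^sub>1 5)(r := 2 * N + 1))"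
  define \<rho>\<^sub>2 where "\<rho>\<^sub>2 = \<rho>\<^sub>1(4 := r)"
  define g where "g w = (if w = r then 2 * N + 1 else \<alpha>' 5 w) - of_bool (A w r)" for w
  define \<alpha>\<^sub>3 where "\<alpha>\<^sub>3 = \<alpha>\<^sub>2(5 := \<lambda>w. if w < N then g w else \<alpha>\<^sub>2 5 w)"
  have 3: "hoare decrement_prog
      ((N + 1) * tick M) \<rho>\<^sub>2 \<alpha>\<^sub>2 (\<lambda>\<rho>'' \<alpha>''. \<rho>'' = \<rho>\<^sub>2(30 := N, 30 + 1 := 0, 30 + 2 := N) \<and> \<alpha>'' = \<alpha>\<^sub>3)"
  proof (rule hoare_table_tick[where g = g])
    fix k assume k: "k < N"
    show "let \<rho>' = \<rho>\<^sub>2(30 := k, 30 + 1 := N - k, 30 + 2 := N);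
          \<alpha>' = \<alpha>\<^sub>2(5 := \<lambda>x. if x < k then g x else \<alpha>\<^sub>2 5 x)
      in bounded M (Ar 5 (Rg 30) \<ominus> Ar 2 (Rg 30 \<otimes> Rg 2 \<oplus> Rg 4)) \<rho>' \<alpha>' \<and>
        val (Ar 5 (Rg 30) \<ominus> Ar 2 (Rg 30 \<otimes> Rg 2 \<oplus> Rg 4)) \<rho>' \<alpha>' = g k"
      using A[OF k r(1)] d[OF k] k r M by (simp add: g_def \<rho>\<^sub>2_def \<alpha>\<^sub>2_def \<alpha>\<^sub>1_def \<rho>\<^sub>1_def \<rho>' \<alpha>')
  qed (use M in \<open>simp_all add: small_def \<rho>\<^sub>2_def \<rho>\<^sub>1_def \<rho>' \<alpha>\<^sub>3_def\<close>)
  have Q: "\<rho>'' 20 = p \<and> \<rho>'' 22 = N \<and>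
        topo_invariant N A \<rho> \<alpha> (Suc p) (\<rho>''(20 := Suc p, 21 := N - Suc p)) \<alpha>''"
    if "\<rho>'' = \<rho>\<^sub>2(30 := N, 30 + 1 := 0, 30 + 2 := N) \<and> \<alpha>'' = \<alpha>\<^sub>3" for \<rho>'' \<alpha>''
  proof -
    have "sorted_upto N A (Suc p) (\<alpha>\<^sub>3 5) (\<alpha>\<^sub>3 7)"
      by (rule sorted_upto_Suc[OF sorted p r]) (simp_all add: g_def \<alpha>\<^sub>3_def \<alpha>\<^sub>2_def \<alpha>\<^sub>1_def)
    moreover have "\<alpha>\<^sub>3 8 (\<alpha>\<^sub>3 7 i) = i" if "i < Suc p" for i
      using that pos rpos by (auto simp: \<alpha>\<^sub>3_def \<alpha>\<^sub>2_def \<alpha>\<^sub>1_def less_Suc_eq)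
    moreover have "\<alpha>\<^sub>3 5 w \<le> 2 * N + 1" if "w < N" for w
      using that d[of w] by (auto simp: g_def \<alpha>\<^sub>3_def)
    ultimately show ?thesis
      using inv that regs unfolding topo_invariant_def
      by (auto simp: \<rho>\<^sub>2_def \<rho>\<^sub>1_def \<alpha>\<^sub>3_def \<alpha>\<^sub>2_def \<alpha>\<^sub>1_def scattered_Suc)
  qed
  have 2: "hoare place_prog
     (tick M + (tick M + (tick M + (tick M + (N + 1) * tick M)))) \<rho>\<^sub>1 \<alpha>\<^sub>1
     (\<lambda>\<rho>'' \<alpha>''. \<rho>'' = \<rho>\<^sub>2(30 := N, 30 + 1 := 0, 30 + 2 := N) \<and> \<alpha>'' = \<alpha>\<^sub>3)"
    by (intro hoare_assign_tick hoare_store_tick)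
      (use M p r \<alpha>\<^sub>1N 3 \<rho>' regs in \<open>simp_all add: small_def \<rho>\<^sub>1_def \<rho>\<^sub>2_def \<alpha>\<^sub>2_def\<close>)
  show ?thesis
  proof (rule hoare_mono[OF _ order_refl Q])
    show "hoare topo_body
     ((N + 1) * tick M + (tick M + (tick M + (tick M + (tick M + (N + 1) * tick M))))) \<rho>' \<alpha>'
     (\<lambda>\<rho>'' \<alpha>''. \<rho>'' = \<rho>\<^sub>2(30 := N, 30 + 1 := 0, 30 + 2 := N) \<and> \<alpha>'' = \<alpha>\<^sub>3)"
    proof (rule hoare_fill_Seq_tick[where h = Suc and g = h])
      fix k assume k: "k < N"
      have "scattered (\<alpha>' 6) Suc h k k = find_last ?P k"
        using \<alpha>' by (cases k) (auto simp: scattered_Suc h_def simp del: scattered.simps)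
      moreover have "find_last ?P k \<le> M" using find_last_le[of ?P k] k M by simp
      ultimately show "let \<rho>'' = \<rho>'(30 := k, 30 + 1 := N - k, 30 + 2 := N);
          \<alpha>'' = \<alpha>'(6 := scattered (\<alpha>' 6) Suc h k)
        in bounded M (Rg 30 \<oplus> Nm 1) \<rho>'' \<alpha>'' \<and> bounded M find_ex \<rho>'' \<alpha>'' \<and>
          val (Rg 30 \<oplus> Nm 1) \<rho>'' \<alpha>'' = Suc k \<and> val find_ex \<rho>'' \<alpha>'' = h k"
        using k d[OF k] M by (simp add: Let_def h_def)
    qed (use M \<rho>' 2 in \<open>simp_all add: small_def \<rho>\<^sub>1_def \<alpha>\<^sub>1_def\<close>)
  qed
qed

definition topo_sorted :: "nat \<Rightarrow> (nat \<Rightarrow> nat \<Rightarrow> bool) \<Rightarrow> (nat \<Rightarrow> nat) \<Rightarrow> (nat \<Rightarrow> nat) \<Rightarrow> bool" where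
  "topo_sorted N A ord pos \<longleftrightarrow> bij_betw ord {..<N} {..<N} \<and> (\<forall>i<N. pos (ord i) = i) \<and>
     (\<forall>i<N. \<forall>j<N. A (ord i) (ord j) \<longrightarrow> j < i)"

lemma hoare_topo:
  assumes N: "1 \<le> N" "\<rho> 2 = N" and M: "N * N + 2 * N + 2 \<le> M"
    and A: "\<And>u w. u < N \<Longrightarrow> w < N \<Longrightarrow> \<alpha> 2 (u * N + w) = of_bool (A u w)"
    and acyc: "acyclic {(u, w). u < N \<and> w < N \<and> A u w}"
    and zero: "\<alpha> 4 0 = 0" "\<alpha> 6 0 = 0"
  shows "hoare topo_prog (15 * (N * N) * tick M) \<rho> \<alpha> (\<lambda>\<rho>' \<alpha>'.
     (\<forall>r. r \<notin> {4, 20, 21, 22, 30, 31, 32} \<longrightarrow> \<rho>' r = \<rho> r) \<and>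
     (\<forall>a. a \<notin> {4, 5, 6, 7, 8} \<longrightarrow> \<alpha>' a = \<alpha> a) \<and> topo_sorted N A (\<alpha>' 7) (\<alpha>' 8))"
proof (rule hoare_mono)
  have M2: "2 \<le> M" "N * N \<le> M" "N \<le> M" using M by simp_all
  \<comment> \<open>Running sums along each row of the adjacency matrix; the last one of a row is
    the out-degree of its vertex.\<close>
  define g where "g k = (\<Sum>w\<le>k mod N. of_bool (A (k div N) w) :: nat)" for k
  have gN: "g k \<le> N" for k
  proof -
    have "g k \<le> (\<Sum>w\<le>k mod N. 1)" unfolding g_def by (intro sum_mono) simp
    also have "\<dots> \<le> N" using N(1) by (simp add: Suc_le_eq)
    finally show ?thesis .
  qed
  have g: "g k = \<alpha> 2 k + (if k mod N = 0 then 0 else g (k - 1))" if k: "k < N * N" for k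
  proof -
    have kA: "\<alpha> 2 k = of_bool (A (k div N) (k mod N))"
      using A[OF index_bounds[OF k]] by simp
    show ?thesis
    proof (cases "k mod N")
      case 0
      then show ?thesis using kA by (simp add: g_def)
    next
      case (Suc w)
      have w: "w < N" using Suc N(1) mod_less_divisor[of N k] by simp
      have "k = k div N * N + Suc w" using Suc by (metis div_mult_mod_eq)
      then have "k - 1 = k div N * N + w" by simp
      then have "(k - 1) div N = k div N" "(k - 1) mod N = w"
        using index_div_mod[OF w, of "k div N"] by simp_all
      then show ?thesis using kA Suc by (simp add: g_def)
    qed
  qed
  define \<alpha>\<^sub>1 where "\<alpha>\<^sub>1 = \<alpha>(4 := \<lambda>x. if x < N * N then g x else \<alpha> 4 x)"
  define \<rho>\<^sub>1 where "\<rho>\<^sub>1 = \<rho>(20 := N * N, 20 + 1 := 0, 20 + 2 := N * N)"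
  define \<alpha>\<^sub>2 where "\<alpha>\<^sub>2 = \<alpha>\<^sub>1(5 := \<lambda>x. if x < N then g (x * N + (N - 1)) else \<alpha>\<^sub>1 5 x)"
  define \<rho>\<^sub>2 where "\<rho>\<^sub>2 = \<rho>\<^sub>1(20 := N, 20 + 1 := 0, 20 + 2 := N)"
  let ?I = "topo_invariant N A \<rho> \<alpha>"
  let ?T = "(N + 1) * tick M + (tick M + (tick M + (tick M + (tick M + (N + 1) * tick M))))"
  have degree: "g (w * N + (N - 1)) = card {u. u < N \<and> A w u}" if w: "w < N" for w
  proof -
    have "N - 1 < N" using N(1) by simp
    note dm = index_div_mod[OF this, of w]
    have "g (w * N + (N - 1)) = (\<Sum>u\<le>N - 1. of_bool (A w u))" unfolding g_def dm ..
    also have "{..N - 1} = {..<N}" using N(1) by auto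
    also have "(\<Sum>u<N. of_bool (A w u) :: nat) = card {u. u < N \<and> A w u}"
      by (simp add: sum_of_bool_eq Int_def conj_commute)
    finally show ?thesis .
  qed
  have 3: "hoare (loop 20 (Rg 2) topo_body) ((\<Sum>p<N. ?T) + (N + 1) * tick M) \<rho>\<^sub>2 \<alpha>\<^sub>2
      (\<lambda>\<rho>' \<alpha>'. ?I N \<rho>' \<alpha>' \<and> \<rho>' 20 = N \<and> \<rho>' (20 + 1) = 0 \<and> \<rho>' (20 + 2) = N)"
  proof (rule hoare_loop_tick[where I = ?I])
    show "?I 0 (\<rho>\<^sub>2(20 + 2 := N, 20 := 0, 20 + 1 := N)) \<alpha>\<^sub>2"
    proof -
      have "card {u. u < N \<and> A w u} \<le> 2 * N + 1" if "w < N" for w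
        using gN[of "w * N + (N - 1)"] degree[OF that] by simp
      then show ?thesis
        unfolding topo_invariant_def
        using degree zero by (auto simp: \<rho>\<^sub>2_def \<rho>\<^sub>1_def \<alpha>\<^sub>2_def \<alpha>\<^sub>1_def intro!: sorted_upto_0)
    qed
  next
    fix p \<rho>' \<alpha>'
    assume "p < N" "?I p \<rho>' \<alpha>'" "\<rho>' 20 = p" "\<rho>' (20 + 1) = N - p" "\<rho>' (20 + 2) = N"
    then have "hoare topo_body ?T \<rho>' \<alpha>' (\<lambda>\<rho>'' \<alpha>''. \<rho>'' 20 = p \<and> \<rho>'' 22 = N \<and>
        ?I (Suc p) (\<rho>''(20 := Suc p, 21 := N - Suc p)) \<alpha>'')"
      using M by (intro hoare_topo_body[where A = A and \<rho> = \<rho> and \<alpha> = \<alpha>, OF N _ A acyc]) simp_all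
    then show "hoare topo_body ?T \<rho>' \<alpha>' (\<lambda>\<rho>'' \<alpha>''. \<rho>'' 20 = p \<and> \<rho>'' (20 + 2) = N \<and>
        ?I (Suc p) (\<rho>''(20 := Suc p, 20 + 1 := N - Suc p)) \<alpha>'')"
      by simp
  qed (use M N in \<open>simp_all add: small_def \<rho>\<^sub>2_def \<rho>\<^sub>1_def\<close>)
  have 2: "hoare (Seq (fill 20 (Rg 2) 5 (Rg 20) (Ar 4 (Rg 20 \<otimes> Rg 2 \<oplus> (Rg 2 \<ominus> Nm 1)))) (loop 20 (Rg 2) topo_body))
     ((N + 1) * tick M + ((\<Sum>p<N. ?T) + (N + 1) * tick M)) \<rho>\<^sub>1 \<alpha>\<^sub>1
      (\<lambda>\<rho>' \<alpha>'. ?I N \<rho>' \<alpha>' \<and> \<rho>' 20 = N \<and> \<rho>' (20 + 1) = 0 \<and> \<rho>' (20 + 2) = N)"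
  proof (rule hoare_table_Seq_tick[where g = "\<lambda>x. g (x * N + (N - 1))"])
    fix k assume k: "k < N"
      let ?e = "Ar 4 (Rg 20 \<otimes> Rg 2 \<oplus> (Rg 2 \<ominus> Nm 1))"
    have "k * N + (N - 1) < N * N" using index_less[OF k, of "N - 1"] N(1) by simp
    then show "let \<rho>' = \<rho>\<^sub>1(20 := k, 20 + 1 := N - k, 20 + 2 := N);
          \<alpha>' = \<alpha>\<^sub>1(5 := \<lambda>x. if x < k then g (x * N + (N - 1)) else \<alpha>\<^sub>1 5 x)
        in bounded M ?e \<rho>' \<alpha>' \<and> val ?e \<rho>' \<alpha>' = g (k * N + (N - 1))"
      using k M N le_trans[OF gN M2(3)] by (simp add: \<rho>\<^sub>1_def \<alpha>\<^sub>1_def Let_def)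
  qed (use M N M2 3 in \<open>simp_all add: small_def \<rho>\<^sub>1_def \<rho>\<^sub>2_def \<alpha>\<^sub>2_def\<close>)
  show "hoare topo_prog ((N * N + 1) * tick M + ((N + 1) * tick M + ((\<Sum>p<N. ?T) + (N + 1) * tick M))) \<rho> \<alpha>
      (\<lambda>\<rho>' \<alpha>'. ?I N \<rho>' \<alpha>' \<and> \<rho>' 20 = N \<and> \<rho>' (20 + 1) = 0 \<and> \<rho>' (20 + 2) = N)"
    unfolding topo_prog_def
  proof (rule hoare_table_Seq_tick[where g = g])
    fix k assume k: "k < N * N"
      let ?e = "Ar 2 (Rg 20) \<oplus> is_less (Nm 0) (Rg 20 \<odot> Rg 2) \<otimes> Ar 4 (Rg 20 \<ominus> Nm 1)"
    have "\<alpha> 2 k \<le> 1" using A[OF index_bounds[OF k]] by simp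
    moreover have "(if k - 1 < k then g (k - 1) else \<alpha> 4 (k - 1)) \<le> M"
      using zero le_trans[OF gN M2(3)] by (cases k) auto
    ultimately show "let \<rho>' = \<rho>(20 := k, 20 + 1 := N * N - k, 20 + 2 := N * N);
          \<alpha>' = \<alpha>(4 := \<lambda>x. if x < k then g x else \<alpha> 4 x)
        in bounded M ?e \<rho>' \<alpha>' \<and> val ?e \<rho>' \<alpha>' = g k"
      using k M2 N g[OF k] by (cases k) (simp_all add: Let_def)
  qed (use M N M2 2 in \<open>simp_all add: small_def \<rho>\<^sub>1_def \<alpha>\<^sub>1_def\<close>)
  have "(N * N + 1) * tick M + ((N + 1) * tick M + ((\<Sum>p<N. ?T) + (N + 1) * tick M)) =
    (3 * (N * N) + 8 * N + 3) * tick M" by (simp add: algebra_simps)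
  also have "\<dots> \<le> 15 * (N * N) * tick M"
  proof (rule mult_le_mono1)
    have "N * 1 \<le> N * N" using N(1) by (intro mult_le_mono2)
    then show "3 * (N * N) + 8 * N + 3 \<le> 15 * (N * N)" using N(1) by linarith
  qed
  finally show "(N * N + 1) * tick M + ((N + 1) * tick M + ((\<Sum>p<N. ?T) + (N + 1) * tick M)) \<le>
    15 * (N * N) * tick M" .
next
  fix \<rho>' \<alpha>' assume *: "topo_invariant N A \<rho> \<alpha> N \<rho>' \<alpha>' \<and> \<rho>' 20 = N \<and> \<rho>' (20 + 1) = 0 \<and> \<rho>' (20 + 2) = N"
  then have "topo_sorted N A (\<alpha>' 7) (\<alpha>' 8)"
    using sorted_upto_all[of N A "\<alpha>' 5" "\<alpha>' 7"] by (auto simp: topo_invariant_def topo_sorted_def)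
  with * show "(\<forall>r. r \<notin> {4, 20, 21, 22, 30, 31, 32} \<longrightarrow> \<rho>' r = \<rho> r) \<and>
     (\<forall>a. a \<notin> {4, 5, 6, 7, 8} \<longrightarrow> \<alpha>' a = \<alpha> a) \<and> topo_sorted N A (\<alpha>' 7) (\<alpha>' 8)"
    unfolding topo_invariant_def by blast
qed

section \<open>The matrix multiplication step\<close>

abbreviation dest_ex :: "nat \<Rightarrow> nat \<Rightarrow> ex" where
  "dest_ex x y \<equiv> ((Rg y \<oplus> Nm 1) \<otimes> Rg 7 \<oplus> Rg 40 \<oslash> Rg 7) \<otimes> Rg 2 \<oplus> (Rg x \<otimes> Rg 7 \<oplus> Rg 40 \<odot> Rg 7)"

abbreviation merged_ex :: "nat \<Rightarrow> nat \<Rightarrow> ex" where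
  "merged_ex x y \<equiv> is_zero (is_zero (Ar 10 (dest_ex x y) \<oplus> Ar 21 (Rg 40 \<otimes> Rg 6 \<oplus> Rg 16)))"

abbreviation merge_prog :: "nat \<Rightarrow> nat \<Rightarrow> com" where
  "merge_prog x y \<equiv> fill 40 (Rg 7 \<otimes> Rg 7) 10 (dest_ex x y) (merged_ex x y)"

text \<open>\<open>update_prog R c x y\<close> performs \<open>update\<close> for the block whose coordinates are in the registers
  \<open>x\<close> and \<open>y\<close> and whose size is in register 7, calling the matrix multiplication program \<open>c\<close>.\<close>

definition update_prog :: "nat \<Rightarrow> com \<Rightarrow> nat \<Rightarrow> nat \<Rightarrow> com" where
  "update_prog R c x y =
     Seq (store 20 (Rg 16) (Rg 7))
    (Seq (fill 40 (Rg 7 \<otimes> Rg 7) 20 ((Rg 40 \<oplus> Nm 1) \<otimes> Rg 6 \<oplus> Rg 16)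
      (Ar 9 (((Rg y \<oplus> Nm 1) \<otimes> Rg 7 \<oplus> Rg 40 \<oslash> Rg 7) \<otimes> Rg 2 \<oplus> (Rg y \<otimes> Rg 7 \<oplus> Rg 40 \<odot> Rg 7))))
    (Seq (fill 40 (Rg 7 \<otimes> Rg 7) 20 ((Rg 40 \<oplus> Rg 7 \<otimes> Rg 7 \<oplus> Nm 1) \<otimes> Rg 6 \<oplus> Rg 16)
      (is_zero (Ar 10 ((Rg x \<otimes> Rg 7 \<oplus> Rg 40 \<odot> Rg 7) \<otimes> Rg 2 \<oplus> (Rg y \<otimes> Rg 7 \<oplus> Rg 40 \<oslash> Rg 7)))))
    (Seq (call R c)
    (merge_prog x y))))"

definition multiplies :: "com \<Rightarrow> nat \<Rightarrow> nat \<Rightarrow> bool" where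
  "multiplies c s T \<longleftrightarrow> (\<forall>A B. \<exists>t \<sigma>. exec c (init_state (s # row_major s A @ row_major s B)) t \<sigma> \<and>
     t \<le> T \<and> has_output \<sigma> (row_major s (bool_mat_mult s A B)))"

text \<open>Calls are numbered consecutively, and all residue classes from \<open>i\<close> on are
  still untouched.\<close>

definition fresh_from :: "nat \<Rightarrow> nat \<Rightarrow> (nat \<Rightarrow> nat \<Rightarrow> nat) \<Rightarrow> bool" where
  "fresh_from m i \<alpha> \<longleftrightarrow> (\<forall>a z k. i \<le> k \<longrightarrow> k < m \<longrightarrow> \<alpha> (a + 20) (z * m + k) = 0)"

text \<open>The zeros of array 9 from \<open>N * N\<close> on matter when the block of rows after
  the last one is read: it contains no arcs, so nothing is contributed there.\<close>

definition bit_arrays :: "nat \<Rightarrow> (nat \<Rightarrow> nat \<Rightarrow> nat) \<Rightarrow> bool" where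
  "bit_arrays N \<alpha> \<longleftrightarrow> (\<forall>z. \<alpha> 9 z \<le> 1 \<and> \<alpha> 10 z \<le> 1) \<and> (\<forall>z\<ge>N * N. \<alpha> 9 z = 0)"

definition entry :: "nat \<Rightarrow> (nat \<Rightarrow> nat) \<Rightarrow> nat \<Rightarrow> nat \<Rightarrow> bool" where
  "entry N A u v \<longleftrightarrow> v < N \<and> A (u * N + v) \<noteq> 0"

lemma index_eq_iff:
  fixes N :: nat
  assumes "w < N" "w' < N"
  shows "u * N + w = u' * N + w' \<longleftrightarrow> u = u' \<and> w = w'"
  using index_div_mod[OF assms(1), of u] index_div_mod[OF assms(2), of u'] by metis

lemma length_row_major [simp]: "length (row_major n A) = n * n"
  by (simp add: row_major_def)

lemma row_major_nth: "k < n * n \<Longrightarrow> row_major n A ! k = of_bool (A (k div n) (k mod n))"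
  by (simp add: row_major_def)

text \<open>The call finds its input in residue class \<open>i\<close> of array 20: the size at
  position 0, then the two matrices. Its result is merged by a disjunction and never overwrites a
  cell that is already won. Only class \<open>i\<close> becomes dirty, so the next call may use
  class \<open>Suc i\<close>.\<close>

lemma hoare_update:
  assumes c: "multiplies c s T" "regs_below R c"
    and regs: "\<rho> 2 = N" "\<rho> 6 = m" "\<rho> 7 = s" "\<rho> 16 = i" "\<rho> x = I" "\<rho> y = J"
      "x < 100" "y < 100" "x \<notin> {40, 41, 42, 98}" "y \<notin> {40, 41, 42, 98}"
    and i: "i < m" and s: "1 \<le> s" "(I + 1) * s \<le> N" "(J + 1) * s \<le> N"
    and \<alpha>: "bit_arrays N \<alpha>" "fresh_from m i \<alpha>"
    and M: "N * N + N + 2 \<le> M" "m \<le> M"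
  shows "hoare (update_prog R c x y) ((R + 8) * (s * s + T) * tick M) \<rho> \<alpha> (\<lambda>\<rho>' \<alpha>'.
    (\<forall>r. r \<notin> {40, 41, 42, 98} \<longrightarrow> \<rho>' r = \<rho> r) \<and> (\<forall>a<20. a \<noteq> 10 \<longrightarrow> \<alpha>' a = \<alpha> a) \<and>
    bit_arrays N \<alpha>' \<and> fresh_from m (Suc i) \<alpha>' \<and>
    (\<forall>u. \<forall>v<N. entry N (\<alpha>' 10) u v = update s I J (entry N (\<alpha> 9)) (entry N (\<alpha> 10)) u v))"
proof (rule hoare_mono)
  have ss: "s * s \<le> M" "s \<le> M" "I \<le> M" "J \<le> M" "i \<le> M" "2 \<le> M"
  proof -
    have "I * 1 \<le> (I + 1) * s" "J * 1 \<le> (J + 1) * s" "1 * s \<le> (I + 1) * s"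
      using s(1) by (intro mult_mono; simp)+
    then have *: "I \<le> N" "J \<le> N" "s \<le> N" using s by linarith+
    then have "s * s \<le> N * N" by (intro mult_mono) auto
    with * show "s * s \<le> M" "s \<le> M" "I \<le> M" "J \<le> M" "i \<le> M" "2 \<le> M" using M i by linarith+
  qed
  have bits: "\<alpha> 9 z \<le> 1" "\<alpha> 10 z \<le> 1" for z using \<alpha>(1) by (auto simp: bit_arrays_def)
  have bitsM: "\<alpha> 9 z \<le> M" "\<alpha> 10 z \<le> M" for z using bits[of z] ss by simp_all
  have kM: "k \<le> M" if "k < s * s" for k using that ss(1) by simp
  have NM: "N \<le> M" "Suc 0 \<le> M" using M(1) by simp_all
  have neqs: "x \<noteq> 40" "x \<noteq> 41" "x \<noteq> 42" "y \<noteq> 40" "y \<noteq> 41" "y \<noteq> 42" using regs by simp_all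
  have m: "0 < m" using i by simp
  have block: "b * s + k < N" if "(b + 1) * s \<le> N" "k < s" for b k
    using that by simp
  have kb: "k div s < s" "k mod s < s" if "k < s * s" for k
    using index_bounds[OF that] by simp_all
  define A where "A p q \<longleftrightarrow> \<alpha> 9 (((J + 1) * s + p) * N + (J * s + q)) \<noteq> 0" for p q
  \<comment> \<open>Transposed and complemented: the inner index \<open>q\<close> runs over the
    columns of the block, and a zero cell is a position lost by the opponent.\<close>
  define B where "B q p \<longleftrightarrow> \<alpha> 10 ((I * s + p) * N + (J * s + q)) = 0" for p q
  define C where "C = bool_mat_mult s A B"
  define input where "input = s # row_major s A @ row_major s B"
  obtain t \<sigma> where run: "exec c (init_state input) t \<sigma>" "t \<le> T" "has_output \<sigma> (row_major s C)"
    using c(1) unfolding multiplies_def input_def C_def by blast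
  define h1 where "h1 k = (k + 1) * m + i" for k
  define g1 where "g1 k = \<alpha> 9 (((J + 1) * s + k div s) * N + (J * s + k mod s))" for k
  define h2 where "h2 k = (k + s * s + 1) * m + i" for k
  define g2 :: "nat \<Rightarrow> nat" where "g2 k = of_bool (\<alpha> 10 ((I * s + k mod s) * N + (J * s + k div s)) = 0)" for k
  define \<alpha>\<^sub>1 where "\<alpha>\<^sub>1 = \<alpha>(20 := (\<alpha> 20)(i := s))"
  define \<alpha>\<^sub>2 where "\<alpha>\<^sub>2 = \<alpha>\<^sub>1(20 := scattered (\<alpha>\<^sub>1 20) h1 g1 (s * s))"
  define \<alpha>\<^sub>3 where "\<alpha>\<^sub>3 = \<alpha>\<^sub>2(20 := scattered (\<alpha>\<^sub>2 20) h2 g2 (s * s))"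
  define \<rho>\<^sub>2 where "\<rho>\<^sub>2 = \<rho>(40 := s * s, 40 + 1 := 0, 40 + 2 := s * s)"
  define \<rho>\<^sub>3 where "\<rho>\<^sub>3 = \<rho>\<^sub>2(40 := s * s, 40 + 1 := 0, 40 + 2 := s * s)"
  have \<rho>\<^sub>3: "\<rho>\<^sub>3 r = \<rho> r" if "r \<notin> {40, 41, 42}" for r
    using that by (auto simp: \<rho>\<^sub>3_def \<rho>\<^sub>2_def)
  have \<alpha>\<^sub>3: "\<alpha>\<^sub>3 a = \<alpha> a" if "a \<noteq> 20" for a
    using that by (auto simp: \<alpha>\<^sub>3_def \<alpha>\<^sub>2_def \<alpha>\<^sub>1_def)
  have call_index: "z * m + i = z' * m + i \<longleftrightarrow> z = z'" for z z' using m by simp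
  have inj: "inj_on h1 D" "inj_on h2 D" for D
    using m by (auto simp: inj_on_def h1_def h2_def)
  have \<alpha>\<^sub>3_20: "\<alpha>\<^sub>3 20 (z * m + i) = arr (init_state input) 0 z" for z
  proof -
    consider "z = 0" | k where "z = k + 1" "k < s * s" | k where "z = k + s * s + 1" "k < s * s"
      | "z \<ge> 2 * (s * s) + 1"
    proof -
      have "z = 0 \<or> (\<exists>k<s * s. z = k + 1) \<or> (\<exists>k<s * s. z = k + s * s + 1) \<or> z \<ge> 2 * (s * s) + 1"
        by presburger
      then show ?thesis using that by blast
    qed
    then show ?thesis
    proof cases
      case 1
      have "h1 k \<noteq> z * m + i" "h2 k \<noteq> z * m + i" for k
        unfolding h1_def h2_def call_index 1 by simp_all
      then show ?thesis
        using 1 by (simp add: \<alpha>\<^sub>3_def \<alpha>\<^sub>2_def \<alpha>\<^sub>1_def scattered_miss init_state_def input_def)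
    next
      case 2
      have "h2 k' \<noteq> z * m + i" for k'
        unfolding h2_def call_index 2 using 2(2) by simp
      then have "\<alpha>\<^sub>3 20 (z * m + i) = scattered (\<alpha>\<^sub>1 20) h1 g1 (s * s) (h1 k)"
        by (simp add: \<alpha>\<^sub>3_def \<alpha>\<^sub>2_def scattered_miss h1_def 2(1) del: mult_Suc)
      also have "\<dots> = g1 k" using inj 2(2) by (intro scattered_hit)
      also have "\<dots> = of_bool (A (k div s) (k mod s))"
        using bits(1)[of "((J + 1) * s + k div s) * N + (J * s + k mod s)"] unfolding g1_def A_def
        by (auto simp: le_Suc_eq)
      also have "\<dots> = arr (init_state input) 0 z"
        using 2 by (simp add: init_state_def input_def nth_append row_major_nth)
      finally show ?thesis .
    next
      case 3
      have "\<alpha>\<^sub>3 20 (z * m + i) = scattered (\<alpha>\<^sub>2 20) h2 g2 (s * s) (h2 k)"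
        by (simp add: \<alpha>\<^sub>3_def h2_def 3(1) del: mult_Suc)
      also have "\<dots> = g2 k" using inj 3(2) by (intro scattered_hit)
      also have "\<dots> = arr (init_state input) 0 z"
        using 3 by (simp add: init_state_def input_def nth_append row_major_nth g2_def B_def)
      finally show ?thesis .
    next
      case 4
      have "h1 k \<noteq> z * m + i" "h2 k \<noteq> z * m + i" if "k < s * s" for k
        unfolding h1_def h2_def call_index using 4 that by linarith+
      moreover have "z * m + i \<noteq> i" using 4 m by simp
      \<comment> \<open>Behind the input the class has never been written, which is the zero that
        the called program expects.\<close>
      moreover have "\<alpha> (0 + 20) (z * m + i) = 0" using \<alpha>(2) i unfolding fresh_from_def by blast
      ultimately show ?thesis
        using 4 by (simp add: \<alpha>\<^sub>3_def \<alpha>\<^sub>2_def \<alpha>\<^sub>1_def scattered_miss init_state_def input_def)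
    qed
  qed
  have input: "\<alpha>\<^sub>3 (a + 20) (z * m + i) = arr (init_state input) a z" for a z
  proof (cases "a = 0")
    case False
    then show ?thesis using \<alpha>(2) i by (simp add: \<alpha>\<^sub>3 fresh_from_def init_state_def)
  qed (simp add: \<alpha>\<^sub>3_20)
  let ?C = "\<lambda>(\<rho>' :: nat \<Rightarrow> nat) \<alpha>'. (\<forall>r. r \<noteq> 98 \<longrightarrow> \<rho>' r = \<rho>\<^sub>3 r) \<and> (\<forall>a<20. \<alpha>' a = \<alpha>\<^sub>3 a) \<and>
    (\<forall>a z. z mod m \<noteq> i \<longrightarrow> \<alpha>' (a + 20) z = \<alpha>\<^sub>3 (a + 20) z) \<and>
    (\<forall>z<length (row_major s C). \<alpha>' 21 (z * m + i) = row_major s C ! z)"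
  have "hoare (call R c) (R + 1 + 10 * bits m * t) \<rho>\<^sub>3 \<alpha>\<^sub>3 ?C"
    by (rule hoare_call[OF run(1) c(2) run(3) _ _ i input]) (simp_all add: \<rho>\<^sub>3 regs)
  then have call: "hoare (call R c) (R + 1 + 10 * bits m * T) \<rho>\<^sub>3 \<alpha>\<^sub>3 ?C"
    by (rule hoare_mono) (use run(2) in simp_all)
  define h where "h k = ((J + 1) * s + k div s) * N + (I * s + k mod s)" for k
  define g :: "nat \<Rightarrow> nat" where "g k = of_bool (\<alpha> 10 (h k) \<noteq> 0 \<or> C (k div s) (k mod s))" for k
  have h_eq: "h k = u * N + v \<longleftrightarrow> (J + 1) * s + k div s = u \<and> I * s + k mod s = v"
    if "k < s * s" "v < N" for k u v
    unfolding h_def using block[OF s(2) kb(2)[OF that(1)]] that(2) by (rule index_eq_iff)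
  have inj_h: "inj_on h {..<s * s}"
  proof (rule inj_onI)
    fix k k' assume k: "k \<in> {..<s * s}" "k' \<in> {..<s * s}" "h k = h k'"
    then have "k div s = k' div s" "k mod s = k' mod s"
      using h_eq[of k "I * s + k' mod s" "(J + 1) * s + k' div s"] block[OF s(2) kb(2)[of k']]
      by (simp_all add: h_def[of k'])
    then show "k = k'" by (metis div_mult_mod_eq)
  qed
  have final: "hoare (merge_prog x y)
      ((s * s + 1) * tick M) \<rho>\<^sub>4 \<alpha>\<^sub>4 (\<lambda>\<rho>' \<alpha>'. \<exists>\<rho>\<^sub>4 \<alpha>\<^sub>4. ?C \<rho>\<^sub>4 \<alpha>\<^sub>4 \<and>
        \<rho>' = \<rho>\<^sub>4(40 := s * s, 40 + 1 := 0, 40 + 2 := s * s) \<and> \<alpha>' = \<alpha>\<^sub>4(10 := scattered (\<alpha>\<^sub>4 10) h g (s * s)))"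
    if C: "?C \<rho>\<^sub>4 \<alpha>\<^sub>4" for \<rho>\<^sub>4 \<alpha>\<^sub>4
  proof (rule hoare_fill_tick[where h = h and g = g])
    have r4: "\<rho>\<^sub>4 r = \<rho> r" if "r \<notin> {40, 41, 42, 98}" for r
      using C \<rho>\<^sub>3[of r] that by auto
    have regs4: "\<rho>\<^sub>4 2 = N" "\<rho>\<^sub>4 6 = m" "\<rho>\<^sub>4 7 = s" "\<rho>\<^sub>4 16 = i" "\<rho>\<^sub>4 x = I" "\<rho>\<^sub>4 y = J"
      using r4 regs by simp_all
    have a10: "\<alpha>\<^sub>4 10 = \<alpha> 10" using C \<alpha>\<^sub>3[of 10] by auto
    show "2 \<le> M" "bounded M (Rg 7 \<otimes> Rg 7) \<rho>\<^sub>4 \<alpha>\<^sub>4" "val (Rg 7 \<otimes> Rg 7) \<rho>\<^sub>4 \<alpha>\<^sub>4 = s * s" "s * s \<le> M"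
      using regs4 ss by simp_all
    show "small (Rg 7 \<otimes> Rg 7)"
      "small (dest_ex x y)"
      "small (merged_ex x y)"
      using regs by (simp_all add: small_def)
    fix k assume k: "k < s * s"
    have old: "scattered (\<alpha>\<^sub>4 10) h g k (h k) = \<alpha> 10 (h k)"
    proof -
      have "h k' \<noteq> h k" if "k' < k" for k' using inj_h that k by (auto dest: inj_onD)
      then show ?thesis by (simp add: scattered_miss a10)
    qed
    have out: "\<alpha>\<^sub>4 21 (k * m + i) = of_bool (C (k div s) (k mod s))"
      using C k by (simp add: row_major_nth)
    have hk: "(s + J * s + k div s) * N + (I * s + k mod s) = h k"
      by (simp add: h_def)
    let ?\<rho> = "\<rho>\<^sub>4(40 := k, 40 + 1 := s * s - k, 40 + 2 := s * s)"
    \<comment> \<open>Holds for any array contents, since the address is computed from registers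
      only.\<close>
    have d: "val (dest_ex x y) ?\<rho> \<beta> = h k" "bounded M (dest_ex x y) ?\<rho> \<beta>" for \<beta>
      using regs regs4 k ss M by (auto simp: h_def)
    show "let \<rho>' = \<rho>\<^sub>4(40 := k, 40 + 1 := s * s - k, 40 + 2 := s * s);
           \<alpha>' = \<alpha>\<^sub>4(10 := scattered (\<alpha>\<^sub>4 10) h g k)
       in bounded M (dest_ex x y) \<rho>' \<alpha>' \<and>
          bounded M (merged_ex x y) \<rho>' \<alpha>' \<and>
          val (dest_ex x y) \<rho>' \<alpha>' = h k \<and>
          val (merged_ex x y) \<rho>' \<alpha>' = g k"
      unfolding Let_def is_zero_simps bounded.simps(3,4) val.simps(3,4) d
      using d k ss M old out bitsM(2)[of "h k"] by (auto simp: g_def regs4)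
  qed ((use C in blast) | simp)+
  have 3: "hoare (Seq (call R c) (merge_prog x y))
     (R + 1 + 10 * bits m * T + (s * s + 1) * tick M) \<rho>\<^sub>3 \<alpha>\<^sub>3
     (\<lambda>\<rho>' \<alpha>'. \<exists>\<rho>\<^sub>4 \<alpha>\<^sub>4. ?C \<rho>\<^sub>4 \<alpha>\<^sub>4 \<and>
        \<rho>' = \<rho>\<^sub>4(40 := s * s, 40 + 1 := 0, 40 + 2 := s * s) \<and> \<alpha>' = \<alpha>\<^sub>4(10 := scattered (\<alpha>\<^sub>4 10) h g (s * s)))"
    by (rule hoare_Seq[OF call]) (rule final)
  show "hoare (update_prog R c x y) (tick M + ((s * s + 1) * tick M + ((s * s + 1) * tick M +
     (R + 1 + 10 * bits m * T + (s * s + 1) * tick M)))) \<rho> \<alpha>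
     (\<lambda>\<rho>' \<alpha>'. \<exists>\<rho>\<^sub>4 \<alpha>\<^sub>4. ?C \<rho>\<^sub>4 \<alpha>\<^sub>4 \<and>
        \<rho>' = \<rho>\<^sub>4(40 := s * s, 40 + 1 := 0, 40 + 2 := s * s) \<and> \<alpha>' = \<alpha>\<^sub>4(10 := scattered (\<alpha>\<^sub>4 10) h g (s * s)))"
    unfolding update_prog_def
    apply (rule hoare_store_tick)
    using ss regs apply (simp_all add: small_def)[5]
    apply (rule hoare_fill_Seq_tick[where h = h1 and g = g1])
    using ss regs apply (simp_all add: small_def)[8]
    subgoal for k
      using kM[of k] by (simp add: Let_def h1_def g1_def regs(1-8) ss M(2) NM bitsM neqs del: mult_Suc mult_Suc_right)
    apply (rule hoare_fill_Seq_tick[where h = h2 and g = g2])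
    using ss regs apply (simp_all add: small_def)[8]
    subgoal for k
      using kM[of k] by (simp add: Let_def h2_def g2_def regs(1-8) ss M(2) NM bitsM neqs del: mult_Suc mult_Suc_right)
    using 3 regs by (simp add: \<rho>\<^sub>3_def \<rho>\<^sub>2_def \<alpha>\<^sub>3_def \<alpha>\<^sub>2_def \<alpha>\<^sub>1_def)
  show "tick M + ((s * s + 1) * tick M + ((s * s + 1) * tick M +
     (R + 1 + 10 * bits m * T + (s * s + 1) * tick M))) \<le> (R + 8) * (s * s + T) * tick M"
  proof -
    have s1: "1 \<le> s * s" using s(1) by simp
    have t1: "1 \<le> tick M" using bits_pos[of M] ss(6) by (simp add: tick_def)
    have "10 * bits m \<le> tick M" using bits_mono[OF M(2)] by (simp add: tick_def)
    then have "10 * bits m * T \<le> tick M * T" by (rule mult_le_mono1)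
    moreover have "R + 1 \<le> (R + 1) * (s * s * tick M)"
    proof -
      have "1 * 1 \<le> s * s * tick M" using s1 t1 by (rule mult_le_mono)
      then have "(R + 1) * 1 \<le> (R + 1) * (s * s * tick M)" by (intro mult_le_mono2) simp
      then show ?thesis by simp
    qed
    moreover have "tick M \<le> s * s * tick M" using s1 by simp
    ultimately have "tick M + ((s * s + 1) * tick M + ((s * s + 1) * tick M +
       (R + 1 + 10 * bits m * T + (s * s + 1) * tick M))) \<le>
       7 * (s * s * tick M) + (R + 1) * (s * s * tick M) + tick M * T"
      unfolding distrib_right by linarith
    also have "\<dots> \<le> (R + 8) * (s * s + T) * tick M"
      by (simp add: algebra_simps)
    finally show ?thesis .
  qed
  fix \<rho>' \<alpha>'
  assume "\<exists>\<rho>\<^sub>4 \<alpha>\<^sub>4. ?C \<rho>\<^sub>4 \<alpha>\<^sub>4 \<and>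
        \<rho>' = \<rho>\<^sub>4(40 := s * s, 40 + 1 := 0, 40 + 2 := s * s) \<and> \<alpha>' = \<alpha>\<^sub>4(10 := scattered (\<alpha>\<^sub>4 10) h g (s * s))"
  then obtain \<rho>\<^sub>4 \<alpha>\<^sub>4 where C: "?C \<rho>\<^sub>4 \<alpha>\<^sub>4"
    and \<rho>': "\<rho>' = \<rho>\<^sub>4(40 := s * s, 40 + 1 := 0, 40 + 2 := s * s)"
    and \<alpha>': "\<alpha>' = \<alpha>\<^sub>4(10 := scattered (\<alpha>\<^sub>4 10) h g (s * s))" by blast
  have a10: "\<alpha>\<^sub>4 10 = \<alpha> 10" using C \<alpha>\<^sub>3[of 10] by auto
  have fr: "\<alpha>' a = \<alpha> a" if "a < 20" "a \<noteq> 10" for a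
    using C \<alpha>\<^sub>3[of a] that by (auto simp: \<alpha>')
  have "\<rho>' r = \<rho> r" if "r \<notin> {40, 41, 42, 98}" for r
    using C \<rho>\<^sub>3[of r] that by (auto simp: \<rho>')
  moreover have "bit_arrays N \<alpha>'"
  proof -
    have "scattered (\<alpha>\<^sub>4 10) h g (s * s) z \<le> 1" for z
      using bits(2) by (intro scattered_cases[where P = "\<lambda>_ v. v \<le> 1"]) (auto simp: g_def a10)
    then show ?thesis using \<alpha>(1) fr[of 9] by (auto simp: bit_arrays_def \<alpha>')
  qed
  moreover have "fresh_from m (Suc i) \<alpha>'"
    unfolding fresh_from_def
  proof (intro allI impI)
    fix a z k assume k: "Suc i \<le> k" "k < m"
    have mod: "(z * m + k) mod m \<noteq> i" using k by simp
    have "\<alpha>' (a + 20) (z * m + k) = \<alpha>\<^sub>3 (a + 20) (z * m + k)" using C mod by (simp add: \<alpha>')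
    also have "\<dots> = \<alpha> (a + 20) (z * m + k)"
    proof (cases "a = 0")
      case True
      have "h1 q \<noteq> z * m + k" "h2 q \<noteq> z * m + k" for q
        using mod i unfolding h1_def h2_def by (metis mod_mult_self3 mod_less)+
      moreover have "z * m + k \<noteq> i" using k by simp
      ultimately show ?thesis using True by (simp add: \<alpha>\<^sub>3_def \<alpha>\<^sub>2_def \<alpha>\<^sub>1_def scattered_miss)
    qed (simp add: \<alpha>\<^sub>3)
    also have "\<dots> = 0" using \<alpha>(2) k by (simp add: fresh_from_def)
    finally show "\<alpha>' (a + 20) (z * m + k) = 0" .
  qed
  moreover have "entry N (\<alpha>' 10) u v = update s I J (entry N (\<alpha> 9)) (entry N (\<alpha> 10)) u v" if v: "v < N" for u v
  proof (cases "u div s = J + 1 \<and> v div s = I")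
    case True
    define k where "k = u mod s * s + v mod s"
    have sv: "v mod s < s" "u mod s < s" using s(1) by simp_all
    have k: "k < s * s" "k div s = u mod s" "k mod s = v mod s"
      using index_less[OF sv(2,1)] index_div_mod[OF sv(1)] by (simp_all add: k_def)
    have uv: "(J + 1) * s + u mod s = u" "I * s + v mod s = v"
      using True by (metis div_mult_mod_eq)+
    have hk: "h k = u * N + v" using h_eq[OF k(1) v] k uv by simp
    have "\<alpha>' 10 (u * N + v) = g k"
      using scattered_hit[OF inj_h k(1), of "\<alpha>\<^sub>4 10" g] hk by (simp add: \<alpha>')
    then have "entry N (\<alpha>' 10) u v \<longleftrightarrow> entry N (\<alpha> 10) u v \<or> C (u mod s) (v mod s)"
      using v hk k by (auto simp: entry_def g_def)
    moreover have "C (u mod s) (v mod s) \<longleftrightarrow> (\<exists>w. w div s = J \<and> entry N (\<alpha> 9) u w \<and> \<not> entry N (\<alpha> 10) v w)"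
    proof
      assume "C (u mod s) (v mod s)"
      then obtain q where q: "q < s" "A (u mod s) q" "B q (v mod s)"
        by (auto simp: C_def bool_mat_mult_def)
      have "(J * s + q) div s = J" using index_div_mod(1)[OF q(1)] .
      moreover have "entry N (\<alpha> 9) u (J * s + q)" "\<not> entry N (\<alpha> 10) v (J * s + q)"
        using q(2,3) block[OF s(3) q(1)] uv by (auto simp: entry_def A_def B_def)
      ultimately show "\<exists>w. w div s = J \<and> entry N (\<alpha> 9) u w \<and> \<not> entry N (\<alpha> 10) v w" by blast
    next
      assume "\<exists>w. w div s = J \<and> entry N (\<alpha> 9) u w \<and> \<not> entry N (\<alpha> 10) v w"
      then obtain w where w: "w div s = J" "entry N (\<alpha> 9) u w" "\<not> entry N (\<alpha> 10) v w" by blast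
      have ws: "w mod s < s" "J * s + w mod s = w" using s(1) w(1) by auto
      have "A (u mod s) (w mod s)" "B (w mod s) (v mod s)"
        using w(2,3) ws uv by (auto simp: entry_def A_def B_def)
      then show "C (u mod s) (v mod s)" using ws by (auto simp: C_def bool_mat_mult_def)
    qed
    ultimately show ?thesis using True by (simp add: update_def)
  next
    case False
    have "h k \<noteq> u * N + v" if k: "k < s * s" for k
    proof
      assume "h k = u * N + v"
      then have "u = (J + 1) * s + k div s" "v = I * s + k mod s" using h_eq[OF k v] by auto
      then show False using False index_div_mod(1)[OF kb(1)[OF k]] index_div_mod(1)[OF kb(2)[OF k]] by metis
    qed
    then have "\<alpha>' 10 (u * N + v) = \<alpha> 10 (u * N + v)" by (simp add: \<alpha>' scattered_miss a10)
    then show ?thesis using False by (auto simp: update_def entry_def)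
  qed
  ultimately show "(\<forall>r. r \<notin> {40, 41, 42, 98} \<longrightarrow> \<rho>' r = \<rho> r) \<and> (\<forall>a<20. a \<noteq> 10 \<longrightarrow> \<alpha>' a = \<alpha> a) \<and>
    bit_arrays N \<alpha>' \<and> fresh_from m (Suc i) \<alpha>' \<and>
    (\<forall>u. \<forall>v<N. entry N (\<alpha>' 10) u v = update s I J (entry N (\<alpha> 9)) (entry N (\<alpha> 10)) u v)"
    using fr by blast
qed

section \<open>The main loop over Morton codes\<close>

abbreviation aligned_ex :: ex where
  "aligned_ex \<equiv> is_zero ((Rg 20 \<oplus> Nm 1) \<odot> (Rg 7 \<otimes> Rg 7))"

text \<open>The pair of code and level is numbered in mixed radix, with \<open>L + 1\<close> levels
  for each code; doubling leaves a second number for the transposed block.\<close>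

abbreviation call_id_ex :: ex where
  "call_id_ex \<equiv> (Rg 20 \<otimes> (Rg 3 \<oplus> Nm 1) \<oplus> Rg 30) \<otimes> Nm 2"

abbreviation update_both :: "nat \<Rightarrow> com \<Rightarrow> com" where
  "update_both R c \<equiv> Seq (assign 16 call_id_ex) (Seq (update_prog R c 8 9)
    (Seq (assign 16 (Rg 16 \<oplus> Nm 1)) (update_prog R c 9 8)))"

abbreviation guarded_update :: "nat \<Rightarrow> com \<Rightarrow> com" where
  "guarded_update R c \<equiv> cond 13 aligned_ex (update_both R c)"

definition level_prog :: "nat \<Rightarrow> com \<Rightarrow> com" where
  "level_prog R c =
     Seq (assign 8 (Ar 11 (Rg 20) \<oslash> Rg 7))
    (Seq (assign 9 (Ar 12 (Rg 20) \<oslash> Rg 7))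
    (Seq (guarded_update R c)
    (Seq (assign 7 (Nm 2 \<otimes> Rg 7)) Skip)))"

abbreviation levels_prog :: "nat \<Rightarrow> com \<Rightarrow> com" where
  "levels_prog R c \<equiv> Seq (assign 7 (Nm 1)) (loop 30 (Rg 3 \<oplus> Nm 1) (level_prog R c))"

abbreviation main_loop_prog :: "nat \<Rightarrow> com \<Rightarrow> com" where
  "main_loop_prog R c \<equiv> loop 20 (Rg 2 \<otimes> Rg 2) (levels_prog R c)"

definition main_prog :: "nat \<Rightarrow> com \<Rightarrow> com" where
  "main_prog R c =
     Seq (assign 6 (Nm 2 \<otimes> (Rg 3 \<oplus> Nm 1) \<otimes> (Rg 2 \<otimes> Rg 2)))
    (main_loop_prog R c)"

abbreviation main_regs :: "nat set" where
  "main_regs \<equiv> {7, 8, 9, 13, 16, 20, 21, 22, 30, 31, 32, 40, 41, 42, 98}"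

locale main_loop = triangular_game L N E f
  for L N :: nat and E f :: "nat \<Rightarrow> nat \<Rightarrow> bool" +
  fixes R :: nat and c :: com and T :: "nat \<Rightarrow> nat" and M m :: nat
    and \<rho> :: "nat \<Rightarrow> nat" and \<alpha> :: "nat \<Rightarrow> nat \<Rightarrow> nat"
  assumes c: "\<And>s. 1 \<le> s \<Longrightarrow> multiplies c s (T s)" "regs_below R c"
    and m: "m = 2 * (L + 1) * (N * N)"
    and M: "N * N + N + 2 \<le> M" "m \<le> M" "L + 1 \<le> M"
    and \<rho>: "\<rho> 2 = N" "\<rho> 3 = L" "\<rho> 6 = m"
    and E_eq: "E = entry N (\<alpha> 9)"
    and tables: "\<And>t. t < N * N \<Longrightarrow> \<alpha> 11 t = morton_fst t" "\<And>t. t < N * N \<Longrightarrow> \<alpha> 12 t = morton_snd t"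
begin

lemma NN: "N * N = 4 ^ L" "1 \<le> N"
  by (simp_all add: N power_mult_distrib[symmetric])

definition state_ok :: "nat \<Rightarrow> nat \<Rightarrow> (nat \<Rightarrow> nat) \<Rightarrow> (nat \<Rightarrow> nat \<Rightarrow> nat) \<Rightarrow> bool" where
  "state_ok t j \<rho>' \<alpha>' \<longleftrightarrow> (\<forall>r. r \<notin> main_regs \<longrightarrow> \<rho>' r = \<rho> r) \<and> (\<forall>a<20. a \<noteq> 10 \<longrightarrow> \<alpha>' a = \<alpha> a) \<and>
     bit_arrays N \<alpha>' \<and> fresh_from m (2 * (t * (L + 1) + j)) \<alpha>' \<and> invariant t j (entry N (\<alpha>' 10))"

definition level_cost :: "nat \<Rightarrow> nat" where
  "level_cost j = 2 + 2 * ((R + 8) * (4 ^ j + T (2 ^ j)))"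

lemma fresh_from_mono: "fresh_from m i \<alpha>' \<Longrightarrow> i \<le> i' \<Longrightarrow> fresh_from m i' \<alpha>'"
  by (auto simp: fresh_from_def)

lemma block_le:
  assumes "a < N" "j \<le> L"
  shows "(a div 2 ^ j + 1) * 2 ^ j \<le> N"
proof -
  have *: "(2::nat) ^ L = 2 ^ (L - j) * 2 ^ j" using assms(2) by (simp add: power_add[symmetric])
  have "a div 2 ^ j < 2 ^ (L - j)"
    using assms(1) unfolding N * by (rule less_mult_imp_div_less)
  then have "(a div 2 ^ j + 1) * 2 ^ j \<le> 2 ^ (L - j) * 2 ^ j" by (intro mult_le_mono1) simp
  then show ?thesis unfolding N * .
qed

lemma hoare_level:
  assumes t: "t < N * N" and j: "j < Suc L" and ok: "state_ok t j \<rho>' \<alpha>'"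
    and regs: "\<rho>' 20 = t" "\<rho>' 22 = N * N" "\<rho>' 30 = j" "\<rho>' 32 = Suc L" "\<rho>' 7 = 2 ^ j"
  shows "hoare (level_prog R c) ((5 + (if 4 ^ j dvd t + 1 then level_cost j else 0)) * tick M) \<rho>' \<alpha>'
    (\<lambda>\<rho>'' \<alpha>''. state_ok t (Suc j) \<rho>'' \<alpha>'' \<and> \<rho>'' 20 = t \<and> \<rho>'' 22 = N * N \<and> \<rho>'' 30 = j \<and>
       \<rho>'' 32 = Suc L \<and> \<rho>'' 7 = 2 ^ Suc j)"
proof (rule hoare_mono)
  have t4: "t < 4 ^ L" using t NN by simp
  define I where "I = morton_fst t div 2 ^ j"
  define J where "J = morton_snd t div 2 ^ j"
  define i where "i = 2 * (t * (L + 1) + j)"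
  have uv: "morton_fst t < N" "morton_snd t < N"
    using morton_fst_less[OF t4] morton_snd_less[OF t4] N by simp_all
  have IJ: "(I + 1) * 2 ^ j \<le> N" "(J + 1) * 2 ^ j \<le> N"
    unfolding I_def J_def using block_le[OF uv(1), of j] block_le[OF uv(2), of j] j by simp_all
  have IJ_le: "I \<le> M" "J \<le> M"
    unfolding I_def J_def using uv M by (meson div_le_dividend le_trans less_imp_le add_leD1 add_leD2)+
  have pj: "(2::nat) ^ j \<le> N" unfolding N using j by (intro power_increasing) auto
  have pjj: "2 ^ j * 2 ^ j = (4::nat) ^ j" by (simp add: power_mult_distrib[symmetric])
  \<comment> \<open>Both call numbers of a level have to lie below the modulus.\<close>
  have i: "Suc i < m"
  proof -
    have double: "Suc (2 * a) < 2 * b" if "a < b" for a b :: nat using that by simp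
    have less: "t * (L + 1) + j < N * N * (L + 1)"
    proof -
      have "t * (L + 1) + j < Suc t * (L + 1)" using j by simp
      also have "\<dots> \<le> N * N * (L + 1)" using t by (intro mult_le_mono1) simp
      finally show ?thesis .
    qed
    have "m = 2 * (N * N * (L + 1))" by (simp add: m)
    then show ?thesis unfolding i_def using double[OF less] by (simp only:)
  qed
  have M': "2 \<le> M" "N \<le> M" "t \<le> M" "j \<le> M" "i \<le> M" "Suc L \<le> M" "L \<le> M" "2 ^ j \<le> M" "Suc t \<le> M"
    using M t j i pj by linarith+
  have \<alpha>': "\<alpha>' a = \<alpha> a" if "a < 20" "a \<noteq> 10" for a using ok that by (auto simp: state_ok_def)
  have \<rho>': "\<rho>' r = \<rho> r" if "r \<notin> main_regs" for r using ok that by (auto simp: state_ok_def)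
  have tab: "\<alpha>' 11 t = morton_fst t" "\<alpha>' 12 t = morton_snd t" using tables t \<alpha>' by simp_all
  define \<rho>\<^sub>1 where "\<rho>\<^sub>1 = \<rho>'(8 := I, 9 := J)"
  let ?upd = "(R + 8) * (2 ^ j * 2 ^ j + T (2 ^ j)) * tick M"
  let ?Q = "\<lambda>(\<rho>'' :: nat \<Rightarrow> nat) \<alpha>''. state_ok t (Suc j) \<rho>'' \<alpha>'' \<and> \<rho>'' 20 = t \<and> \<rho>'' 22 = N * N \<and> \<rho>'' 30 = j \<and>
       \<rho>'' 32 = Suc L \<and> \<rho>'' 7 = 2 ^ j"
  have frame: "\<rho>\<^sub>1 r = \<rho> r" if "r \<notin> main_regs" for r
    using \<rho>'[OF that] that by (auto simp: \<rho>\<^sub>1_def)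
  have regs1: "\<rho>\<^sub>1 20 = t" "\<rho>\<^sub>1 22 = N * N" "\<rho>\<^sub>1 30 = j" "\<rho>\<^sub>1 32 = Suc L" "\<rho>\<^sub>1 7 = 2 ^ j" "\<rho>\<^sub>1 8 = I" "\<rho>\<^sub>1 9 = J"
      "\<rho>\<^sub>1 2 = N" "\<rho>\<^sub>1 3 = L" "\<rho>\<^sub>1 6 = m"
    using regs \<rho> \<rho>' by (simp_all add: \<rho>\<^sub>1_def)
  have test: "val aligned_ex \<rho>\<^sub>1 \<alpha>' = of_bool (4 ^ j dvd t + 1)"
    by (simp add: regs1 pjj dvd_eq_mod_eq_0)
  have upd: "hoare (update_both R c)
      (tick M + (?upd + (tick M + ?upd))) (\<rho>\<^sub>1(13 := 1)) \<alpha>' ?Q" if dvd: "4 ^ j dvd t + 1"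
  proof (intro hoare_assign_tick)
    define \<rho>\<^sub>2 where "\<rho>\<^sub>2 = \<rho>\<^sub>1(13 := 1, 16 := i)"
    have \<rho>\<^sub>2: "(\<rho>\<^sub>1(13 := 1))(16 := val call_id_ex (\<rho>\<^sub>1(13 := 1)) \<alpha>') = \<rho>\<^sub>2"
      by (simp add: \<rho>\<^sub>2_def regs1 i_def algebra_simps)
    show "2 \<le> M" "small call_id_ex" "16 < (100::nat)" using M' by (simp_all add: small_def)
    show "bounded M call_id_ex (\<rho>\<^sub>1(13 := 1)) \<alpha>'" using M' by (simp add: regs1)
    have regs2: "\<rho>\<^sub>2 2 = N" "\<rho>\<^sub>2 6 = m" "\<rho>\<^sub>2 7 = 2 ^ j" "\<rho>\<^sub>2 16 = i" "\<rho>\<^sub>2 8 = I" "\<rho>\<^sub>2 9 = J"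
        "\<rho>\<^sub>2 20 = t" "\<rho>\<^sub>2 22 = N * N" "\<rho>\<^sub>2 30 = j" "\<rho>\<^sub>2 32 = Suc L"
      by (simp_all add: \<rho>\<^sub>2_def regs1)
    have ok': "bit_arrays N \<alpha>'" "fresh_from m i \<alpha>'" "invariant t j (entry N (\<alpha>' 10))"
      using ok by (auto simp: state_ok_def i_def)
    have "hoare (update_prog R c 8 9) ?upd \<rho>\<^sub>2 \<alpha>' (\<lambda>\<rho>'' \<alpha>''.
      (\<forall>r. r \<notin> {40, 41, 42, 98} \<longrightarrow> \<rho>'' r = \<rho>\<^sub>2 r) \<and> (\<forall>a<20. a \<noteq> 10 \<longrightarrow> \<alpha>'' a = \<alpha>' a) \<and>
      bit_arrays N \<alpha>'' \<and> fresh_from m (Suc i) \<alpha>'' \<and>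
      (\<forall>u. \<forall>v<N. entry N (\<alpha>'' 10) u v = update (2 ^ j) I J (entry N (\<alpha>' 9)) (entry N (\<alpha>' 10)) u v))"
      using i by (intro hoare_update[OF c(1) c(2) regs2(1-6)]) (simp_all add: IJ[simplified] ok' M[simplified])
    then show "hoare (Seq (update_prog R c 8 9) (Seq (assign 16 (Rg 16 \<oplus> Nm 1)) (update_prog R c 9 8)))
      (?upd + (tick M + ?upd)) ((\<rho>\<^sub>1(13 := 1))(16 := val call_id_ex (\<rho>\<^sub>1(13 := 1)) \<alpha>')) \<alpha>' ?Q"
      unfolding \<rho>\<^sub>2
    proof (rule hoare_Seq)
      fix \<rho>\<^sub>3 \<alpha>\<^sub>3
      assume 3: "(\<forall>r. r \<notin> {40, 41, 42, 98} \<longrightarrow> \<rho>\<^sub>3 r = \<rho>\<^sub>2 r) \<and> (\<forall>a<20. a \<noteq> 10 \<longrightarrow> \<alpha>\<^sub>3 a = \<alpha>' a) \<and>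
        bit_arrays N \<alpha>\<^sub>3 \<and> fresh_from m (Suc i) \<alpha>\<^sub>3 \<and>
        (\<forall>u. \<forall>v<N. entry N (\<alpha>\<^sub>3 10) u v = update (2 ^ j) I J (entry N (\<alpha>' 9)) (entry N (\<alpha>' 10)) u v)"
      define \<rho>\<^sub>4 where "\<rho>\<^sub>4 = \<rho>\<^sub>3(16 := Suc i)"
      have \<rho>\<^sub>4: "\<rho>\<^sub>4 r = \<rho>\<^sub>2 r" if "r \<notin> {16, 40, 41, 42, 98}" for r
        using 3 that by (simp add: \<rho>\<^sub>4_def)
      have regs4: "\<rho>\<^sub>4 2 = N" "\<rho>\<^sub>4 6 = m" "\<rho>\<^sub>4 7 = 2 ^ j" "\<rho>\<^sub>4 16 = Suc i" "\<rho>\<^sub>4 9 = J" "\<rho>\<^sub>4 8 = I"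
          "\<rho>\<^sub>4 20 = t" "\<rho>\<^sub>4 22 = N * N" "\<rho>\<^sub>4 30 = j" "\<rho>\<^sub>4 32 = Suc L"
        using \<rho>\<^sub>4 regs2 by (simp_all add: \<rho>\<^sub>4_def[THEN fun_cong, of 16])
      have "hoare (update_prog R c 9 8) ?upd \<rho>\<^sub>4 \<alpha>\<^sub>3 (\<lambda>\<rho>'' \<alpha>''.
        (\<forall>r. r \<notin> {40, 41, 42, 98} \<longrightarrow> \<rho>'' r = \<rho>\<^sub>4 r) \<and> (\<forall>a<20. a \<noteq> 10 \<longrightarrow> \<alpha>'' a = \<alpha>\<^sub>3 a) \<and>
        bit_arrays N \<alpha>'' \<and> fresh_from m (Suc (Suc i)) \<alpha>'' \<and>
        (\<forall>u. \<forall>v<N. entry N (\<alpha>'' 10) u v = update (2 ^ j) J I (entry N (\<alpha>\<^sub>3 9)) (entry N (\<alpha>\<^sub>3 10)) u v))"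
        using i 3 by (intro hoare_update[OF c(1) c(2) regs4(1-6)]) (simp_all add: IJ[simplified] M[simplified])
      moreover have "?Q \<rho>\<^sub>5 \<alpha>\<^sub>5"
        if 5: "(\<forall>r. r \<notin> {40, 41, 42, 98} \<longrightarrow> \<rho>\<^sub>5 r = \<rho>\<^sub>4 r) \<and> (\<forall>a<20. a \<noteq> 10 \<longrightarrow> \<alpha>\<^sub>5 a = \<alpha>\<^sub>3 a) \<and>
          bit_arrays N \<alpha>\<^sub>5 \<and> fresh_from m (Suc (Suc i)) \<alpha>\<^sub>5 \<and>
          (\<forall>u. \<forall>v<N. entry N (\<alpha>\<^sub>5 10) u v = update (2 ^ j) J I (entry N (\<alpha>\<^sub>3 9)) (entry N (\<alpha>\<^sub>3 10)) u v)"
        for \<rho>\<^sub>5 \<alpha>\<^sub>5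
      proof -
        have "\<alpha>' 9 = \<alpha> 9" "\<alpha>\<^sub>3 9 = \<alpha> 9" using 3 \<alpha>'[of 9] by simp_all
        then have "invariant t (Suc j) (entry N (\<alpha>\<^sub>5 10))"
          using 3 5 by (intro invariant_level[OF ok'(3) t4 dvd]) (simp_all add: E_eq I_def J_def)
        moreover have "\<rho>\<^sub>5 r = \<rho> r" if r: "r \<notin> main_regs" for r
        proof -
          have "\<rho>\<^sub>5 r = \<rho>\<^sub>4 r" using 5 r by simp
          also have "\<dots> = \<rho>\<^sub>2 r" using r by (intro \<rho>\<^sub>4) simp
          also have "\<dots> = \<rho>\<^sub>1 r" using r by (simp add: \<rho>\<^sub>2_def)
          also have "\<dots> = \<rho> r" using r by (rule frame)
          finally show ?thesis .
        qed
        moreover have "\<alpha>\<^sub>5 a = \<alpha> a" if "a < 20" "a \<noteq> 10" for a using 3 5 \<alpha>' that by simp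
        moreover have "fresh_from m (2 * (t * (L + 1) + Suc j)) \<alpha>\<^sub>5" using 5 by (simp add: i_def)
        ultimately show ?thesis using 5 regs4 by (simp add: state_ok_def)
      qed
      ultimately have "hoare (update_prog R c 9 8) ?upd \<rho>\<^sub>4 \<alpha>\<^sub>3 ?Q"
        by (rule hoare_mono[OF _ order_refl])
      moreover have "\<rho>\<^sub>3 16 = i" using 3 regs2 by simp
      ultimately show "hoare (Seq (assign 16 (Rg 16 \<oplus> Nm 1)) (update_prog R c 9 8)) (tick M + ?upd) \<rho>\<^sub>3 \<alpha>\<^sub>3 ?Q"
        using M' by (intro hoare_assign_tick) (simp_all add: small_def \<rho>\<^sub>4_def)
    qed
  qed
  have skip: "?Q (\<rho>\<^sub>1(13 := 0)) \<alpha>'" if "\<not> 4 ^ j dvd t + 1"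
  proof -
    have "fresh_from m (2 * (t * (L + 1) + Suc j)) \<alpha>'"
      using ok by (auto simp: state_ok_def elim: fresh_from_mono)
    then show ?thesis
      using ok invariant_skip_level[OF _ that, of "entry N (\<alpha>' 10)"] frame regs1
      by (simp add: state_ok_def)
  qed
  have "hoare (guarded_update R c)
      (tick M + (if val aligned_ex \<rho>\<^sub>1 \<alpha>' = 0 then 0
        else tick M + (?upd + (tick M + ?upd)))) \<rho>\<^sub>1 \<alpha>' ?Q"
  proof (rule hoare_cond_tick)
    show "bounded M aligned_ex \<rho>\<^sub>1 \<alpha>'" using M' by (simp add: regs1)
    show "hoare (update_both R c)
      (tick M + (?upd + (tick M + ?upd)))
      (\<rho>\<^sub>1(13 := val aligned_ex \<rho>\<^sub>1 \<alpha>')) \<alpha>' ?Q"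
      if "val aligned_ex \<rho>\<^sub>1 \<alpha>' \<noteq> 0"
    proof -
      have "4 ^ j dvd t + 1" using that unfolding test by (simp split: if_splits)
      then show ?thesis using upd unfolding test by simp
    qed
    show "?Q (\<rho>\<^sub>1(13 := 0)) \<alpha>'"
      if "val aligned_ex \<rho>\<^sub>1 \<alpha>' = 0"
    proof -
      have "\<not> 4 ^ j dvd t + 1" using that unfolding test by simp
      then show ?thesis by (rule skip)
    qed
  qed (use M' in \<open>simp_all add: small_def\<close>)
  then have guarded: "hoare (guarded_update R c)
      (tick M + (if 4 ^ j dvd t + 1 then tick M + (?upd + (tick M + ?upd)) else 0)) \<rho>\<^sub>1 \<alpha>' ?Q"
    unfolding test by (rule hoare_mono) simp_all
  have 3: "hoare (Seq (guarded_update R c)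
      (Seq (assign 7 (Nm 2 \<otimes> Rg 7)) Skip))
      ((tick M + (if 4 ^ j dvd t + 1 then tick M + (?upd + (tick M + ?upd)) else 0)) + (tick M + tick M)) \<rho>\<^sub>1 \<alpha>'
      (\<lambda>\<rho>'' \<alpha>''. state_ok t (Suc j) \<rho>'' \<alpha>'' \<and> \<rho>'' 20 = t \<and> \<rho>'' 22 = N * N \<and> \<rho>'' 30 = j \<and>
       \<rho>'' 32 = Suc L \<and> \<rho>'' 7 = 2 ^ Suc j)"
  proof (rule hoare_Seq[OF guarded])
    fix \<rho>'' \<alpha>'' assume "?Q \<rho>'' \<alpha>''"
    then show "hoare (Seq (assign 7 (Nm 2 \<otimes> Rg 7)) Skip) (tick M + tick M) \<rho>'' \<alpha>''
      (\<lambda>\<rho>'' \<alpha>''. state_ok t (Suc j) \<rho>'' \<alpha>'' \<and> \<rho>'' 20 = t \<and> \<rho>'' 22 = N * N \<and> \<rho>'' 30 = j \<and>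
       \<rho>'' 32 = Suc L \<and> \<rho>'' 7 = 2 ^ Suc j)"
      using M' by (intro hoare_assign_tick hoare_Skip) (auto simp: small_def state_ok_def)
  qed
  show "hoare (level_prog R c) (tick M + (tick M +
      ((tick M + (if 4 ^ j dvd t + 1 then tick M + (?upd + (tick M + ?upd)) else 0)) + (tick M + tick M)))) \<rho>' \<alpha>'
      (\<lambda>\<rho>'' \<alpha>''. state_ok t (Suc j) \<rho>'' \<alpha>'' \<and> \<rho>'' 20 = t \<and> \<rho>'' 22 = N * N \<and> \<rho>'' 30 = j \<and>
       \<rho>'' 32 = Suc L \<and> \<rho>'' 7 = 2 ^ Suc j)"
    unfolding level_prog_def
  proof (rule hoare_assign_tick, goal_cases)
    case 5
    have uvM: "morton_fst t \<le> M" "morton_snd t \<le> M" using uv M'(2) by simp_all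
    show ?case
    proof (rule hoare_assign_tick, goal_cases)
      case 5
      have "\<rho>'(8 := val (Ar 11 (Rg 20) \<oslash> Rg 7) \<rho>' \<alpha>', 9 := val (Ar 12 (Rg 20) \<oslash> Rg 7)
          (\<rho>'(8 := val (Ar 11 (Rg 20) \<oslash> Rg 7) \<rho>' \<alpha>')) \<alpha>') = \<rho>\<^sub>1"
        using regs tab by (simp add: \<rho>\<^sub>1_def I_def J_def)
      then show ?case using 3 by simp
    qed (use M' uvM regs tab in \<open>simp_all add: small_def\<close>)
  qed (use M' uv regs tab in \<open>simp_all add: small_def\<close>)
  show "tick M + (tick M + ((tick M + (if 4 ^ j dvd t + 1 then tick M + (?upd + (tick M + ?upd)) else 0)) +
      (tick M + tick M))) \<le> (5 + (if 4 ^ j dvd t + 1 then level_cost j else 0)) * tick M"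
    by (simp add: level_cost_def pjj algebra_simps)
qed

lemma hoare_main:
  assumes init: "state_ok 0 0 \<rho> \<alpha>" and f: "f = entry N (\<alpha> 10)"
  shows "hoare (main_loop_prog R c)
    ((2 * R + 38) * (Suc L * level_time T L) * tick M) \<rho> \<alpha>
    (\<lambda>\<rho>' \<alpha>'. (\<forall>r. r \<notin> main_regs \<longrightarrow> \<rho>' r = \<rho> r) \<and> (\<forall>a<20. a \<noteq> 10 \<longrightarrow> \<alpha>' a = \<alpha> a) \<and>
      (\<forall>u<N. \<forall>v<N. \<alpha>' 10 (u * N + v) = of_bool (Z u v)))"
proof (rule hoare_mono)
  let ?lev = "\<lambda>t j. (5 + (if 4 ^ j dvd t + 1 then level_cost j else 0)) * tick M"
  let ?inner = "\<lambda>t. tick M + ((\<Sum>j<Suc L. ?lev t j) + (Suc L + 1) * tick M)"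
  let ?J = "\<lambda>t j (\<rho>' :: nat \<Rightarrow> nat) \<alpha>'. state_ok t j \<rho>' \<alpha>' \<and> \<rho>' 20 = t \<and> \<rho>' 22 = N * N \<and> \<rho>' 7 = 2 ^ j"
  have M': "2 \<le> M" "N \<le> M" "N * N \<le> M" "Suc L \<le> M" "L \<le> M" using M by linarith+
  show "hoare (main_loop_prog R c)
    ((\<Sum>t<N * N. ?inner t) + (N * N + 1) * tick M) \<rho> \<alpha>
    (\<lambda>\<rho>' \<alpha>'. state_ok (N * N) 0 \<rho>' \<alpha>' \<and> \<rho>' 20 = N * N \<and> \<rho>' (20 + 1) = 0 \<and> \<rho>' (20 + 2) = N * N)"
  proof (rule hoare_loop_tick[where I = "\<lambda>t. state_ok t 0"])
    show "state_ok 0 0 (\<rho>(20 + 2 := N * N, 20 := 0, 20 + 1 := N * N)) \<alpha>"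
      using init by (auto simp: state_ok_def)
    fix t \<rho>' \<alpha>' assume t: "t < N * N" and ok: "state_ok t 0 \<rho>' \<alpha>'"
      and regs: "\<rho>' 20 = t" "\<rho>' (20 + 1) = N * N - t" "\<rho>' (20 + 2) = N * N"
    have \<rho>': "\<rho>' 2 = N" "\<rho>' 3 = L" using ok \<rho> by (simp_all add: state_ok_def)
    have inner: "hoare (loop 30 (Rg 3 \<oplus> Nm 1) (level_prog R c)) ((\<Sum>j<Suc L. ?lev t j) + (Suc L + 1) * tick M)
       (\<rho>'(7 := 1)) \<alpha>' (\<lambda>\<rho>'' \<alpha>''. ?J t (Suc L) \<rho>'' \<alpha>'' \<and> \<rho>'' 30 = Suc L \<and> \<rho>'' (30 + 1) = 0 \<and> \<rho>'' (30 + 2) = Suc L)"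
    proof (rule hoare_loop_tick[where I = "?J t"])
      show "?J t 0 ((\<rho>'(7 := 1))(30 + 2 := Suc L, 30 := 0, 30 + 1 := Suc L)) \<alpha>'"
        using ok regs by (auto simp: state_ok_def)
      fix j \<rho>'' \<alpha>'' assume j: "j < Suc L" and J: "?J t j \<rho>'' \<alpha>''"
        and regs': "\<rho>'' 30 = j" "\<rho>'' (30 + 1) = Suc L - j" "\<rho>'' (30 + 2) = Suc L"
      have "hoare (level_prog R c) (?lev t j) \<rho>'' \<alpha>''
        (\<lambda>\<rho>'' \<alpha>''. state_ok t (Suc j) \<rho>'' \<alpha>'' \<and> \<rho>'' 20 = t \<and> \<rho>'' 22 = N * N \<and> \<rho>'' 30 = j \<and>
         \<rho>'' 32 = Suc L \<and> \<rho>'' 7 = 2 ^ Suc j)"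
        using J regs' by (intro hoare_level[OF t j]) simp_all
      then show "hoare (level_prog R c) (?lev t j) \<rho>'' \<alpha>'' (\<lambda>\<rho>'' \<alpha>''. \<rho>'' 30 = j \<and> \<rho>'' (30 + 2) = Suc L \<and>
          ?J t (Suc j) (\<rho>''(30 := Suc j, 30 + 1 := Suc L - Suc j)) \<alpha>'')"
        by (rule hoare_mono[OF _ order_refl]) (auto simp: state_ok_def)
    qed (use M' \<rho>' in \<open>simp_all add: small_def\<close>)
    have "hoare (levels_prog R c) (?inner t) \<rho>' \<alpha>'
      (\<lambda>\<rho>'' \<alpha>''. ?J t (Suc L) \<rho>'' \<alpha>'' \<and> \<rho>'' 30 = Suc L \<and> \<rho>'' (30 + 1) = 0 \<and> \<rho>'' (30 + 2) = Suc L)"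
      using M' inner by (intro hoare_assign_tick) (simp_all add: small_def)
    then show "hoare (levels_prog R c) (?inner t) \<rho>' \<alpha>'
      (\<lambda>\<rho>'' \<alpha>''. \<rho>'' 20 = t \<and> \<rho>'' (20 + 2) = N * N \<and>
        state_ok (Suc t) 0 (\<rho>''(20 := Suc t, 20 + 1 := N * N - Suc t)) \<alpha>'')"
    proof (rule hoare_mono[OF _ order_refl])
      fix \<rho>'' \<alpha>''
      assume J: "?J t (Suc L) \<rho>'' \<alpha>'' \<and> \<rho>'' 30 = Suc L \<and> \<rho>'' (30 + 1) = 0 \<and> \<rho>'' (30 + 2) = Suc L"
      then have "invariant (Suc t) 0 (entry N (\<alpha>'' 10))"
        using t NN by (intro invariant_next) (simp_all add: state_ok_def)
      moreover have "2 * (t * (L + 1) + Suc L) = 2 * (Suc t * (L + 1) + 0)" by simp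
      ultimately show "\<rho>'' 20 = t \<and> \<rho>'' (20 + 2) = N * N \<and>
        state_ok (Suc t) 0 (\<rho>''(20 := Suc t, 20 + 1 := N * N - Suc t)) \<alpha>''"
        using J unfolding state_ok_def by (simp add: algebra_simps)
    qed
  qed (use M' \<rho> in \<open>simp_all add: small_def\<close>)
  show "(\<Sum>t<N * N. ?inner t) + (N * N + 1) * tick M \<le> (2 * R + 38) * (Suc L * level_time T L) * tick M"
  proof -
    define S where "S = (\<Sum>j<Suc L. 4 ^ (L - j) * T (2 ^ j))"
    define X where "X = (4::nat) ^ L"
    define D where "D = (\<Sum>j<Suc L. 4 ^ (L - j) * level_cost j)"
    have "(\<Sum>t<N * N. ?inner t) =
        (\<Sum>t<N * N. (6 * L + 8 + (\<Sum>j<Suc L. if 4 ^ j dvd t + 1 then level_cost j else 0)) * tick M)"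
      by (intro sum.cong refl)
        (simp add: sum_distrib_right[symmetric] sum.distrib distrib_right del: sum.lessThan_Suc)
    also have "\<dots> = (X * (6 * L + 8) + D) * tick M"
      unfolding D_def X_def
      by (simp only: sum_distrib_right[symmetric] sum.distrib NN sum_level_costs) (simp add: distrib_left)
    finally have total: "(\<Sum>t<N * N. ?inner t) + (N * N + 1) * tick M = (X * (6 * L + 8) + D + (X + 1)) * tick M"
      unfolding NN X_def[symmetric] by (simp add: distrib_right)
    have "D \<le> (\<Sum>j<Suc L. (2 * R + 18) * X + (2 * R + 16) * (4 ^ (L - j) * T (2 ^ j)))"
      unfolding D_def
    proof (rule sum_mono)
      fix j assume "j \<in> {..<Suc L}"
      \<comment> \<open>The blocks of one level together have as many cells as the matrix, so
        copying costs the same on every level.\<close>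
      then have "4 ^ (L - j) * 4 ^ j = X" by (simp add: X_def power_add[symmetric])
      moreover have "(4::nat) ^ (L - j) \<le> X" unfolding X_def by (intro power_increasing) auto
      moreover have "4 ^ (L - j) * level_cost j = 2 * 4 ^ (L - j) + (2 * R + 16) * (4 ^ (L - j) * 4 ^ j) +
          (2 * R + 16) * (4 ^ (L - j) * T (2 ^ j))"
        by (simp add: level_cost_def algebra_simps)
      ultimately show "4 ^ (L - j) * level_cost j \<le>
          (2 * R + 18) * X + (2 * R + 16) * (4 ^ (L - j) * T (2 ^ j))"
        by (simp add: algebra_simps)
    qed
    also have "\<dots> = (2 * R + 18) * (Suc L * X) + (2 * R + 16) * S"
      unfolding S_def by (simp only: sum.distrib sum_distrib_left[symmetric]) simp
    finally have D: "D \<le> (2 * R + 18) * (Suc L * X) + (2 * R + 16) * S" .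
    have "1 \<le> X" by (simp add: X_def)
    then have "X * (6 * L + 8) + ((2 * R + 18) * (Suc L * X) + (2 * R + 16) * S) + (X + 1) \<le>
        (2 * R + 38) * (Suc L * (X + S))"
      by (simp add: algebra_simps)
    with D have "X * (6 * L + 8) + D + (X + 1) \<le> (2 * R + 38) * (Suc L * (X + S))" by linarith
    then show ?thesis
      unfolding total level_time_def S_def[symmetric] X_def[symmetric] by (rule mult_le_mono1)
  qed
  fix \<rho>' \<alpha>' assume *: "state_ok (N * N) 0 \<rho>' \<alpha>' \<and> \<rho>' 20 = N * N \<and> \<rho>' (20 + 1) = 0 \<and> \<rho>' (20 + 2) = N * N"
  then have inv: "invariant (4 ^ L) 0 (entry N (\<alpha>' 10))" and bits: "\<And>z. \<alpha>' 10 z \<le> 1"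
    by (auto simp: state_ok_def NN bit_arrays_def)
  have "\<alpha>' 10 (u * N + v) = of_bool (Z u v)" if "u < N" "v < N" for u v
    using invariant_final[OF inv that] bits[of "u * N + v"] that by (auto simp: entry_def le_Suc_eq)
  with * show "(\<forall>r. r \<notin> main_regs \<longrightarrow> \<rho>' r = \<rho> r) \<and> (\<forall>a<20. a \<noteq> 10 \<longrightarrow> \<alpha>' a = \<alpha> a) \<and>
      (\<forall>u<N. \<forall>v<N. \<alpha>' 10 (u * N + v) = of_bool (Z u v))"
    by (auto simp: state_ok_def)
qed

end

section \<open>The complete programs\<close>

abbreviation old_index_ex :: ex where
  "old_index_ex \<equiv> Ar 7 (Rg 20 \<oslash> Rg 2) \<otimes> Rg 2 \<oplus> Ar 7 (Rg 20 \<odot> Rg 2)"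

abbreviation morton_fst_ex :: ex where
  "morton_fst_ex \<equiv> Nm 2 \<otimes> Ar 11 (Rg 20 \<oslash> Nm 4) \<oplus> Rg 20 \<oslash> Nm 2 \<odot> Nm 2"

abbreviation morton_snd_ex :: ex where
  "morton_snd_ex \<equiv> Nm 2 \<otimes> Ar 12 (Rg 20 \<oslash> Nm 4) \<oplus> Rg 20 \<odot> Nm 2"

text \<open>The first two tables permute adjacency and final configurations into topological order.
  The other two decode Morton codes by the recurrence through \<open>t div 4\<close>, whose entry is
  already in the table.\<close>

definition relabel_prog :: com where
  "relabel_prog =
     Seq (fill 20 (Rg 2 \<otimes> Rg 2) 9 (Rg 20) (Ar 2 old_index_ex))
    (Seq (fill 20 (Rg 2 \<otimes> Rg 2) 10 (Rg 20) (Ar 3 old_index_ex))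
    (Seq (fill 20 (Rg 2 \<otimes> Rg 2) 11 (Rg 20) morton_fst_ex)
    (fill 20 (Rg 2 \<otimes> Rg 2) 12 (Rg 20) morton_snd_ex)))"

lemma morton_fst_rec: "morton_fst t = 2 * morton_fst (t div 4) + t div 2 mod 2"
  by (cases "t = 0") (simp, subst morton_fst.simps, simp)

lemma morton_snd_rec: "morton_snd t = 2 * morton_snd (t div 4) + t mod 2"
  by (cases "t = 0") (simp, subst morton_snd.simps, simp)

lemma hoare_relabel:
  assumes N: "\<rho> 2 = N" "N = 2 ^ L" and M: "N * N + N + 10 \<le> M"
    and A: "\<And>u w. u < N \<Longrightarrow> w < N \<Longrightarrow> \<alpha> 2 (u * N + w) = of_bool (A u w)"
    and F: "\<And>u w. u < N \<Longrightarrow> w < N \<Longrightarrow> \<alpha> 3 (u * N + w) = of_bool (F u w)"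
    and ord: "\<And>i. i < N \<Longrightarrow> \<alpha> 7 i < N"
    and zero: "\<alpha> 11 0 = 0" "\<alpha> 12 0 = 0"
  shows "hoare relabel_prog (4 * ((N * N + 1) * tick M)) \<rho> \<alpha> (\<lambda>\<rho>' \<alpha>'.
    (\<forall>r. r \<notin> {20, 21, 22} \<longrightarrow> \<rho>' r = \<rho> r) \<and> (\<forall>a. a \<notin> {9, 10, 11, 12} \<longrightarrow> \<alpha>' a = \<alpha> a) \<and>
    \<alpha>' 9 = (\<lambda>k. if k < N * N then of_bool (A (\<alpha> 7 (k div N)) (\<alpha> 7 (k mod N))) else \<alpha> 9 k) \<and>
    \<alpha>' 10 = (\<lambda>k. if k < N * N then of_bool (F (\<alpha> 7 (k div N)) (\<alpha> 7 (k mod N))) else \<alpha> 10 k) \<and>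
    (\<forall>t<N * N. \<alpha>' 11 t = morton_fst t \<and> \<alpha>' 12 t = morton_snd t))"
proof (rule hoare_mono)
  let ?\<rho> = "\<rho>(20 := N * N, 20 + 1 := 0, 20 + 2 := N * N)"
  define g9 :: "nat \<Rightarrow> nat" where "g9 k = of_bool (A (\<alpha> 7 (k div N)) (\<alpha> 7 (k mod N)))" for k
  define g10 :: "nat \<Rightarrow> nat" where "g10 k = of_bool (F (\<alpha> 7 (k div N)) (\<alpha> 7 (k mod N)))" for k
  define \<alpha>\<^sub>1 where "\<alpha>\<^sub>1 = \<alpha>(9 := \<lambda>x. if x < N * N then g9 x else \<alpha> 9 x)"
  define \<alpha>\<^sub>2 where "\<alpha>\<^sub>2 = \<alpha>\<^sub>1(10 := \<lambda>x. if x < N * N then g10 x else \<alpha>\<^sub>1 10 x)"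
  define \<alpha>\<^sub>3 where "\<alpha>\<^sub>3 = \<alpha>\<^sub>2(11 := \<lambda>x. if x < N * N then morton_fst x else \<alpha>\<^sub>2 11 x)"
  define \<alpha>\<^sub>4 where "\<alpha>\<^sub>4 = \<alpha>\<^sub>3(12 := \<lambda>x. if x < N * N then morton_snd x else \<alpha>\<^sub>3 12 x)"
  let ?Q = "\<lambda>\<rho>' \<alpha>'. \<rho>' = ?\<rho> \<and> \<alpha>' = \<alpha>\<^sub>4"
  have M': "2 \<le> M" "4 \<le> M" "N * N \<le> M" "N \<le> M" using M by simp_all
  have NN: "N * N = 4 ^ L" unfolding N(2) by (simp add: power_mult_distrib[symmetric])
  have kM: "k \<le> M" if "k < N * N" for k using that M'(3) by simp
  have ordM: "\<alpha> 7 (k div N) \<le> M" "\<alpha> 7 (k mod N) \<le> M"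
      "\<alpha> 2 (\<alpha> 7 (k div N) * N + \<alpha> 7 (k mod N)) = g9 k" "\<alpha> 3 (\<alpha> 7 (k div N) * N + \<alpha> 7 (k mod N)) = g10 k"
      "g9 k \<le> M" "g10 k \<le> M"
    if "k < N * N" for k
  proof -
    have *: "\<alpha> 7 (k div N) < N" "\<alpha> 7 (k mod N) < N" using ord index_bounds[OF that] by simp_all
    then show "\<alpha> 7 (k div N) \<le> M" "\<alpha> 7 (k mod N) \<le> M" using M' by simp_all
    show "\<alpha> 2 (\<alpha> 7 (k div N) * N + \<alpha> 7 (k mod N)) = g9 k" "\<alpha> 3 (\<alpha> 7 (k div N) * N + \<alpha> 7 (k mod N)) = g10 k"
      using A F * by (simp_all add: g9_def g10_def)
    show "g9 k \<le> M" "g10 k \<le> M" using M' by (simp_all add: g9_def g10_def)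
  qed
  have mortonM: "morton_fst k \<le> M" "morton_snd k \<le> M" if "k < N * N" for k
    using morton_fst_less[of k L] morton_snd_less[of k L] that M' NN N by simp_all
  have 4: "hoare (fill 20 (Rg 2 \<otimes> Rg 2) 12 (Rg 20) morton_snd_ex)
     ((N * N + 1) * tick M) ?\<rho> \<alpha>\<^sub>3 ?Q"
  proof (rule hoare_table_tick[where g = morton_snd])
    fix k assume k: "k < N * N"
    let ?e = "morton_snd_ex"
    have "\<alpha>\<^sub>3 12 0 = 0" using zero by (simp add: \<alpha>\<^sub>3_def \<alpha>\<^sub>2_def \<alpha>\<^sub>1_def)
    then show "let \<rho>' = ?\<rho>(20 := k, 20 + 1 := N * N - k, 20 + 2 := N * N);
        \<alpha>' = \<alpha>\<^sub>3(12 := \<lambda>x. if x < k then morton_snd x else \<alpha>\<^sub>3 12 x)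
      in bounded M ?e \<rho>' \<alpha>' \<and> val ?e \<rho>' \<alpha>' = morton_snd k"
      using k kM[OF k] M' mortonM[of "k div 4"] morton_snd_rec[of k] by (cases "k = 0") (simp_all add: Let_def)
  qed (use N M' in \<open>simp_all add: small_def \<alpha>\<^sub>4_def fun_eq_iff\<close>)
  have 3: "hoare (Seq (fill 20 (Rg 2 \<otimes> Rg 2) 11 (Rg 20) morton_fst_ex)
    (fill 20 (Rg 2 \<otimes> Rg 2) 12 (Rg 20) morton_snd_ex))
     ((N * N + 1) * tick M + (N * N + 1) * tick M) ?\<rho> \<alpha>\<^sub>2 ?Q"
  proof (rule hoare_table_Seq_tick[where g = morton_fst])
    fix k assume k: "k < N * N"
    let ?e = "morton_fst_ex"
    have "\<alpha>\<^sub>2 11 0 = 0" using zero by (simp add: \<alpha>\<^sub>2_def \<alpha>\<^sub>1_def)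
    then show "let \<rho>' = ?\<rho>(20 := k, 20 + 1 := N * N - k, 20 + 2 := N * N);
        \<alpha>' = \<alpha>\<^sub>2(11 := \<lambda>x. if x < k then morton_fst x else \<alpha>\<^sub>2 11 x)
      in bounded M ?e \<rho>' \<alpha>' \<and> val ?e \<rho>' \<alpha>' = morton_fst k"
      using k kM[OF k] M' mortonM[of "k div 4"] morton_fst_rec[of k] by (cases "k = 0") (simp_all add: Let_def)
  qed (use N M' 4 in \<open>simp_all add: small_def \<alpha>\<^sub>3_def\<close>)
  have 2: "hoare (Seq (fill 20 (Rg 2 \<otimes> Rg 2) 10 (Rg 20) (Ar 3 old_index_ex))
    (Seq (fill 20 (Rg 2 \<otimes> Rg 2) 11 (Rg 20) morton_fst_ex)
    (fill 20 (Rg 2 \<otimes> Rg 2) 12 (Rg 20) morton_snd_ex)))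
     ((N * N + 1) * tick M + ((N * N + 1) * tick M + (N * N + 1) * tick M)) ?\<rho> \<alpha>\<^sub>1 ?Q"
  proof (rule hoare_table_Seq_tick[where g = g10])
    fix k assume k: "k < N * N"
    let ?e = "Ar 3 old_index_ex"
    show "let \<rho>' = ?\<rho>(20 := k, 20 + 1 := N * N - k, 20 + 2 := N * N);
        \<alpha>' = \<alpha>\<^sub>1(10 := \<lambda>x. if x < k then g10 x else \<alpha>\<^sub>1 10 x)
      in bounded M ?e \<rho>' \<alpha>' \<and> val ?e \<rho>' \<alpha>' = g10 k"
      using kM[OF k] M' ordM[OF k] N(1) by (simp add: Let_def \<alpha>\<^sub>1_def)
  qed (use N M' 3 in \<open>simp_all add: small_def \<alpha>\<^sub>2_def\<close>)
  show "hoare relabel_prog ((N * N + 1) * tick M + ((N * N + 1) * tick M + ((N * N + 1) * tick M +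
     (N * N + 1) * tick M))) \<rho> \<alpha> ?Q"
    unfolding relabel_prog_def
  proof (rule hoare_table_Seq_tick[where g = g9])
    fix k assume k: "k < N * N"
    let ?e = "Ar 2 old_index_ex"
    show "let \<rho>' = \<rho>(20 := k, 20 + 1 := N * N - k, 20 + 2 := N * N);
        \<alpha>' = \<alpha>(9 := \<lambda>x. if x < k then g9 x else \<alpha> 9 x)
      in bounded M ?e \<rho>' \<alpha>' \<and> val ?e \<rho>' \<alpha>' = g9 k"
      using kM[OF k] M' ordM[OF k] N(1) by (simp add: Let_def)
  qed (use N M' 2 in \<open>simp_all add: small_def \<alpha>\<^sub>1_def\<close>)
  fix \<rho>' \<alpha>' assume "?Q \<rho>' \<alpha>'"
  then show "(\<forall>r. r \<notin> {20, 21, 22} \<longrightarrow> \<rho>' r = \<rho> r) \<and> (\<forall>a. a \<notin> {9, 10, 11, 12} \<longrightarrow> \<alpha>' a = \<alpha> a) \<and>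
    \<alpha>' 9 = (\<lambda>k. if k < N * N then of_bool (A (\<alpha> 7 (k div N)) (\<alpha> 7 (k mod N))) else \<alpha> 9 k) \<and>
    \<alpha>' 10 = (\<lambda>k. if k < N * N then of_bool (F (\<alpha> 7 (k div N)) (\<alpha> 7 (k mod N))) else \<alpha> 10 k) \<and>
    (\<forall>t<N * N. \<alpha>' 11 t = morton_fst t \<and> \<alpha>' 12 t = morton_snd t)"
    by (simp add: \<alpha>\<^sub>4_def \<alpha>\<^sub>3_def \<alpha>\<^sub>2_def \<alpha>\<^sub>1_def g9_def g10_def cong: if_cong)
qed simp

definition core_prog :: "nat \<Rightarrow> com \<Rightarrow> com" where
  "core_prog R c = Seq topo_prog (Seq relabel_prog (main_prog R c))"

text \<open>The postcondition speaks of the original vertices only: array 8 translates them into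
  topological positions, and the existential \<open>z\<close> is \<open>negamax\<close> pulled back
  along this translation. The cubic bound on \<open>M\<close> is what the numbers of the calls
  require.\<close>

lemma hoare_core:
  assumes c: "\<And>s. 1 \<le> s \<Longrightarrow> multiplies c s (T s)" "regs_below R c"
    and N: "N = 2 ^ L" "\<rho> 2 = N" "\<rho> 3 = L"
    and M: "2 * (N * N * N) + 3 * (N * N) + 10 \<le> M"
    and A: "\<And>u w. u < N \<Longrightarrow> w < N \<Longrightarrow> \<alpha> 2 (u * N + w) = of_bool (A u w)"
    and F: "\<And>u w. u < N \<Longrightarrow> w < N \<Longrightarrow> \<alpha> 3 (u * N + w) = of_bool (F u w)"
    and acyc: "acyclic {(u, w). u < N \<and> w < N \<and> A u w}"
    and zero: "\<And>a. 4 \<le> a \<Longrightarrow> a \<noteq> 13 \<Longrightarrow> \<alpha> a = (\<lambda>_. 0)"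
  shows "hoare (core_prog R c) ((2 * R + 62) * (Suc L * level_time T L) * tick M) \<rho> \<alpha> (\<lambda>\<rho>' \<alpha>'.
    \<rho>' 1 = \<rho> 1 \<and> \<rho>' 2 = N \<and> \<alpha>' 0 = \<alpha> 0 \<and> \<alpha>' 1 = \<alpha> 1 \<and>
    (\<exists>z. (\<forall>u<N. \<forall>w<N. z u w \<longleftrightarrow> F u w \<or> (\<exists>u'<N. A u u' \<and> \<not> z w u')) \<and>
      (\<forall>u<N. \<alpha>' 8 u < N) \<and>
      (\<forall>u<N. \<forall>w<N. \<alpha>' 10 (\<alpha>' 8 u * N + \<alpha>' 8 w) = of_bool (z u w))))"
    (is "hoare _ _ _ _ ?Q")
proof (rule hoare_mono)
  have N1: "1 \<le> N" and LN: "L < N" and NN4: "N * N = 4 ^ L"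
    unfolding N(1) by (simp_all add: less_exp power_mult_distrib[symmetric])
  have NNle: "N \<le> N * N" "1 \<le> N * N" using N1 by simp_all
  define m where "m = 2 * (L + 1) * (N * N)"
  have mM: "m \<le> M"
  proof -
    \<comment> \<open>From \<open>L < 2^L\<close> the modulus is at most
      \<open>2 * N^3\<close>.\<close>
    have "(L + 1) * (N * N) \<le> N * (N * N)" using LN by (intro mult_le_mono1) simp
    then show ?thesis using M unfolding m_def by (simp add: algebra_simps)
  qed
  have M': "2 \<le> M" "N * N + 2 * N + 2 \<le> M" "N * N + N + 10 \<le> M" "N * N + N + 2 \<le> M" "L + 1 \<le> M" "N \<le> M"
    using M NNle LN by linarith+
  show "hoare (core_prog R c) (15 * (N * N) * tick M + (4 * ((N * N + 1) * tick M) +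
    (tick M + (2 * R + 38) * (Suc L * level_time T L) * tick M))) \<rho> \<alpha> ?Q"
    unfolding core_prog_def
  proof (rule hoare_Seq)
    show "hoare topo_prog (15 * (N * N) * tick M) \<rho> \<alpha> (\<lambda>\<rho>' \<alpha>'.
       (\<forall>r. r \<notin> {4, 20, 21, 22, 30, 31, 32} \<longrightarrow> \<rho>' r = \<rho> r) \<and>
       (\<forall>a. a \<notin> {4, 5, 6, 7, 8} \<longrightarrow> \<alpha>' a = \<alpha> a) \<and> topo_sorted N A (\<alpha>' 7) (\<alpha>' 8))"
      using N1 N M' A acyc zero by (intro hoare_topo) simp_all
  next
    fix \<rho>\<^sub>1 \<alpha>\<^sub>1
    assume 1: "(\<forall>r. r \<notin> {4, 20, 21, 22, 30, 31, 32} \<longrightarrow> \<rho>\<^sub>1 r = \<rho> r) \<and>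
       (\<forall>a. a \<notin> {4, 5, 6, 7, 8} \<longrightarrow> \<alpha>\<^sub>1 a = \<alpha> a) \<and> topo_sorted N A (\<alpha>\<^sub>1 7) (\<alpha>\<^sub>1 8)"
    define ord where "ord = \<alpha>\<^sub>1 7"
    define pos where "pos = \<alpha>\<^sub>1 8"
    have bij: "bij_betw ord {..<N} {..<N}" and pos_ord: "\<And>i. i < N \<Longrightarrow> pos (ord i) = i"
      and sorted: "\<And>i j. i < N \<Longrightarrow> j < N \<Longrightarrow> A (ord i) (ord j) \<Longrightarrow> j < i"
      using 1 by (auto simp: topo_sorted_def ord_def pos_def)
    have ordN: "ord i < N" if "i < N" for i using bij that by (auto simp: bij_betw_def)
    have ex_ord: "\<exists>i<N. u = ord i" if "u < N" for u using bij_betw_imp_surj_on[OF bij] that by (metis imageE lessThan_iff)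
    have posN: "pos u < N" and ord_pos: "ord (pos u) = u" if "u < N" for u
      using ex_ord[OF that] pos_ord by auto
    let ?g9 = "\<lambda>k. if k < N * N then of_bool (A (ord (k div N)) (ord (k mod N))) else \<alpha>\<^sub>1 9 k"
    let ?g10 = "\<lambda>k. if k < N * N then of_bool (F (ord (k div N)) (ord (k mod N))) else \<alpha>\<^sub>1 10 k"
    have "hoare relabel_prog (4 * ((N * N + 1) * tick M)) \<rho>\<^sub>1 \<alpha>\<^sub>1 (\<lambda>\<rho>' \<alpha>'.
      (\<forall>r. r \<notin> {20, 21, 22} \<longrightarrow> \<rho>' r = \<rho>\<^sub>1 r) \<and> (\<forall>a. a \<notin> {9, 10, 11, 12} \<longrightarrow> \<alpha>' a = \<alpha>\<^sub>1 a) \<and>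
      \<alpha>' 9 = ?g9 \<and> \<alpha>' 10 = ?g10 \<and> (\<forall>t<N * N. \<alpha>' 11 t = morton_fst t \<and> \<alpha>' 12 t = morton_snd t))"
      unfolding ord_def
      using 1 N M' A F zero ordN by (intro hoare_relabel[where L = L]) (simp_all add: ord_def)
    then show "hoare (Seq relabel_prog (main_prog R c)) (4 * ((N * N + 1) * tick M) +
      (tick M + (2 * R + 38) * (Suc L * level_time T L) * tick M)) \<rho>\<^sub>1 \<alpha>\<^sub>1 ?Q"
    proof (rule hoare_Seq)
      fix \<rho>\<^sub>2 \<alpha>\<^sub>2
      assume 2: "(\<forall>r. r \<notin> {20, 21, 22} \<longrightarrow> \<rho>\<^sub>2 r = \<rho>\<^sub>1 r) \<and> (\<forall>a. a \<notin> {9, 10, 11, 12} \<longrightarrow> \<alpha>\<^sub>2 a = \<alpha>\<^sub>1 a) \<and>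
        \<alpha>\<^sub>2 9 = ?g9 \<and> \<alpha>\<^sub>2 10 = ?g10 \<and> (\<forall>t<N * N. \<alpha>\<^sub>2 11 t = morton_fst t \<and> \<alpha>\<^sub>2 12 t = morton_snd t)"
      define \<rho>\<^sub>3 where "\<rho>\<^sub>3 = \<rho>\<^sub>2(6 := m)"
      define E where "E = entry N (\<alpha>\<^sub>2 9)"
      define f where "f = entry N (\<alpha>\<^sub>2 10)"
      have \<alpha>\<^sub>1z: "\<alpha>\<^sub>1 9 = (\<lambda>_. 0)" "\<alpha>\<^sub>1 10 = (\<lambda>_. 0)" using 1 zero by simp_all
      have \<rho>\<^sub>2: "\<rho>\<^sub>2 1 = \<rho> 1" "\<rho>\<^sub>2 2 = N" "\<rho>\<^sub>2 3 = L" using 1 2 N by simp_all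
      have E_iff: "E p q \<longleftrightarrow> p < N \<and> q < N \<and> A (ord p) (ord q)" for p q
      proof (cases "p < N \<and> q < N")
        case True
        then show ?thesis using index_div_mod[of q N p] index_less[of p N q] 2 by (simp add: E_def entry_def)
      next
        case False
        show ?thesis
        proof (cases "q < N")
          case True
          \<comment> \<open>Rows beyond the matrix: the table was not written there and still holds
            its initial zeros.\<close>
          then have "N * N \<le> p * N + q" using False by (simp add: trans_le_add1)
          then have "\<not> E p q" using 2 \<alpha>\<^sub>1z by (simp add: E_def entry_def)
          then show ?thesis using False by blast
        qed (simp add: E_def entry_def)
      qed
      have f_iff: "f p q \<longleftrightarrow> F (ord p) (ord q)" if "p < N" "q < N" for p q
        using index_div_mod[of q N p] index_less[of p N q] 2 that by (simp add: f_def entry_def)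
      have \<rho>\<^sub>3: "\<rho>\<^sub>3 2 = N" "\<rho>\<^sub>3 3 = L" "\<rho>\<^sub>3 6 = m" using \<rho>\<^sub>2 by (simp_all add: \<rho>\<^sub>3_def)
      interpret main_loop L N E f R c T M m \<rho>\<^sub>3 \<alpha>\<^sub>2
        by unfold_locales (use N E_iff sorted c m_def M' mM \<rho>\<^sub>3 2 in \<open>simp_all add: E_def\<close>)
      have "bit_arrays N \<alpha>\<^sub>2" using 2 \<alpha>\<^sub>1z by (simp add: bit_arrays_def)
      moreover have "fresh_from m 0 \<alpha>\<^sub>2" using 1 2 zero by (simp add: fresh_from_def)
      moreover have "invariant 0 0 (entry N (\<alpha>\<^sub>2 10))" by (rule invariant_init) (simp add: f_def)
      ultimately have ok: "state_ok 0 0 \<rho>\<^sub>3 \<alpha>\<^sub>2" by (simp add: state_ok_def)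
      have "hoare (main_loop_prog R c)
        ((2 * R + 38) * (Suc L * level_time T L) * tick M) \<rho>\<^sub>3 \<alpha>\<^sub>2 ?Q"
      proof (rule hoare_mono[OF hoare_main[OF ok f_def] order_refl])
        fix \<rho>' \<alpha>'
        assume 3: "(\<forall>r. r \<notin> main_regs \<longrightarrow> \<rho>' r = \<rho>\<^sub>3 r) \<and> (\<forall>a<20. a \<noteq> 10 \<longrightarrow> \<alpha>' a = \<alpha>\<^sub>2 a) \<and>
          (\<forall>u<N. \<forall>v<N. \<alpha>' 10 (u * N + v) = of_bool (Z u v))"
        define z where "z u w = Z (pos u) (pos w)" for u w
        have \<alpha>'8: "\<alpha>' 8 = pos" using 3 2 by (simp add: pos_def)
        have "z u w \<longleftrightarrow> F u w \<or> (\<exists>u'<N. A u u' \<and> \<not> z w u')" if uw: "u < N" "w < N" for u w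
        proof -
          have "z u w \<longleftrightarrow> f (pos u) (pos w) \<or> (\<exists>k<pos u. E (pos u) k \<and> \<not> Z (pos w) k)"
            unfolding z_def by (rule negamax.simps)
          also have "(\<exists>k<pos u. E (pos u) k \<and> \<not> Z (pos w) k) \<longleftrightarrow> (\<exists>u'<N. A u u' \<and> \<not> z w u')"
          proof
            assume "\<exists>k<pos u. E (pos u) k \<and> \<not> Z (pos w) k"
            then obtain k where "E (pos u) k" "\<not> Z (pos w) k" by blast
            then have "ord k < N \<and> A u (ord k) \<and> \<not> z w (ord k)"
              using ordN ord_pos uw pos_ord unfolding E_iff z_def by auto
            then show "\<exists>u'<N. A u u' \<and> \<not> z w u'" by blast
          next
            assume "\<exists>u'<N. A u u' \<and> \<not> z w u'"
            then obtain u' where u': "u' < N" "A u u'" "\<not> z w u'" by blast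
            then have "E (pos u) (pos u')" using posN ord_pos uw by (simp add: E_iff)
            then show "\<exists>k<pos u. E (pos u) k \<and> \<not> Z (pos w) k" using u' E z_def by blast
          qed
          finally show ?thesis using f_iff posN ord_pos uw by simp
        qed
        moreover have "\<rho>' 1 = \<rho> 1" "\<rho>' 2 = N" "\<alpha>' 0 = \<alpha> 0" "\<alpha>' 1 = \<alpha> 1"
          using 1 2 3 \<rho>\<^sub>2 by (simp_all add: \<rho>\<^sub>3_def)
        moreover have "\<forall>u<N. \<alpha>' 8 u < N"
          "\<forall>u<N. \<forall>w<N. \<alpha>' 10 (\<alpha>' 8 u * N + \<alpha>' 8 w) = of_bool (z u w)"
          using 3 posN by (simp_all add: \<alpha>'8 z_def)
        ultimately show "?Q \<rho>' \<alpha>'" by blast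
      qed
      moreover have "Suc (N * N) \<le> M" "N * N \<le> M" using M' by linarith+
      ultimately show "hoare (main_prog R c) (tick M + (2 * R + 38) * (Suc L * level_time T L) * tick M) \<rho>\<^sub>2 \<alpha>\<^sub>2 ?Q"
        unfolding main_prog_def using M' \<rho>\<^sub>2
        by (intro hoare_assign_tick) (simp_all add: small_def \<rho>\<^sub>3_def m_def)
    qed
  qed
  have "N * N \<le> level_time T L" by (simp add: level_time_def NN4)
  then have X: "N * N \<le> Suc L * level_time T L" by (simp add: trans_le_add1)
  define X where "X = Suc L * level_time T L"
  have "15 * Y + (4 * (Y + 1) + 1) + (2 * R + 38) * X \<le> (2 * R + 62) * X" if "1 \<le> Y" "Y \<le> X" for Y
    using that by (simp add: algebra_simps)
  from this[OF NNle(2)] X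
  have "15 * (N * N) + (4 * (N * N + 1) + 1) + (2 * R + 38) * X \<le> (2 * R + 62) * X"
    unfolding X_def[symmetric] by blast
  then have "(15 * (N * N) + (4 * (N * N + 1) + 1) + (2 * R + 38) * X) * tick M \<le> (2 * R + 62) * X * tick M"
    by (rule mult_le_mono1)
  then show "15 * (N * N) * tick M + (4 * ((N * N + 1) * tick M) +
    (tick M + (2 * R + 38) * (Suc L * level_time T L) * tick M)) \<le> (2 * R + 62) * (Suc L * level_time T L) * tick M"
    unfolding X_def[symmetric] by (simp add: distrib_right)
qed simp

section \<open>The disjoint union of the two graphs\<close>

definition union_adj :: "nat \<Rightarrow> nat rel \<Rightarrow> nat rel \<Rightarrow> nat \<Rightarrow> nat \<Rightarrow> bool" where
  "union_adj n R0 R1 u w \<longleftrightarrow> u < n \<and> w < n \<and> (u, w) \<in> R0 \<or>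
     n \<le> u \<and> u < 2 * n \<and> n \<le> w \<and> w < 2 * n \<and> (u - n, w - n) \<in> R1"

text \<open>The final configurations of the player to move. The input lists only those of Bob, hence
  the negation in Alice's case. Pairs with both tokens on the same graph get False; the recurrence
  never leads to them from genuine configurations.\<close>

definition union_final :: "nat \<Rightarrow> (player \<times> nat \<times> nat) set \<Rightarrow> nat \<Rightarrow> nat \<Rightarrow> bool" where
  "union_final n B u w \<longleftrightarrow> u < n \<and> n \<le> w \<and> w < 2 * n \<and> (Alice, u, w - n) \<notin> B \<or>
     n \<le> u \<and> u < 2 * n \<and> w < n \<and> (Bob, u - n, w) \<in> B"

text \<open>No arc leaves the half in which it starts, so a cycle would project to a cycle of one of
  the graphs.\<close>

lemma acyclic_union_adj:
  assumes "acyclic R0" "acyclic R1"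
  shows "acyclic {(u, w). u < N \<and> w < N \<and> union_adj n R0 R1 u w}"
proof (rule acyclicI, clarify)
  let ?S = "{(u, w). u < N \<and> w < N \<and> union_adj n R0 R1 u w}"
  have "(x < n \<longrightarrow> y < n \<and> (x, y) \<in> R0\<^sup>+) \<and> (n \<le> x \<longrightarrow> n \<le> y \<and> (x - n, y - n) \<in> R1\<^sup>+)"
    if "(x, y) \<in> ?S\<^sup>+" for x y
    using that
  proof (induction rule: trancl_induct)
    case (base y)
    then show ?case by (auto simp: union_adj_def)
  next
    case (step y z)
    then show ?case by (auto simp: union_adj_def intro: trancl.trancl_into_trancl)
  qed
  note * = this
  fix x assume "(x, x) \<in> ?S\<^sup>+"
  from *[OF this] show False using assms by (cases "x < n") (auto simp: acyclic_def)
qed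

definition game_input :: "nat \<Rightarrow> nat rel \<Rightarrow> nat rel \<Rightarrow> (player \<times> nat \<times> nat) set \<Rightarrow> nat list" where
  "game_input n R0 R1 B = n # encode_rel n R0 @ encode_rel n R1 @ encode_confs n B"

lemma game_input_nth:
  assumes "u < n" "w < n"
  shows "game_input n R0 R1 B ! 0 = n"
    and "game_input n R0 R1 B ! (1 + (u * n + w)) = of_bool ((u, w) \<in> R0)"
    and "game_input n R0 R1 B ! (1 + n * n + (u * n + w)) = of_bool ((u, w) \<in> R1)"
    and "game_input n R0 R1 B ! (1 + 2 * (n * n) + (u * n + w)) = of_bool ((Alice, u, w) \<in> B)"
    and "game_input n R0 R1 B ! (1 + 3 * (n * n) + (u * n + w)) = of_bool ((Bob, u, w) \<in> B)"
  using index_less[OF assms] index_div_mod[OF assms(2), of u]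
  by (simp_all add: game_input_def encode_rel_def encode_confs_def nth_append row_major_nth)

lemma length_game_input [simp]: "length (game_input n R0 R1 B) = 1 + 4 * (n * n)"
  by (simp add: game_input_def encode_rel_def encode_confs_def)

text \<open>A case distinction written as a sum of products: the 0/1 tests select the summand that
  belongs to the half containing both vertices, and padding vertices get 0.\<close>

definition adj_ex :: ex where
  "adj_ex =
     is_less (Rg 20 \<oslash> Rg 2) (Rg 1) \<otimes> is_less (Rg 20 \<odot> Rg 2) (Rg 1) \<otimes>
       Ar 0 (Nm 1 \<oplus> (Rg 20 \<oslash> Rg 2 \<otimes> Rg 1 \<oplus> Rg 20 \<odot> Rg 2)) \<oplus>
     is_zero (is_less (Rg 20 \<oslash> Rg 2) (Rg 1)) \<otimes> is_less (Rg 20 \<oslash> Rg 2) (Nm 2 \<otimes> Rg 1) \<otimes>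
     is_zero (is_less (Rg 20 \<odot> Rg 2) (Rg 1)) \<otimes> is_less (Rg 20 \<odot> Rg 2) (Nm 2 \<otimes> Rg 1) \<otimes>
       Ar 0 (Nm 1 \<oplus> Rg 1 \<otimes> Rg 1 \<oplus> ((Rg 20 \<oslash> Rg 2 \<ominus> Rg 1) \<otimes> Rg 1 \<oplus> (Rg 20 \<odot> Rg 2 \<ominus> Rg 1)))"

definition final_ex :: ex where
  "final_ex =
     is_less (Rg 20 \<oslash> Rg 2) (Rg 1) \<otimes>
     is_zero (is_less (Rg 20 \<odot> Rg 2) (Rg 1)) \<otimes> is_less (Rg 20 \<odot> Rg 2) (Nm 2 \<otimes> Rg 1) \<otimes>
       is_zero (Ar 0 (Nm 1 \<oplus> Nm 2 \<otimes> (Rg 1 \<otimes> Rg 1) \<oplus> (Rg 20 \<oslash> Rg 2 \<otimes> Rg 1 \<oplus> (Rg 20 \<odot> Rg 2 \<ominus> Rg 1)))) \<oplus>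
     is_zero (is_less (Rg 20 \<oslash> Rg 2) (Rg 1)) \<otimes> is_less (Rg 20 \<oslash> Rg 2) (Nm 2 \<otimes> Rg 1) \<otimes>
     is_less (Rg 20 \<odot> Rg 2) (Rg 1) \<otimes>
       Ar 0 (Nm 1 \<oplus> Nm 3 \<otimes> (Rg 1 \<otimes> Rg 1) \<oplus> ((Rg 20 \<oslash> Rg 2 \<ominus> Rg 1) \<otimes> Rg 1 \<oplus> Rg 20 \<odot> Rg 2))"

definition graph_prog :: com where
  "graph_prog = Seq (fill 20 (Rg 2 \<otimes> Rg 2) 2 (Rg 20) adj_ex) (fill 20 (Rg 2 \<otimes> Rg 2) 3 (Rg 20) final_ex)"

lemma small_graph_ex: "small adj_ex" "small final_ex"
  by (simp_all add: small_def adj_ex_def final_ex_def)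

lemma val_graph_ex:
  assumes \<alpha>: "\<And>k. k < 1 + 4 * (n * n) \<Longrightarrow> \<alpha> 0 k = game_input n R0 R1 B ! k"
    and \<rho>: "\<rho> 1 = n" "\<rho> 2 = N" "\<rho> 20 = k"
  shows "val adj_ex \<rho> \<alpha> = of_bool (union_adj n R0 R1 (k div N) (k mod N))"
    and "val final_ex \<rho> \<alpha> = of_bool (union_final n B (k div N) (k mod N))"
proof -
  have input: "\<alpha> 0 (1 + (u * n + w)) = of_bool ((u, w) \<in> R0)"
    "\<alpha> 0 (1 + n * n + (u * n + w)) = of_bool ((u, w) \<in> R1)"
    "\<alpha> 0 (1 + 2 * (n * n) + (u * n + w)) = of_bool ((Alice, u, w) \<in> B)"
    "\<alpha> 0 (1 + 3 * (n * n) + (u * n + w)) = of_bool ((Bob, u, w) \<in> B)" if "u < n" "w < n" for u w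
    using index_less[OF that] game_input_nth[OF that] by (simp_all add: \<alpha>)
  define u where "u = k div N"
  define w where "w = k mod N"
  have uw: "u < 2 * n \<Longrightarrow> n \<le> u \<Longrightarrow> u - n < n" "w < 2 * n \<Longrightarrow> n \<le> w \<Longrightarrow> w - n < n" by simp_all
  show "val adj_ex \<rho> \<alpha> = of_bool (union_adj n R0 R1 (k div N) (k mod N))"
    unfolding adj_ex_def union_adj_def val.simps binop_val.simps is_zero_simps is_less_simps \<rho>
      u_def[symmetric] w_def[symmetric]
    using input(1)[of u w] input(2)[of "u - n" "w - n"] uw
    by (cases "u < n"; cases "w < n"; cases "u < 2 * n"; cases "w < 2 * n") simp_all
  show "val final_ex \<rho> \<alpha> = of_bool (union_final n B (k div N) (k mod N))"
    unfolding final_ex_def union_final_def val.simps binop_val.simps is_zero_simps is_less_simps \<rho>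
      u_def[symmetric] w_def[symmetric]
    using input(3)[of u "w - n"] input(4)[of "u - n" w] uw
    by (cases "u < n"; cases "w < n"; cases "u < 2 * n"; cases "w < 2 * n") simp_all
qed

text \<open>A summand multiplied by 0 is evaluated all the same and may read array 0 anywhere, so
  all of its cells have to be bounded.\<close>

lemma bounded_graph_ex:
  assumes "\<And>z. \<alpha> 0 z \<le> M" "\<rho> 1 \<le> M" "\<rho> 2 \<le> M" "\<rho> 20 \<le> M" "3 \<le> M"
  shows "bounded M adj_ex \<rho> \<alpha>" "bounded M final_ex \<rho> \<alpha>"
  using assms by (simp_all add: adj_ex_def final_ex_def)

lemma hoare_graph:
  assumes \<alpha>: "\<And>k. k < 1 + 4 * (n * n) \<Longrightarrow> \<alpha> 0 k = game_input n R0 R1 B ! k" "\<And>z. \<alpha> 0 z \<le> M"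
    and \<rho>: "\<rho> 1 = n" "\<rho> 2 = N" and M: "N * N + N + 3 \<le> M" "n \<le> M"
  shows "hoare graph_prog (2 * ((N * N + 1) * tick M)) \<rho> \<alpha> (\<lambda>\<rho>' \<alpha>'.
    (\<forall>r. r \<notin> {20, 21, 22} \<longrightarrow> \<rho>' r = \<rho> r) \<and> (\<forall>a. a \<notin> {2, 3} \<longrightarrow> \<alpha>' a = \<alpha> a) \<and>
    (\<forall>u<N. \<forall>w<N. \<alpha>' 2 (u * N + w) = of_bool (union_adj n R0 R1 u w)) \<and>
    (\<forall>u<N. \<forall>w<N. \<alpha>' 3 (u * N + w) = of_bool (union_final n B u w)))"
proof (rule hoare_mono)
  define g2 :: "nat \<Rightarrow> nat" where "g2 k = of_bool (union_adj n R0 R1 (k div N) (k mod N))" for k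
  define g3 :: "nat \<Rightarrow> nat" where "g3 k = of_bool (union_final n B (k div N) (k mod N))" for k
  have M': "2 \<le> M" "3 \<le> M" "N \<le> M" "N * N \<le> M" using M by linarith+
  let ?\<rho> = "\<rho>(20 := N * N, 20 + 1 := 0, 20 + 2 := N * N)"
  have sm: "small (Rg 2 \<otimes> Rg 2)" by (simp add: small_def)
  define \<alpha>\<^sub>1 where "\<alpha>\<^sub>1 = \<alpha>(2 := \<lambda>x. if x < N * N then g2 x else \<alpha> 2 x)"
  define \<alpha>\<^sub>2 where "\<alpha>\<^sub>2 = \<alpha>\<^sub>1(3 := \<lambda>x. if x < N * N then g3 x else \<alpha>\<^sub>1 3 x)"
  let ?Q = "\<lambda>\<rho>' \<alpha>'. \<rho>' = ?\<rho> \<and> \<alpha>' = \<alpha>\<^sub>2"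
  have 2: "hoare (fill 20 (Rg 2 \<otimes> Rg 2) 3 (Rg 20) final_ex) ((N * N + 1) * tick M) ?\<rho> \<alpha>\<^sub>1 ?Q"
  proof (rule hoare_table_tick[where g = g3])
    fix k assume k: "k < N * N"
    show "let \<rho>' = ?\<rho>(20 := k, 20 + 1 := N * N - k, 20 + 2 := N * N);
        \<alpha>' = \<alpha>\<^sub>1(3 := \<lambda>x. if x < k then g3 x else \<alpha>\<^sub>1 3 x)
      in bounded M final_ex \<rho>' \<alpha>' \<and> val final_ex \<rho>' \<alpha>' = g3 k"
      unfolding Let_def g3_def
      by (intro conjI bounded_graph_ex val_graph_ex) (use k M' M \<rho> \<alpha> in \<open>simp_all add: \<alpha>\<^sub>1_def\<close>)
  qed (use M' \<rho> sm in \<open>simp_all add: small_graph_ex \<alpha>\<^sub>2_def\<close>)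
  show "hoare graph_prog ((N * N + 1) * tick M + (N * N + 1) * tick M) \<rho> \<alpha> ?Q"
    unfolding graph_prog_def
  proof (rule hoare_table_Seq_tick[where g = g2])
    fix k assume k: "k < N * N"
    show "let \<rho>' = \<rho>(20 := k, 20 + 1 := N * N - k, 20 + 2 := N * N);
        \<alpha>' = \<alpha>(2 := \<lambda>x. if x < k then g2 x else \<alpha> 2 x)
      in bounded M adj_ex \<rho>' \<alpha>' \<and> val adj_ex \<rho>' \<alpha>' = g2 k"
      unfolding Let_def g2_def
      by (intro conjI bounded_graph_ex val_graph_ex) (use k M' M \<rho> \<alpha> in simp_all)
  qed (use M' \<rho> 2 sm in \<open>simp_all add: small_graph_ex \<alpha>\<^sub>1_def\<close>)
  fix \<rho>' \<alpha>' assume "?Q \<rho>' \<alpha>'"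
  then show "(\<forall>r. r \<notin> {20, 21, 22} \<longrightarrow> \<rho>' r = \<rho> r) \<and> (\<forall>a. a \<notin> {2, 3} \<longrightarrow> \<alpha>' a = \<alpha> a) \<and>
    (\<forall>u<N. \<forall>w<N. \<alpha>' 2 (u * N + w) = of_bool (union_adj n R0 R1 u w)) \<and>
    (\<forall>u<N. \<forall>w<N. \<alpha>' 3 (u * N + w) = of_bool (union_final n B u w))"
    by (simp add: \<alpha>\<^sub>2_def \<alpha>\<^sub>1_def g2_def g3_def index_less index_div_mod)
qed simp

text \<open>Here \<open>p\<close> is the player to move and \<open>q\<close> the owner of the
  requested set, with Alice as 0. Membership means that the value of \<open>z\<close> is true
  exactly when \<open>p = q\<close>, which is the parity of \<open>z + p + q\<close>.\<close>

definition output_ex :: ex where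
  "output_ex = (let p = Rg 20 \<oslash> (Rg 1 \<otimes> Rg 1) \<odot> Nm 2; q = Rg 20 \<oslash> (Rg 1 \<otimes> Rg 1) \<oslash> Nm 2 \<odot> Nm 2;
       u = Rg 20 \<odot> (Rg 1 \<otimes> Rg 1) \<oslash> Rg 1; v = Rg 20 \<odot> (Rg 1 \<otimes> Rg 1) \<odot> Rg 1
     in (Ar 10 (Ar 8 (p \<otimes> Rg 1 \<oplus> u) \<otimes> Rg 2 \<oplus> Ar 8 (is_zero p \<otimes> Rg 1 \<oplus> v)) \<oplus> p \<oplus> q) \<odot> Nm 2)"

definition output_prog :: com where
  "output_prog = fill 20 (Nm 8 \<otimes> (Rg 1 \<otimes> Rg 1)) 1 (Rg 20) output_ex"

definition player_of :: "nat \<Rightarrow> player" where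
  "player_of b = (if even b then Alice else Bob)"

definition union_negamax :: "nat \<Rightarrow> (nat \<Rightarrow> nat \<Rightarrow> bool) \<Rightarrow> player \<Rightarrow> nat \<Rightarrow> nat \<Rightarrow> bool" where
  "union_negamax n z P u v = (case P of Alice \<Rightarrow> z u (n + v) | Bob \<Rightarrow> z (n + u) v)"

lemma hoare_output:
  assumes \<rho>: "\<rho> 1 = n" "\<rho> 2 = N" and N: "2 * n \<le> N" and M: "2 * (N * N) + N + 10 \<le> M"
    and pos: "\<And>u. u < N \<Longrightarrow> \<alpha> 8 u < N"
    and z: "\<And>u w. u < N \<Longrightarrow> w < N \<Longrightarrow> \<alpha> 10 (\<alpha> 8 u * N + \<alpha> 8 w) = of_bool (z u w)"
  shows "hoare output_prog ((2 * (N * N) + 1) * tick M) \<rho> \<alpha> (\<lambda>\<rho>' \<alpha>'. \<rho>' 1 = n \<and>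
    (\<forall>k<8 * (n * n). \<alpha>' 1 k = of_bool
      (union_negamax n z (player_of (k div (n * n))) (k mod (n * n) div n) (k mod (n * n) mod n) \<longleftrightarrow>
       player_of (k div (n * n)) = player_of (k div (n * n) div 2))))"
proof (rule hoare_mono)
  define g :: "nat \<Rightarrow> nat" where "g k = of_bool
      (union_negamax n z (player_of (k div (n * n))) (k mod (n * n) div n) (k mod (n * n) mod n) \<longleftrightarrow>
       player_of (k div (n * n)) = player_of (k div (n * n) div 2))" for k
  have n8: "8 * (n * n) \<le> 2 * (N * N)"
  proof -
    have "(2 * n) * (2 * n) \<le> N * N" using N by (intro mult_le_mono)
    then show ?thesis by simp
  qed
  have M': "2 \<le> M" "8 * (n * n) \<le> M" "8 \<le> M" "n \<le> M" "N \<le> M" using M n8 N by linarith+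
  show "hoare output_prog ((8 * (n * n) + 1) * tick M) \<rho> \<alpha> (\<lambda>\<rho>' \<alpha>'.
      \<rho>' = \<rho>(20 := 8 * (n * n), 20 + 1 := 0, 20 + 2 := 8 * (n * n)) \<and>
      \<alpha>' = \<alpha>(1 := \<lambda>x. if x < 8 * (n * n) then g x else \<alpha> 1 x))"
    unfolding output_prog_def
  proof (rule hoare_table_tick[where g = g])
    fix k assume k: "k < 8 * (n * n)"
    then have n: "0 < n" by (cases n) auto
    define b where "b = k div (n * n)"
    define u where "u = k mod (n * n) div n"
    define v where "v = k mod (n * n) mod n"
    have "k mod (n * n) < n * n" using n by simp
    from index_bounds[OF this] have uv: "u < n" "v < n" by (simp_all add: u_def v_def)
    define p where "p = b mod 2 * n + u"
    define q where "q = of_bool (b mod 2 = 0) * n + v"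
    have pq: "p < N" "q < N" using uv N mod_less_divisor[of 2 b] unfolding p_def q_def
      by (cases "even b"; simp add: mod_2_eq_odd)+
    have zpq: "z p q = union_negamax n z (player_of b) u v"
      by (cases "even b") (simp_all add: p_def q_def union_negamax_def player_of_def mod_2_eq_odd)
    \<comment> \<open>One added to both sides of an equality of bits: the sum is odd exactly if the
      truth value of \<open>X\<close> agrees with that of \<open>p = q\<close>.\<close>
    have parity: "(of_bool X + b mod 2 + b div 2 mod 2) mod 2 =
        (of_bool (X \<longleftrightarrow> player_of b = player_of (b div 2)) :: nat)" for X
      by (cases X; cases "even b"; cases "even (b div 2)")
        (simp_all add: player_of_def mod_2_eq_odd)
    have "\<alpha> 8 p \<le> M" "\<alpha> 8 q \<le> M" using pos[OF pq(1)] pos[OF pq(2)] M' by simp_all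
    moreover have zM: "\<alpha> 10 (\<alpha> 8 p * N + \<alpha> 8 q) = of_bool (union_negamax n z (player_of b) u v)"
      using z[OF pq] zpq by simp
    moreover have "g k = (of_bool (union_negamax n z (player_of b) u v) + b mod 2 + b div 2 mod 2) mod 2"
      unfolding parity by (simp add: g_def b_def u_def v_def)
    moreover have "k \<le> M" using k M' by simp
    ultimately show "let \<rho>' = \<rho>(20 := k, 20 + 1 := 8 * (n * n) - k, 20 + 2 := 8 * (n * n));
        \<alpha>' = \<alpha>(1 := \<lambda>x. if x < k then g x else \<alpha> 1 x)
      in bounded M output_ex \<rho>' \<alpha>' \<and> val output_ex \<rho>' \<alpha>' = g k"
      using M' \<rho> by (simp add: output_ex_def Let_def b_def[symmetric] u_def[symmetric] v_def[symmetric]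
        p_def[symmetric] q_def[symmetric] del: of_bool_eq_0_iff)
  qed (use M' \<rho> in \<open>simp_all add: small_def output_ex_def Let_def\<close>)
  show "(8 * (n * n) + 1) * tick M \<le> (2 * (N * N) + 1) * tick M" using n8 by (intro mult_le_mono1) simp
  fix \<rho>' \<alpha>'
  assume "\<rho>' = \<rho>(20 := 8 * (n * n), 20 + 1 := 0, 20 + 2 := 8 * (n * n)) \<and>
      \<alpha>' = \<alpha>(1 := \<lambda>x. if x < 8 * (n * n) then g x else \<alpha> 1 x)"
  then show "\<rho>' 1 = n \<and> (\<forall>k<8 * (n * n). \<alpha>' 1 k = of_bool
      (union_negamax n z (player_of (k div (n * n))) (k mod (n * n) div n) (k mod (n * n) mod n) \<longleftrightarrow>
       player_of (k div (n * n)) = player_of (k div (n * n) div 2)))"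
    using \<rho> by (simp add: g_def)
qed

lemma length_encode_confs [simp]: "length (encode_confs n X) = 2 * (n * n)"
  by (simp add: encode_confs_def)

lemma encode_confs_nth:
  assumes k: "k < 2 * (n * n)"
  shows "encode_confs n X ! k =
    of_bool ((player_of (k div (n * n)), k mod (n * n) div n, k mod (n * n) mod n) \<in> X)"
proof (cases "k < n * n")
  case True
  then show ?thesis
    by (simp add: encode_confs_def nth_append row_major_nth player_of_def)
next
  case False
  define q where "q = k - n * n"
  have q: "k = q + n * n" "q < n * n" using False k by (simp_all add: q_def)
  then have "0 < n * n" by linarith
  then have "k div (n * n) = Suc 0" "k mod (n * n) = q" using q by simp_all
  then show ?thesis
    using q by (simp add: encode_confs_def nth_append row_major_nth player_of_def)
qed

text \<open>Each of the four lists has two parts of \<open>n * n\<close> entries, one per player to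
  move. So the lowest bit of \<open>k div (n * n)\<close> is the player to move and the next one the
  owner of the set; winning and surviving lists come from the same family \<open>X\<close>.\<close>

lemma game_output_nth:
  assumes k: "k < 8 * (n * n)"
  shows "(encode_confs n (X Alice) @ encode_confs n (X Bob) @ encode_confs n (X Alice) @ encode_confs n (X Bob)) ! k =
    of_bool ((player_of (k div (n * n)), k mod (n * n) div n, k mod (n * n) mod n) \<in> X (player_of (k div (n * n) div 2)))"
proof -
  define m where "m = n * n"
  define i where "i = k div (2 * m)"
  define q where "q = k mod (2 * m)"
  have m: "0 < m" using k by (cases n) (auto simp: m_def)
  have q: "q < 2 * m" using m by (simp add: q_def)
  have kq: "k = q + i * (2 * m)" unfolding i_def q_def by (rule mod_div_mult_eq[symmetric])
  have "i < 4" using k unfolding m_def[symmetric] i_def by (simp add: div_less_iff_less_mult m)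
  have kq': "k = q + (2 * i) * m" using kq by simp
  have "k div m = q div m + 2 * i" "k mod m = q mod m"
    unfolding kq' using m by (simp_all only: div_mult_self1 mod_mult_self1)
  moreover have "q div m < 2" using q m by (simp add: div_less_iff_less_mult)
  ultimately have *: "player_of (k div m) = player_of (q div m)" "player_of (k div m div 2) = player_of i" "k mod m = q mod m"
    by (simp_all add: player_of_def)
  have enc: "encode_confs n (X P) ! q = of_bool ((player_of (q div m), q mod m div n, q mod m mod n) \<in> X P)" for P
    using encode_confs_nth[of q n] q unfolding m_def by simp
  consider "i = 0" | "i = 1" | "i = 2" | "i = 3" using \<open>i < 4\<close> by linarith
  then have "(encode_confs n (X Alice) @ encode_confs n (X Bob) @ encode_confs n (X Alice) @ encode_confs n (X Bob)) ! k =
      encode_confs n (X (player_of i)) ! q"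
    using q by cases (simp_all add: kq nth_append m_def player_of_def)
  then show ?thesis unfolding enc using * by (simp add: m_def)
qed

text \<open>A token stays in its half of the union, so the recurrence on genuine pairs involves
  genuine pairs only. The shift by \<open>n\<close> translates it into that of the game.\<close>

lemma union_negamax_solution:
  assumes verts: "pverts G0 = {0..<n}" "pverts G1 = {0..<n}"
    and arcs: "parcs G0 \<subseteq> {0..<n} \<times> {0..<n}" "parcs G1 \<subseteq> {0..<n} \<times> {0..<n}"
    and F: "bipartition (confs (two_token_graph G0 G1)) F" and N: "2 * n \<le> N"
    and z: "\<And>u w. u < N \<Longrightarrow> w < N \<Longrightarrow> z u w \<longleftrightarrow> union_final n (F Bob) u w \<or>
      (\<exists>u'<N. union_adj n (parcs G0) (parcs G1) u u' \<and> \<not> z w u')"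
  shows "negamax_solution G0 G1 F (union_negamax n z)"
  unfolding negamax_solution_def
proof (intro allI impI)
  fix P u v
  assume "u \<in> pverts (case_player G0 G1 P)" "v \<in> pverts (case_player G0 G1 (opp P))"
  then have uv: "u < n" "v < n" using verts by (cases P; simp)+
  show "union_negamax n z P u v \<longleftrightarrow> (P, u, v) \<in> F P \<or>
    (\<exists>u'. (u, u') \<in> parcs (case_player G0 G1 P) \<and> \<not> union_negamax n z (opp P) v u')"
  proof (cases P)
    case Alice
    have "(Alice, u, v) \<in> confs (two_token_graph G0 G1)"
      using uv verts by (simp add: two_token_graph_simps)
    then have "(Alice, u, v) \<in> F Alice \<longleftrightarrow> (Alice, u, v) \<notin> F Bob"
      using F by (auto simp: bipartition_def)
    moreover have "(\<exists>u'<N. union_adj n (parcs G0) (parcs G1) u u' \<and> \<not> z (n + v) u') \<longleftrightarrow>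
        (\<exists>u'. (u, u') \<in> parcs G0 \<and> \<not> z (n + v) u')"
    proof
      assume "\<exists>u'<N. union_adj n (parcs G0) (parcs G1) u u' \<and> \<not> z (n + v) u'"
      then show "\<exists>u'. (u, u') \<in> parcs G0 \<and> \<not> z (n + v) u'"
        using uv by (auto simp: union_adj_def)
    next
      assume "\<exists>u'. (u, u') \<in> parcs G0 \<and> \<not> z (n + v) u'"
      then obtain u' where u': "(u, u') \<in> parcs G0" "\<not> z (n + v) u'" by blast
      then have "u' < n" using arcs by auto
      then have "u' < N" "union_adj n (parcs G0) (parcs G1) u u'"
        using u' uv N by (auto simp: union_adj_def)
      with u' show "\<exists>u'<N. union_adj n (parcs G0) (parcs G1) u u' \<and> \<not> z (n + v) u'" by blast
    qed
    ultimately show ?thesis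
      using z[of u "n + v"] uv N unfolding Alice
      by (simp add: union_negamax_def union_final_def)
  next
    case Bob
    have "(\<exists>u'<N. union_adj n (parcs G0) (parcs G1) (n + u) u' \<and> \<not> z v u') \<longleftrightarrow>
        (\<exists>w. (u, w) \<in> parcs G1 \<and> \<not> z v (n + w))"
    proof
      assume "\<exists>u'<N. union_adj n (parcs G0) (parcs G1) (n + u) u' \<and> \<not> z v u'"
      then obtain u' where "union_adj n (parcs G0) (parcs G1) (n + u) u'" "\<not> z v u'" by blast
      then have "(u, u' - n) \<in> parcs G1 \<and> \<not> z v (n + (u' - n))" by (auto simp: union_adj_def)
      then show "\<exists>w. (u, w) \<in> parcs G1 \<and> \<not> z v (n + w)" by blast
    next
      assume "\<exists>w. (u, w) \<in> parcs G1 \<and> \<not> z v (n + w)"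
      then obtain w where w: "(u, w) \<in> parcs G1" "\<not> z v (n + w)" by blast
      then have "w < n" using arcs by auto
      then have "n + w < N" "union_adj n (parcs G0) (parcs G1) (n + u) (n + w)"
        using w uv N by (auto simp: union_adj_def)
      with w show "\<exists>u'<N. union_adj n (parcs G0) (parcs G1) (n + u) u' \<and> \<not> z v u'" by blast
    qed
    then show ?thesis
      using z[of "n + u" v] uv N unfolding Bob
      by (simp add: union_negamax_def union_final_def)
  qed
qed

definition two_token_prog :: "nat \<Rightarrow> com \<Rightarrow> com" where
  "two_token_prog R c = Seq setup_prog (Seq graph_prog (Seq (core_prog R c) output_prog))"

definition acyclic_games :: "nat \<Rightarrow> nat pair_pre_digraph \<Rightarrow> nat pair_pre_digraph \<Rightarrow>
    (player \<Rightarrow> (player \<times> nat \<times> nat) set) \<Rightarrow> bool" where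
  "acyclic_games n G0 G1 F \<longleftrightarrow>
     pair_fin_digraph G0 \<and> pverts G0 = {0..<n} \<and> acyclic (parcs G0) \<and>
     pair_fin_digraph G1 \<and> pverts G1 = {0..<n} \<and> acyclic (parcs G1) \<and>
     bipartition (confs (two_token_graph G0 G1)) F"

definition solution :: "nat \<Rightarrow> nat pair_pre_digraph \<Rightarrow> nat pair_pre_digraph \<Rightarrow>
    (player \<Rightarrow> (player \<times> nat \<times> nat) set) \<Rightarrow> nat list" where
  "solution n G0 G1 F =
     encode_confs n (winning_set (two_token_graph G0 G1) F Alice) @
     encode_confs n (winning_set (two_token_graph G0 G1) F Bob) @
     encode_confs n (surviving_set (two_token_graph G0 G1) F Alice) @
     encode_confs n (surviving_set (two_token_graph G0 G1) F Bob)"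

lemma length_solution [simp]: "length (solution n G0 G1 F) = 8 * (n * n)"
  by (simp add: solution_def)

lemma solution_nth:
  assumes game: "acyclic_games n G0 G1 F" and z: "negamax_solution G0 G1 F z" and k: "k < 8 * (n * n)"
  shows "solution n G0 G1 F ! k = of_bool
      (z (player_of (k div (n * n))) (k mod (n * n) div n) (k mod (n * n) mod n) \<longleftrightarrow>
       player_of (k div (n * n)) = player_of (k div (n * n) div 2))"
proof -
  let ?G = "two_token_graph G0 G1"
  have eq: "surviving_set ?G F P = winning_set ?G F P" for P
    using game z by (simp add: acyclic_games_def winning_surviving_eq)
  have mem: "(Q, u, v) \<in> winning_set ?G F P \<longleftrightarrow> (z Q u v \<longleftrightarrow> Q = P)" if "u < n" "v < n" for P Q u v
    using game z that by (cases Q) (auto simp: acyclic_games_def winning_surviving_eq favourable_def two_token_graph_simps)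
  have "k mod (n * n) < n * n" using k by (cases n) auto
  from index_bounds[OF this] show ?thesis
    unfolding solution_def eq game_output_nth[OF k] by (simp add: mem)
qed

text \<open>Array 13 is exempt from being zero because the labels of a Kripke structure are kept
  there. The registers are arbitrary, so the program can be run after the preparation of an input by
  another one.\<close>

lemma hoare_two_token:
  assumes c: "\<And>s. 1 \<le> s \<Longrightarrow> multiplies c s (T s)" "regs_below R c"
    and game: "acyclic_games n G0 G1 F"
    and L: "L = level_of n" "N = 2 ^ L"
    and M: "2 * (N * N * N) + 3 * (N * N) + 10 \<le> M"
    and \<alpha>: "\<And>k. k < 1 + 4 * (n * n) \<Longrightarrow> \<alpha> 0 k = game_input n (parcs G0) (parcs G1) (F Bob) ! k"
      "\<And>z. \<alpha> 0 z \<le> M" "\<And>a. 2 \<le> a \<Longrightarrow> a \<noteq> 13 \<Longrightarrow> \<alpha> a = (\<lambda>_. 0)"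
  shows "hoare (two_token_prog R c) ((2 * R + 77) * (Suc L * level_time T L) * tick M) \<rho> \<alpha>
    (\<lambda>(\<rho>' :: nat \<Rightarrow> nat) \<alpha>'. \<rho>' 1 = n \<and> (\<forall>k<8 * (n * n). \<alpha>' 1 k = solution n G0 G1 F ! k))"
    (is "hoare _ _ _ _ ?Q")
proof (rule hoare_mono)
  interpret G0: pair_fin_digraph G0 using game by (simp add: acyclic_games_def)
  interpret G1: pair_fin_digraph G1 using game by (simp add: acyclic_games_def)
  have verts: "pverts G0 = {0..<n}" "pverts G1 = {0..<n}" and F: "bipartition (confs (two_token_graph G0 G1)) F"
    using game by (simp_all add: acyclic_games_def)
  have arcs: "parcs G0 \<subseteq> {0..<n} \<times> {0..<n}" "parcs G1 \<subseteq> {0..<n} \<times> {0..<n}"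
    using G0.wellformed' G1.wellformed' unfolding verts by auto
  have N1: "1 \<le> N" and nN: "2 * n \<le> N" and NN4: "N * N = 4 ^ L"
    using level_of[of n] unfolding L by (simp_all add: power_mult_distrib[symmetric])
  have NN: "N \<le> N * N" "1 \<le> N * N" "N * N \<le> N * N * N" using N1 by simp_all
  have M': "2 ^ level_of n + 2 \<le> M" "N * N + N + 3 \<le> M" "n \<le> M" "2 * (N * N) + N + 10 \<le> M"
    using M NN nN unfolding L by linarith+
  let ?B = "F Bob" and ?R0 = "parcs G0" and ?R1 = "parcs G1"
  let ?core = "(2 * R + 62) * (Suc L * level_time T L) * tick M"
  have out: "hoare output_prog ((2 * (N * N) + 1) * tick M) \<rho>\<^sub>3 \<alpha>\<^sub>3 ?Q"
    if "\<rho>\<^sub>3 1 = n" "\<rho>\<^sub>3 2 = N" and z: "\<forall>u<N. \<forall>w<N. z u w \<longleftrightarrow> union_final n ?B u w \<or> (\<exists>u'<N. union_adj n ?R0 ?R1 u u' \<and> \<not> z w u')"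
      and "\<forall>u<N. \<alpha>\<^sub>3 8 u < N" "\<forall>u<N. \<forall>w<N. \<alpha>\<^sub>3 10 (\<alpha>\<^sub>3 8 u * N + \<alpha>\<^sub>3 8 w) = of_bool (z u w)"
    for \<rho>\<^sub>3 \<alpha>\<^sub>3 z
  proof -
    have sol: "negamax_solution G0 G1 F (union_negamax n z)"
      by (rule union_negamax_solution[OF verts arcs F nN]) (use z in blast)
    show ?thesis
    proof (rule hoare_mono[OF hoare_output order_refl])
      fix \<rho>' :: "nat \<Rightarrow> nat" and \<alpha>' :: "nat \<Rightarrow> nat \<Rightarrow> nat"
      assume "\<rho>' 1 = n \<and> (\<forall>k<8 * (n * n). \<alpha>' 1 k = of_bool
        (union_negamax n z (player_of (k div (n * n))) (k mod (n * n) div n) (k mod (n * n) mod n) \<longleftrightarrow>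
         player_of (k div (n * n)) = player_of (k div (n * n) div 2)))"
      then show "?Q \<rho>' \<alpha>'" using solution_nth[OF game sol] by simp
    qed (use that nN M' in auto)
  qed
  have core: "hoare (Seq (core_prog R c) output_prog) (?core + (2 * (N * N) + 1) * tick M) \<rho>\<^sub>2 \<alpha>\<^sub>2 ?Q"
    if "\<rho>\<^sub>2 1 = n" "\<rho>\<^sub>2 2 = N" "\<rho>\<^sub>2 3 = L" "\<forall>a. a \<notin> {2, 3} \<longrightarrow> \<alpha>\<^sub>2 a = \<alpha> a"
      "\<forall>u<N. \<forall>w<N. \<alpha>\<^sub>2 2 (u * N + w) = of_bool (union_adj n ?R0 ?R1 u w)"
      "\<forall>u<N. \<forall>w<N. \<alpha>\<^sub>2 3 (u * N + w) = of_bool (union_final n ?B u w)" for \<rho>\<^sub>2 \<alpha>\<^sub>2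
  proof (rule hoare_Seq[OF hoare_core[OF c L(2) that(2,3) M]])
    show "acyclic {(u, w). u < N \<and> w < N \<and> union_adj n ?R0 ?R1 u w}"
      using game by (intro acyclic_union_adj) (simp_all add: acyclic_games_def)
    fix \<rho>\<^sub>3 :: "nat \<Rightarrow> nat" and \<alpha>\<^sub>3 :: "nat \<Rightarrow> nat \<Rightarrow> nat"
    assume 3: "\<rho>\<^sub>3 1 = \<rho>\<^sub>2 1 \<and> \<rho>\<^sub>3 2 = N \<and> \<alpha>\<^sub>3 0 = \<alpha>\<^sub>2 0 \<and> \<alpha>\<^sub>3 1 = \<alpha>\<^sub>2 1 \<and>
      (\<exists>z. (\<forall>u<N. \<forall>w<N. z u w \<longleftrightarrow> union_final n ?B u w \<or> (\<exists>u'<N. union_adj n ?R0 ?R1 u u' \<and> \<not> z w u')) \<and>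
        (\<forall>u<N. \<alpha>\<^sub>3 8 u < N) \<and> (\<forall>u<N. \<forall>w<N. \<alpha>\<^sub>3 10 (\<alpha>\<^sub>3 8 u * N + \<alpha>\<^sub>3 8 w) = of_bool (z u w)))"
    then obtain z where z: "\<forall>u<N. \<forall>w<N. z u w \<longleftrightarrow> union_final n ?B u w \<or>
        (\<exists>u'<N. union_adj n ?R0 ?R1 u u' \<and> \<not> z w u')"
      "\<forall>u<N. \<alpha>\<^sub>3 8 u < N" "\<forall>u<N. \<forall>w<N. \<alpha>\<^sub>3 10 (\<alpha>\<^sub>3 8 u * N + \<alpha>\<^sub>3 8 w) = of_bool (z u w)" by blast
    show "hoare output_prog ((2 * (N * N) + 1) * tick M) \<rho>\<^sub>3 \<alpha>\<^sub>3 ?Q"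
      by (rule out[OF _ _ z]) (use 3 that in simp_all)
  qed (use that \<alpha>(3) in simp_all)
  have graph: "hoare (Seq graph_prog (Seq (core_prog R c) output_prog))
    (2 * ((N * N + 1) * tick M) + (?core + (2 * (N * N) + 1) * tick M)) \<rho>\<^sub>1 \<alpha> ?Q"
    if "\<rho>\<^sub>1 1 = n" "\<rho>\<^sub>1 2 = N" "\<rho>\<^sub>1 3 = L" for \<rho>\<^sub>1
  proof (rule hoare_Seq)
    show "hoare graph_prog (2 * ((N * N + 1) * tick M)) \<rho>\<^sub>1 \<alpha> (\<lambda>\<rho>' \<alpha>'.
      (\<forall>r. r \<notin> {20, 21, 22} \<longrightarrow> \<rho>' r = \<rho>\<^sub>1 r) \<and> (\<forall>a. a \<notin> {2, 3} \<longrightarrow> \<alpha>' a = \<alpha> a) \<and>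
      (\<forall>u<N. \<forall>w<N. \<alpha>' 2 (u * N + w) = of_bool (union_adj n ?R0 ?R1 u w)) \<and>
      (\<forall>u<N. \<forall>w<N. \<alpha>' 3 (u * N + w) = of_bool (union_final n ?B u w)))"
      by (rule hoare_graph) (use \<alpha> that M' in auto)
  next
    fix \<rho>\<^sub>2 :: "nat \<Rightarrow> nat" and \<alpha>\<^sub>2 :: "nat \<Rightarrow> nat \<Rightarrow> nat"
    assume "(\<forall>r. r \<notin> {20, 21, 22} \<longrightarrow> \<rho>\<^sub>2 r = \<rho>\<^sub>1 r) \<and> (\<forall>a. a \<notin> {2, 3} \<longrightarrow> \<alpha>\<^sub>2 a = \<alpha> a) \<and>
      (\<forall>u<N. \<forall>w<N. \<alpha>\<^sub>2 2 (u * N + w) = of_bool (union_adj n ?R0 ?R1 u w)) \<and>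
      (\<forall>u<N. \<forall>w<N. \<alpha>\<^sub>2 3 (u * N + w) = of_bool (union_final n ?B u w))"
    then show "hoare (Seq (core_prog R c) output_prog) (?core + (2 * (N * N) + 1) * tick M) \<rho>\<^sub>2 \<alpha>\<^sub>2 ?Q"
      using that by (intro core) simp_all
  qed
  have "game_input n ?R0 ?R1 ?B ! 0 = n" by (simp add: game_input_def)
  then have "\<alpha> 0 0 = n" using \<alpha>(1)[of 0] by simp
  then show "hoare (two_token_prog R c) ((8 * n + 4) * tick M + (2 * ((N * N + 1) * tick M) +
      (?core + (2 * (N * N) + 1) * tick M))) \<rho> \<alpha> ?Q"
    unfolding two_token_prog_def
  proof (rule hoare_Seq[OF hoare_setup[OF _ M'(1)]])
    fix \<rho>\<^sub>1 :: "nat \<Rightarrow> nat" and \<alpha>\<^sub>1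
    assume "\<alpha>\<^sub>1 = \<alpha> \<and> \<rho>\<^sub>1 1 = n \<and> \<rho>\<^sub>1 2 = 2 ^ level_of n \<and> \<rho>\<^sub>1 3 = level_of n"
    then show "hoare (Seq graph_prog (Seq (core_prog R c) output_prog))
      (2 * ((N * N + 1) * tick M) + (?core + (2 * (N * N) + 1) * tick M)) \<rho>\<^sub>1 \<alpha>\<^sub>1 ?Q"
      using graph[of \<rho>\<^sub>1] L by blast
  qed
  define X where "X = Suc L * level_time T L"
  have "N * N \<le> level_time T L" by (simp add: level_time_def NN4)
  then have X: "N * N \<le> X" by (simp add: X_def trans_le_add1)
  have "8 * n + 4 + (2 * (Y + 1) + ((2 * R + 62) * X + (2 * Y + 1))) \<le> (2 * R + 77) * X"
    if "1 \<le> Y" "Y \<le> X" "2 * n \<le> Y" for Y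
    using that by (simp add: algebra_simps)
  from this[OF NN(2) X] nN NN
  have "8 * n + 4 + (2 * (N * N + 1) + ((2 * R + 62) * X + (2 * (N * N) + 1))) \<le> (2 * R + 77) * X"
    by linarith
  then have "(8 * n + 4 + (2 * (N * N + 1) + ((2 * R + 62) * X + (2 * (N * N) + 1)))) * tick M \<le>
      (2 * R + 77) * X * tick M"
    by (rule mult_le_mono1)
  then show "(8 * n + 4) * tick M + (2 * ((N * N + 1) * tick M) + (?core + (2 * (N * N) + 1) * tick M)) \<le>
      (2 * R + 77) * (Suc L * level_time T L) * tick M"
    unfolding X_def[symmetric] by (simp add: distrib_right)
qed simp

lemma ex_multiplication_program:
  assumes "computable_in_time boolean_matrix_multiplication T"
  shows "\<exists>c R. (\<forall>s. multiplies c s (T s)) \<and> regs_below R c"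
proof -
  obtain c where c: "\<forall>n. \<forall>(x, y)\<in>boolean_matrix_multiplication n. \<exists>t \<sigma>.
     exec c (init_state x) t \<sigma> \<and> t \<le> T n \<and> has_output \<sigma> y"
    using assms unfolding computable_in_time_def by blast
  have "multiplies c s (T s)" for s
    unfolding multiplies_def
  proof (intro allI)
    fix A B
    have "(s # row_major s A @ row_major s B, row_major s (bool_mat_mult s A B)) \<in> boolean_matrix_multiplication s"
      unfolding boolean_matrix_multiplication_def by blast
    then show "\<exists>t \<sigma>. exec c (init_state (s # row_major s A @ row_major s B)) t \<sigma> \<and>
      t \<le> T s \<and> has_output \<sigma> (row_major s (bool_mat_mult s A B))"
      using c by fast
  qed
  then show ?thesis using ex_regs_below by blast
qed

text \<open>Bounds every number handled outside the calls: labels are below \<open>n ^ d\<close>, call numbers and array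
  indices below \<open>O(N\<^sup>3)\<close>.\<close>

definition value_bound :: "nat \<Rightarrow> nat \<Rightarrow> nat" where
  "value_bound d L = 1000 * 2 ^ ((d + 3) * L)"

text \<open>With \<open>N = 2^L\<close> the bound is \<open>1000 * N^(d + 3)\<close>. Its bit length
  is linear in \<open>L\<close>, which is the logarithmic cost of one elementary step; the 10 bits
  for the factor 1000 are included in \<open>d + 14\<close>.\<close>

lemma value_bound:
  assumes "N = 2 ^ L"
  shows "2 * (N * N * N) + 3 * (N * N) + 10 \<le> value_bound d L" "N ^ d \<le> value_bound d L"
    "tick (value_bound d L) \<le> 500000 * (d + 14) * Suc L"
proof -
  have pos: "1 \<le> N" "1 \<le> N ^ d" using assms by simp_all
  have eq: "value_bound d L = 1000 * (N ^ d * (N * N * N))"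
    by (simp add: value_bound_def assms power_add[symmetric] power_mult[symmetric] algebra_simps)
  have *: "N * N \<le> N * N * N" "1 \<le> N * N * N" using pos by simp_all
  have "1 * (N * N * N) \<le> N ^ d * (N * N * N)" "N ^ d * 1 \<le> N ^ d * (N * N * N)"
    using pos * by (intro mult_le_mono; simp)+
  then show "2 * (N * N * N) + 3 * (N * N) + 10 \<le> value_bound d L" "N ^ d \<le> value_bound d L"
    using * unfolding eq by linarith+
  have "bits (value_bound d L) \<le> 10 + (d + 3) * L"
    unfolding bits_le_iff value_bound_def power_add by simp
  also have "\<dots> \<le> (d + 14) * Suc L"
  proof -
    have "(d + 3) * L \<le> (d + 14) * L" by (intro mult_le_mono1) simp
    then show ?thesis unfolding mult_Suc_right by linarith
  qed
  finally show "tick (value_bound d L) \<le> 500000 * (d + 14) * Suc L"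
    unfolding tick_def mult.assoc by (rule mult_le_mono2)
qed

lemma hoare_init_state:
  assumes "hoare c U (\<lambda>_. 0) (arr (init_state x)) Q"
  shows "\<exists>t \<sigma>. exec c (init_state x) t \<sigma> \<and> t \<le> U \<and> (\<exists>\<rho>. Q \<rho> (arr \<sigma>))"
proof -
  have "repr (init_state x) (\<lambda>_. 0) (arr (init_state x))" by (simp add: repr_def init_state_def)
  then obtain t \<tau> \<rho>' \<alpha>' where "exec c (init_state x) t \<tau>" "t \<le> U" "repr \<tau> \<rho>' \<alpha>'" "Q \<rho>' \<alpha>'"
    using assms unfolding hoare_def by blast
  moreover from this have "arr \<tau> = \<alpha>'" by (simp add: repr_def)
  ultimately show ?thesis by blast
qed

lemma game_input_le:
  assumes "k < length (game_input n R0 R1 B)" "1 \<le> M" "n \<le> M"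
  shows "game_input n R0 R1 B ! k \<le> M"
proof -
  have "game_input n R0 R1 B ! k \<in> set (game_input n R0 R1 B)" using assms(1) by (rule nth_mem)
  then show ?thesis using assms(2,3)
    by (auto simp: game_input_def encode_rel_def encode_confs_def row_major_def)
qed

lemma acyclic_2trg_winning_setD:
  assumes "(x, y) \<in> acyclic_2trg_winning_set n"
  shows "\<exists>G0 G1 F. acyclic_games n G0 G1 F \<and> x = game_input n (parcs G0) (parcs G1) (F Bob) \<and>
    y = solution n G0 G1 F"
  using assms unfolding acyclic_2trg_winning_set_def acyclic_games_def game_input_def solution_def
  by (elim CollectE exE conjE Pair_inject) (intro exI conjI, assumption+)

lemma two_token_exponent:
  assumes "computable_with_exponent boolean_matrix_multiplication \<omega>"
  shows "computable_with_exponent acyclic_2trg_winning_set \<omega>"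
proof (rule computable_with_exponent_transfer[OF assms])
  fix T assume "computable_in_time boolean_matrix_multiplication T"
  then obtain c R where c: "\<And>s. multiplies c s (T s)" "regs_below R c"
    using ex_multiplication_program by blast
  \<comment> \<open>There are no labels here, so the degree in \<open>value_bound\<close> is
    0.\<close>
  define K where "K = (2 * R + 77) * (500000 * (0 + 14))"
  have "\<exists>t \<sigma> L. exec (two_token_prog R c) (init_state x) t \<sigma> \<and> has_output \<sigma> y \<and>
        2 ^ L \<le> 4 * n + 1 \<and> t \<le> K * (Suc L ^ 2 * level_time T L)"
    if inst: "(x, y) \<in> acyclic_2trg_winning_set n" for n x y
  proof -
    obtain G0 G1 F where game: "acyclic_games n G0 G1 F"
      and x: "x = game_input n (parcs G0) (parcs G1) (F Bob)" and y: "y = solution n G0 G1 F"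
      using acyclic_2trg_winning_setD[OF inst] by blast
    define L where "L = level_of n"
    define N where "N = (2::nat) ^ L"
    define M where "M = value_bound 0 L"
    have nN: "2 * n \<le> N" using level_of[of n] by (simp add: N_def L_def)
    have M: "2 * (N * N * N) + 3 * (N * N) + 10 \<le> M" "tick M \<le> 500000 * (0 + 14) * Suc L"
      using value_bound[OF N_def] unfolding M_def by blast+
    have NM: "n \<le> M" "1 \<le> M"
    proof -
      have "N \<le> N * N" by (simp add: N_def)
      then show "n \<le> M" "1 \<le> M" using M(1) nN by linarith+
    qed
    have "hoare (two_token_prog R c) ((2 * R + 77) * (Suc L * level_time T L) * tick M) (\<lambda>_. 0) (arr (init_state x))
      (\<lambda>\<rho>' \<alpha>'. \<rho>' 1 = n \<and> (\<forall>k<8 * (n * n). \<alpha>' 1 k = solution n G0 G1 F ! k))"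
    proof (rule hoare_two_token[OF c game L_def N_def M(1)])
      show "arr (init_state x) 0 k \<le> M" for k
        using game_input_le[of k n "parcs G0" "parcs G1" "F Bob" M] NM by (simp add: init_state_def x)
    qed (auto simp: init_state_def x)
    from hoare_init_state[OF this] obtain t \<sigma>
      where t: "exec (two_token_prog R c) (init_state x) t \<sigma>" "t \<le> (2 * R + 77) * (Suc L * level_time T L) * tick M"
        and out: "\<forall>k<8 * (n * n). arr \<sigma> 1 k = solution n G0 G1 F ! k" by blast
    have "(2 * R + 77) * (Suc L * level_time T L) * tick M \<le>
        (2 * R + 77) * (Suc L * level_time T L) * (500000 * (0 + 14) * Suc L)"
      using M(2) by (rule mult_le_mono2)
    also have "\<dots> = K * (Suc L ^ 2 * level_time T L)"
      by (simp add: K_def power2_eq_square mult_ac del: mult_Suc mult_Suc_right)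
    finally have "t \<le> K * (Suc L ^ 2 * level_time T L)" using t(2) by linarith
    moreover have "has_output \<sigma> y" using out by (simp add: has_output_def y)
    moreover have "2 ^ L \<le> 4 * n + 1" unfolding L_def by (rule power_level_of_le)
    ultimately show ?thesis using t(1) by blast
  qed
  then show "\<exists>c K. \<forall>n. \<forall>(x, y)\<in>acyclic_2trg_winning_set n. \<exists>t \<sigma> L. exec c (init_state x) t \<sigma> \<and>
      has_output \<sigma> y \<and> 2 ^ L \<le> 4 * n + 1 \<and> t \<le> K * (Suc L ^ 2 * level_time T L)"
    by (intro exI[of _ "two_token_prog R c"] exI[of _ K]) auto
qed

section \<open>Simulation as a two-token game\<close>

lemma scattered_shift:
  "scattered A (\<lambda>k. c + k) g n = (\<lambda>x. if c \<le> x \<and> x < c + n then g (x - c) else A x)"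
proof
  fix x show "scattered A (\<lambda>k. c + k) g n x = (if c \<le> x \<and> x < c + n then g (x - c) else A x)"
    by (induction n) auto
qed

text \<open>Truncated differences in both directions add up to the distance, which is 0 exactly for
  equal labels.\<close>

definition label_eq_ex :: ex where
  "label_eq_ex = is_zero ((Ar 13 (Rg 20 \<oslash> Rg 1) \<ominus> Ar 13 (Rg 20 \<odot> Rg 1)) \<oplus>
     (Ar 13 (Rg 20 \<odot> Rg 1) \<ominus> Ar 13 (Rg 20 \<oslash> Rg 1)))"

abbreviation extract_prog :: com where
  "extract_prog \<equiv> fill 20 (Rg 1 \<otimes> Rg 1) 1 (Rg 20) (Ar 1 (Nm 6 \<otimes> (Rg 1 \<otimes> Rg 1) \<oplus> Rg 20))"

abbreviation solve_prog :: "nat \<Rightarrow> com \<Rightarrow> com" where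
  "solve_prog R c \<equiv> Seq (two_token_prog R c) extract_prog"

abbreviation bob_final_prog :: "nat \<Rightarrow> com \<Rightarrow> com" where
  "bob_final_prog R c \<equiv> Seq (fill 20 (Rg 1 \<otimes> Rg 1) 0 (Nm 1 \<oplus> Nm 3 \<otimes> (Rg 1 \<otimes> Rg 1) \<oplus> Rg 20) (Nm 0)) (solve_prog R c)"

abbreviation alice_final_prog :: "nat \<Rightarrow> com \<Rightarrow> com" where
  "alice_final_prog R c \<equiv> Seq (fill 20 (Rg 1 \<otimes> Rg 1) 0 (Nm 1 \<oplus> Nm 2 \<otimes> (Rg 1 \<otimes> Rg 1) \<oplus> Rg 20) label_eq_ex) (bob_final_prog R c)"

abbreviation copy_graph_prog :: "nat \<Rightarrow> com \<Rightarrow> com" where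
  "copy_graph_prog R c \<equiv> Seq (fill 20 (Rg 1 \<otimes> Rg 1) 0 (Nm 1 \<oplus> Rg 1 \<otimes> Rg 1 \<oplus> Rg 20) (Ar 0 (Nm 1 \<oplus> Rg 20))) (alice_final_prog R c)"

abbreviation save_labels_prog :: "nat \<Rightarrow> com \<Rightarrow> com" where
  "save_labels_prog R c \<equiv> Seq (fill 20 (Rg 1) 13 (Rg 20) (Ar 0 (Nm 1 \<oplus> Rg 1 \<otimes> Rg 1 \<oplus> Rg 20))) (copy_graph_prog R c)"

text \<open>The input is rewritten in place into that of the game. The second copy of the graph
  overwrites the labels, which are therefore saved before; the graph serves both players.\<close>

definition simulation_prog :: "nat \<Rightarrow> com \<Rightarrow> com" where
  "simulation_prog R c =
     Seq (assign 1 (Ar 0 (Nm 0)))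
    (save_labels_prog R c)"

definition valid_kripke :: "nat \<Rightarrow> nat \<Rightarrow> (nat, nat) kripke \<Rightarrow> bool" where
  "valid_kripke d n K \<longleftrightarrow> pair_fin_digraph (kripke_graph K) \<and> states K = {0..<n} \<and> acyclic (transitions K) \<and>
      (\<forall>s<n. labeling K s < n ^ d)"

definition simulation_input :: "nat \<Rightarrow> (nat, nat) kripke \<Rightarrow> nat list" where
  "simulation_input n K = n # encode_rel n (transitions K) @ map (labeling K) [0..<n]"

lemma acyclic_simulationD:
  assumes "(x, y) \<in> acyclic_simulation d n"
  shows "\<exists>K. valid_kripke d n K \<and> x = simulation_input n K \<and> y = row_major n (\<lambda>s t. simulates K t s)"
  using assms unfolding acyclic_simulation_def valid_kripke_def simulation_input_def
  by (elim CollectE exE conjE Pair_inject) (intro exI conjI, assumption+)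

lemma valid_kripke_game:
  assumes "valid_kripke d n K"
  shows "acyclic_games n (kripke_graph K) (kripke_graph K) (simulation_final K)"
proof -
  have "pverts (kripke_graph K) = states K" "parcs (kripke_graph K) = transitions K"
    by (simp_all add: kripke_graph_def)
  then show ?thesis
    using assms bipartition_simulation_final[of K]
    by (simp add: valid_kripke_def acyclic_games_def simulation_graph_def)
qed

text \<open>Three lists of \<open>2 * (n * n)\<close> entries precede the surviving set of Bob, and
  that list starts with the configurations in which Alice is to move.\<close>

lemma solution_simulates:
  assumes K: "valid_kripke d n K" and k: "k < n * n"
  shows "solution n (kripke_graph K) (kripke_graph K) (simulation_final K) ! (6 * (n * n) + k) =
    row_major n (\<lambda>s t. simulates K t s) ! k"
  using k by (simp add: solution_def nth_append encode_confs_def row_major_nth simulates_def simulation_graph_def)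

lemma hoare_simulation:
  assumes c: "\<And>s. 1 \<le> s \<Longrightarrow> multiplies c s (T s)" "regs_below R c"
    and K: "valid_kripke d n K" and L: "L = level_of n" "N = 2 ^ L"
    and M: "2 * (N * N * N) + 3 * (N * N) + 10 \<le> M" "N ^ d \<le> M"
  shows "hoare (simulation_prog R c) ((2 * R + 88) * (Suc L * level_time T L) * tick M) (\<lambda>_. 0)
    (arr (init_state (simulation_input n K)))
    (\<lambda>\<rho>' \<alpha>'. \<forall>k<n * n. \<alpha>' 1 k = row_major n (\<lambda>s t. simulates K t s) ! k)"
    (is "hoare _ _ ?\<rho> ?\<alpha> ?Q")
proof (rule hoare_mono)
  let ?G = "kripke_graph K" and ?F = "simulation_final K" and ?lab = "labeling K"
  let ?in = "\<lambda>z. if z < length (simulation_input n K) then simulation_input n K ! z else 0"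
  have nN: "2 * n \<le> N" using level_of[of n] by (simp add: L)
  have N1: "1 \<le> N" and NN4: "N * N = 4 ^ L" by (simp_all add: L(2) power_mult_distrib[symmetric])
  have NN: "N \<le> N * N" "1 \<le> N * N" using N1 by simp_all
  have nn: "n \<le> N" "n * n \<le> N * N" using nN by (auto intro: mult_le_mono)
  have M': "2 \<le> M" "10 \<le> M" "n \<le> M" "n * n \<le> M" "N * N \<le> M" using M(1) nn NN by linarith+
  have lab: "?lab s \<le> M" if "s < n" for s
  proof -
    have "?lab s < n ^ d" using K that by (simp add: valid_kripke_def)
    also have "\<dots> \<le> N ^ d" using nn(1) by (rule power_mono) simp
    finally show ?thesis using M(2) by simp
  qed
  have in_0: "?in 0 = n" by (simp add: simulation_input_def)
  have in_edge: "?in (Suc k) = of_bool ((k div n, k mod n) \<in> transitions K)" if "k < n * n" for k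
    using that by (simp add: simulation_input_def encode_rel_def nth_append row_major_nth)
  have in_lab: "?in (Suc (n * n + k)) = ?lab k" if "k < n" for k
    using that by (simp add: simulation_input_def encode_rel_def nth_append)
  have len: "length (simulation_input n K) = Suc (n * n + n)"
    by (simp add: simulation_input_def encode_rel_def)
  have in_M: "?in z \<le> M" for z
  proof -
    consider "z = 0" | k where "z = Suc k" "k < n * n" | k where "z = Suc (n * n + k)" "k < n"
      | "\<not> z < Suc (n * n + n)"
    proof -
      have "z = 0 \<or> (\<exists>k<q. z = Suc k) \<or> (\<exists>k<n. z = Suc (q + k)) \<or> \<not> z < Suc (q + n)" for q
        by presburger
      from this[of "n * n"] show ?thesis using that by blast
    qed
    then show ?thesis
    proof cases
      case 2
      show ?thesis unfolding 2(1) in_edge[OF 2(2)] using M' by simp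
    next
      case 3
      show ?thesis unfolding 3(1) in_lab[OF 3(2)] by (rule lab[OF 3(2)])
    qed (use in_0 M' len in auto)
  qed
  define \<rho>\<^sub>1 where "\<rho>\<^sub>1 = ?\<rho>(1 := n)"
  define \<rho>\<^sub>2 where "\<rho>\<^sub>2 = \<rho>\<^sub>1(20 := n, 20 + 1 := 0, 20 + 2 := n)"
  define \<rho>\<^sub>3 where "\<rho>\<^sub>3 = \<rho>\<^sub>2(20 := n * n, 20 + 1 := 0, 20 + 2 := n * n)"
  define \<rho>\<^sub>4 where "\<rho>\<^sub>4 = \<rho>\<^sub>3(20 := n * n, 20 + 1 := 0, 20 + 2 := n * n)"
  define \<rho>\<^sub>5 where "\<rho>\<^sub>5 = \<rho>\<^sub>4(20 := n * n, 20 + 1 := 0, 20 + 2 := n * n)"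
  have regs: "\<rho>\<^sub>1 1 = n" "\<rho>\<^sub>2 1 = n" "\<rho>\<^sub>3 1 = n" "\<rho>\<^sub>4 1 = n" "\<rho>\<^sub>5 1 = n"
    by (simp_all add: \<rho>\<^sub>1_def \<rho>\<^sub>2_def \<rho>\<^sub>3_def \<rho>\<^sub>4_def \<rho>\<^sub>5_def)
  define g2 :: "nat \<Rightarrow> nat" where "g2 k = of_bool (?lab (k div n) = ?lab (k mod n))" for k
  define \<alpha>\<^sub>2 where "\<alpha>\<^sub>2 = ?\<alpha>(13 := \<lambda>x. if x < n then ?lab x else ?\<alpha> 13 x)"
  define h1 where "h1 = (\<lambda>k. (1 + n * n) + k)"
  define g1 where "g1 k = ?in (Suc k)" for k
  define \<alpha>\<^sub>3 where "\<alpha>\<^sub>3 = \<alpha>\<^sub>2(0 := scattered (\<alpha>\<^sub>2 0) h1 g1 (n * n))"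
  define \<alpha>\<^sub>4 where "\<alpha>\<^sub>4 = \<alpha>\<^sub>3(0 := scattered (\<alpha>\<^sub>3 0) (\<lambda>k. (1 + 2 * (n * n)) + k) g2 (n * n))"
  define \<alpha>\<^sub>5 where "\<alpha>\<^sub>5 = \<alpha>\<^sub>4(0 := scattered (\<alpha>\<^sub>4 0) (\<lambda>k. (1 + 3 * (n * n)) + k) (\<lambda>_. 0) (n * n))"
  have \<alpha>0: "?\<alpha> 0 = ?in" "\<alpha>\<^sub>2 0 = ?in" by (simp_all add: \<alpha>\<^sub>2_def init_state_def)
  let ?T = "(2 * R + 77) * (Suc L * level_time T L) * tick M"
  have out: "hoare extract_prog ((n * n + 1) * tick M) \<rho>' \<alpha>' ?Q"
    if *: "\<rho>' 1 = n \<and> (\<forall>k<8 * (n * n). \<alpha>' 1 k = solution n ?G ?G ?F ! k)" for \<rho>' \<alpha>'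
  proof (rule hoare_table_tick[where g = "\<lambda>k. row_major n (\<lambda>s t. simulates K t s) ! k"])
    fix k assume k: "k < n * n"
    \<comment> \<open>The answer is moved to the front within the same array; at most the first
      \<open>n * n\<close> cells have been overwritten, so the source is intact.\<close>
    have "\<alpha>' 1 (6 * (n * n) + k) = row_major n (\<lambda>s t. simulates K t s) ! k"
      using * k solution_simulates[OF K k] by simp
    moreover have "row_major n (\<lambda>s t. simulates K t s) ! k \<le> M" using k M' by (simp add: row_major_nth)
    ultimately show "let \<rho>'' = \<rho>'(20 := k, 20 + 1 := n * n - k, 20 + 2 := n * n);
        \<alpha>'' = \<alpha>'(1 := \<lambda>x. if x < k then row_major n (\<lambda>s t. simulates K t s) ! x else \<alpha>' 1 x)
      in bounded M (Ar 1 (Nm 6 \<otimes> (Rg 1 \<otimes> Rg 1) \<oplus> Rg 20)) \<rho>'' \<alpha>'' \<and>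
        val (Ar 1 (Nm 6 \<otimes> (Rg 1 \<otimes> Rg 1) \<oplus> Rg 20)) \<rho>'' \<alpha>'' = row_major n (\<lambda>s t. simulates K t s) ! k"
      using * k M' by (simp add: Let_def)
  qed (use * M' in \<open>simp_all add: small_def\<close>)
  have \<alpha>\<^sub>5: "\<alpha>\<^sub>5 0 z = (if z < 1 + n * n then ?in z else if z < 1 + 2 * (n * n) then ?in (z - n * n)
      else if z < 1 + 3 * (n * n) then g2 (z - (1 + 2 * (n * n))) else if z < 1 + 4 * (n * n) then 0 else ?in z)" for z
    unfolding \<alpha>\<^sub>5_def \<alpha>\<^sub>4_def \<alpha>\<^sub>3_def fun_upd_same h1_def scattered_shift \<alpha>0 g1_def
    by (auto simp: Suc_diff_Suc not_less Suc_le_eq)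
  have game_in: "\<alpha>\<^sub>5 0 z = game_input n (parcs ?G) (parcs ?G) (?F Bob) ! z" if z: "z < 1 + 4 * (n * n)" for z
  proof -
    \<comment> \<open>No configuration with Bob to move is final for Bob, which is why the last
      quarter of the game matrices is filled with zeros.\<close>
    have F: "(Alice, u, w) \<in> ?F Bob \<longleftrightarrow> ?lab u = ?lab w" "(Bob, u, w) \<notin> ?F Bob" if "u < n" "w < n" for u w
      using K that by (auto simp: simulation_final_def Let_def valid_kripke_def)
    consider "z = 0" | k where "z = Suc k" "k < n * n" | k where "z = 1 + n * n + k" "k < n * n"
      | k where "z = 1 + 2 * (n * n) + k" "k < n * n" | k where "z = 1 + 3 * (n * n) + k" "k < n * n"
    proof -
      have "z = 0 \<or> (\<exists>k<q. z = Suc k) \<or> (\<exists>k<q. z = 1 + q + k) \<or> (\<exists>k<q. z = 1 + 2 * q + k) \<or>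
          (\<exists>k<q. z = 1 + 3 * q + k)" if "z < 1 + 4 * q" for q
        using that by presburger
      from this[OF z] show ?thesis using that by blast
    qed
    then show ?thesis
    proof cases
      case 1
      then show ?thesis using in_0 by (simp add: \<alpha>\<^sub>5 game_input_def)
    next
      case 2
      have "\<alpha>\<^sub>5 0 z = ?in (Suc k)" using 2 by (simp add: \<alpha>\<^sub>5)
      then show ?thesis
        using game_input_nth(2)[OF index_bounds[OF 2(2)]] 2
        unfolding in_edge[OF 2(2)] by (simp add: kripke_graph_def)
    next
      case 3
      have "\<alpha>\<^sub>5 0 z = ?in (Suc k)" using 3 by (simp add: \<alpha>\<^sub>5)
      then show ?thesis
        using game_input_nth(3)[OF index_bounds[OF 3(2)]] 3
        unfolding in_edge[OF 3(2)] by (simp add: kripke_graph_def)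
    next
      case 4
      then show ?thesis using game_input_nth(4)[OF index_bounds[OF 4(2)]] F(1)[OF index_bounds[OF 4(2)]]
        by (simp add: \<alpha>\<^sub>5 g2_def)
    next
      case 5
      then show ?thesis using game_input_nth(5)[OF index_bounds[OF 5(2)]] F(2)[OF index_bounds[OF 5(2)]]
        by (simp add: \<alpha>\<^sub>5)
    qed
  qed
  have g2M: "g2 z \<le> M" for z using M' by (simp add: g2_def)
  have "hoare (two_token_prog R c) ?T \<rho>\<^sub>5 \<alpha>\<^sub>5
    (\<lambda>\<rho>' \<alpha>'. \<rho>' 1 = n \<and> (\<forall>k<8 * (n * n). \<alpha>' 1 k = solution n ?G ?G ?F ! k))"
  proof (rule hoare_two_token[OF c valid_kripke_game[OF K] L M(1)])
    show "\<alpha>\<^sub>5 0 z \<le> M" for z using in_M g2M by (simp add: \<alpha>\<^sub>5)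
    show "\<alpha>\<^sub>5 a = (\<lambda>_. 0)" if "2 \<le> a" "a \<noteq> 13" for a
      using that by (simp add: \<alpha>\<^sub>5_def \<alpha>\<^sub>4_def \<alpha>\<^sub>3_def \<alpha>\<^sub>2_def init_state_def)
  qed (assumption | rule game_in)+
  then have 5: "hoare (solve_prog R c) (?T + (n * n + 1) * tick M) \<rho>\<^sub>5 \<alpha>\<^sub>5 ?Q"
    by (rule hoare_Seq) (rule out)
  have 4: "hoare (bob_final_prog R c)
    ((n * n + 1) * tick M + (?T + (n * n + 1) * tick M)) \<rho>\<^sub>4 \<alpha>\<^sub>4 ?Q"
    by (rule hoare_fill_Seq_tick[where h = "\<lambda>k. (1 + 3 * (n * n)) + k" and g = "\<lambda>_. 0"])
      (use 5 M' regs in \<open>simp_all add: small_def Let_def \<rho>\<^sub>5_def \<alpha>\<^sub>5_def\<close>)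
  have 3: "hoare (alice_final_prog R c)
    ((n * n + 1) * tick M + ((n * n + 1) * tick M + (?T + (n * n + 1) * tick M))) \<rho>\<^sub>3 \<alpha>\<^sub>3 ?Q"
  proof (rule hoare_fill_Seq_tick[where h = "\<lambda>k. (1 + 2 * (n * n)) + k" and g = g2])
    fix k assume k: "k < n * n"
    have "k div n < n" "k mod n < n" using index_bounds[OF k] by simp_all
    then show "let \<rho>' = \<rho>\<^sub>3(20 := k, 20 + 1 := n * n - k, 20 + 2 := n * n);
        \<alpha>' = \<alpha>\<^sub>3(0 := scattered (\<alpha>\<^sub>3 0) (\<lambda>k. (1 + 2 * (n * n)) + k) g2 k)
      in bounded M (Nm 1 \<oplus> Nm 2 \<otimes> (Rg 1 \<otimes> Rg 1) \<oplus> Rg 20) \<rho>' \<alpha>' \<and> bounded M label_eq_ex \<rho>' \<alpha>' \<and>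
        val (Nm 1 \<oplus> Nm 2 \<otimes> (Rg 1 \<otimes> Rg 1) \<oplus> Rg 20) \<rho>' \<alpha>' = (1 + 2 * (n * n)) + k \<and> val label_eq_ex \<rho>' \<alpha>' = g2 k"
      using k M' regs lab[of "k div n"] lab[of "k mod n"]
      by (auto simp: Let_def label_eq_ex_def \<alpha>\<^sub>3_def \<alpha>\<^sub>2_def g2_def)
  qed (use 4 M' regs in \<open>simp_all add: small_def label_eq_ex_def \<rho>\<^sub>4_def \<alpha>\<^sub>4_def\<close>)
  have 2: "hoare (copy_graph_prog R c)
    ((n * n + 1) * tick M + ((n * n + 1) * tick M + ((n * n + 1) * tick M + (?T + (n * n + 1) * tick M)))) \<rho>\<^sub>2 \<alpha>\<^sub>2 ?Q"
  proof (rule hoare_fill_Seq_tick[where h = h1 and g = g1])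
    fix k assume k: "k < n * n"
    \<comment> \<open>The copy writes behind cell \<open>n * n\<close> only and hence never changes
      the edges it still has to read.\<close>
    have "scattered (\<alpha>\<^sub>2 0) h1 g1 k (Suc k) = g1 k"
      unfolding h1_def scattered_shift \<alpha>0 g1_def using k by simp
    moreover have "g1 k \<le> M" unfolding g1_def by (rule in_M)
    moreover have "Suc (n * n + k) = h1 k" by (simp add: h1_def)
    ultimately show "let \<rho>' = \<rho>\<^sub>2(20 := k, 20 + 1 := n * n - k, 20 + 2 := n * n);
        \<alpha>' = \<alpha>\<^sub>2(0 := scattered (\<alpha>\<^sub>2 0) h1 g1 k)
      in bounded M (Nm 1 \<oplus> Rg 1 \<otimes> Rg 1 \<oplus> Rg 20) \<rho>' \<alpha>' \<and> bounded M (Ar 0 (Nm 1 \<oplus> Rg 20)) \<rho>' \<alpha>' \<and>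
        val (Nm 1 \<oplus> Rg 1 \<otimes> Rg 1 \<oplus> Rg 20) \<rho>' \<alpha>' = h1 k \<and> val (Ar 0 (Nm 1 \<oplus> Rg 20)) \<rho>' \<alpha>' = g1 k"
      using k M' regs unfolding Let_def by simp
  qed (use 3 M' regs in \<open>simp_all add: small_def \<rho>\<^sub>3_def \<alpha>\<^sub>3_def\<close>)
  have 1: "hoare (save_labels_prog R c)
    ((n + 1) * tick M + ((n * n + 1) * tick M + ((n * n + 1) * tick M + ((n * n + 1) * tick M +
      (?T + (n * n + 1) * tick M))))) \<rho>\<^sub>1 ?\<alpha> ?Q"
  proof (rule hoare_table_Seq_tick[where g = ?lab])
    fix k assume k: "k < n"
    have "?\<alpha> 0 (Suc (n * n + k)) = ?lab k" unfolding \<alpha>0 by (rule in_lab[OF k])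
    then show "let \<rho>' = \<rho>\<^sub>1(20 := k, 20 + 1 := n - k, 20 + 2 := n);
        \<alpha>' = ?\<alpha>(13 := \<lambda>x. if x < k then ?lab x else ?\<alpha> 13 x)
      in bounded M (Ar 0 (Nm 1 \<oplus> Rg 1 \<otimes> Rg 1 \<oplus> Rg 20)) \<rho>' \<alpha>' \<and>
        val (Ar 0 (Nm 1 \<oplus> Rg 1 \<otimes> Rg 1 \<oplus> Rg 20)) \<rho>' \<alpha>' = ?lab k"
      using k M' regs lab[OF k] unfolding Let_def by simp
  qed (use 2 M' regs in \<open>simp_all add: small_def \<rho>\<^sub>2_def \<alpha>\<^sub>2_def\<close>)
  have "?\<alpha> 0 0 = n" unfolding \<alpha>0 by (rule in_0)
  then show "hoare (simulation_prog R c) (tick M + ((n + 1) * tick M + ((n * n + 1) * tick M + ((n * n + 1) * tick M +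
     ((n * n + 1) * tick M + (?T + (n * n + 1) * tick M)))))) ?\<rho> ?\<alpha> ?Q"
    unfolding simulation_prog_def
    by (intro hoare_assign_tick) (use 1 M' in \<open>simp_all add: small_def \<rho>\<^sub>1_def\<close>)
  define X where "X = Suc L * level_time T L"
  have "N * N \<le> level_time T L" by (simp add: level_time_def NN4)
  then have X: "N * N \<le> X" by (simp add: X_def trans_le_add1)
  have "1 + ((n + 1) + (4 * (Y + 1) + (2 * R + 77) * X)) \<le> (2 * R + 88) * X"
    if "1 \<le> X" "Y \<le> X" "n \<le> X" for Y
    using that by (simp add: algebra_simps)
  from this[of "n * n"] X nn NN
  have "1 + ((n + 1) + (4 * (n * n + 1) + (2 * R + 77) * X)) \<le> (2 * R + 88) * X"
    by linarith
  then have "(1 + ((n + 1) + (4 * (n * n + 1) + (2 * R + 77) * X))) * tick M \<le> (2 * R + 88) * X * tick M"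
    by (rule mult_le_mono1)
  then show "tick M + ((n + 1) * tick M + ((n * n + 1) * tick M + ((n * n + 1) * tick M +
     ((n * n + 1) * tick M + (?T + (n * n + 1) * tick M))))) \<le> (2 * R + 88) * (Suc L * level_time T L) * tick M"
    unfolding X_def[symmetric] by (simp add: distrib_right)
qed simp

lemma simulation_exponent:
  assumes "computable_with_exponent boolean_matrix_multiplication \<omega>"
  shows "computable_with_exponent (acyclic_simulation d) \<omega>"
proof (rule computable_with_exponent_transfer[OF assms])
  fix T assume "computable_in_time boolean_matrix_multiplication T"
  then obtain c R where c: "\<And>s. multiplies c s (T s)" "regs_below R c"
    using ex_multiplication_program by blast
  define C where "C = (2 * R + 88) * (500000 * (d + 14))"
  have "\<exists>t \<sigma> L. exec (simulation_prog R c) (init_state x) t \<sigma> \<and> has_output \<sigma> y \<and>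
        2 ^ L \<le> 4 * n + 1 \<and> t \<le> C * (Suc L ^ 2 * level_time T L)"
    if inst: "(x, y) \<in> acyclic_simulation d n" for n x y
  proof -
    obtain K where K: "valid_kripke d n K" and x: "x = simulation_input n K"
      and y: "y = row_major n (\<lambda>s t. simulates K t s)"
      using acyclic_simulationD[OF inst] by blast
    define L where "L = level_of n"
    define N where "N = (2::nat) ^ L"
    define M where "M = value_bound d L"
    have M: "2 * (N * N * N) + 3 * (N * N) + 10 \<le> M" "N ^ d \<le> M" "tick M \<le> 500000 * (d + 14) * Suc L"
      using value_bound[OF N_def] unfolding M_def by blast+
    from hoare_init_state[OF hoare_simulation[where T = T, OF c K L_def N_def M(1,2)]]
    obtain t \<sigma> where t: "exec (simulation_prog R c) (init_state x) t \<sigma>" "t \<le> (2 * R + 88) * (Suc L * level_time T L) * tick M"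
      and out: "\<forall>k<n * n. arr \<sigma> 1 k = row_major n (\<lambda>s t. simulates K t s) ! k" unfolding x by blast
    have "(2 * R + 88) * (Suc L * level_time T L) * tick M \<le>
        (2 * R + 88) * (Suc L * level_time T L) * (500000 * (d + 14) * Suc L)"
      using M(3) by (rule mult_le_mono2)
    also have "\<dots> = C * (Suc L ^ 2 * level_time T L)"
      by (simp add: C_def power2_eq_square mult_ac del: mult_Suc mult_Suc_right)
    finally have "t \<le> C * (Suc L ^ 2 * level_time T L)" using t(2) by linarith
    moreover have "has_output \<sigma> y" using out by (simp add: has_output_def y)
    moreover have "2 ^ L \<le> 4 * n + 1" unfolding L_def by (rule power_level_of_le)
    ultimately show ?thesis using t(1) by blast
  qed
  then show "\<exists>c K. \<forall>n. \<forall>(x, y)\<in>acyclic_simulation d n. \<exists>t \<sigma> L. exec c (init_state x) t \<sigma> \<and>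
      has_output \<sigma> y \<and> 2 ^ L \<le> 4 * n + 1 \<and> t \<le> K * (Suc L ^ 2 * level_time T L)"
    by (intro exI[of _ "simulation_prog R c"] exI[of _ C]) auto
qed

theorem theorem16:
  fixes \<omega> :: real
  assumes "computable_with_exponent boolean_matrix_multiplication \<omega>"
  shows "(\<forall>d. computable_with_exponent (acyclic_simulation d) \<omega>) \<and>
    computable_with_exponent acyclic_2trg_winning_set \<omega>"
  using simulation_exponent[OF assms] two_token_exponent[OF assms] by blast

end
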